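(* The Eilenberg–Moore category $\mathbf{DOM}^{\mathcal{M}}$ of the monad $\mathcal{M}$ over $\mathbf{DOM}$ is isomorphic to the category of continuous Kegelspitzen and Scott-continuous linear maps.
   Context: $\mathbf{DOM}$ is the category of continuous dcpo's (domains) and Scott-continuous maps. For a dcpo $D$: $\mathcal{V} D$ is the dcpo of subprobability valuations on $(D,\sigma D)$ (Scott-continuous maps $\nu\colon\sigma D\to[0,1]$ with $\nu(\emptyset)=0$ and $\nu(U)+\nu(V)=\nu(U\cup V)+\nu(U\cap V)$, pointwise order); $\mathcal{M} D$ is the intersection of all sub-dcpo's of $\mathcal{V} D$ containing the simple valuations $\sum_i r_i\delta_{x_i}$ ($r_i>0$, $\sum r_i\le1$, $\delta_x$ Dirac). $\mathcal{M}$ is a monad with unit $x\mapsto\delta_x$ and multiplication $\mu_D(\varpi)=\lambda U.\int_\nu\nu(U)\,d\varpi$ (with $\int f\,d\nu=\int_0^1\nu(f^{-1}((t,1]))dt$); it restricts to a monad on $\mathbf{DOM}$. A barycentric algebra is a set with operations $+_r$ ($r\in[0,1]$) satisfying $a+_1b=a$, $a+_rb=b+_{1-r}a$, $a+_ra=a$, $(a+_pb)+_rc=a+_{pr}(b+_{\frac{r-pr}{1-pr}}c)$ for $r,p<1$; pointed if it has a distinguished element $\bot$, with $r\cdot a:=a+_r\bot$; a map is linear if it preserves $\bot$ and each $+_r$. A Kegelspitze is a pointed barycentric algebra with a dcpo order such that $(a,b)\mapsto a+_rb$ and $(r,a)\mapsto r\cdot a$ are Scott-continuous in each argument; it is continuous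 if the order is a domain. *)

theory Defs
  imports "HOL-Analysis.Analysis"
begin

section \<open>Categories\<close>

record ('o, 'm) cat =
  Ob :: "'o set"
  Hom :: "'o \<Rightarrow> 'o \<Rightarrow> 'm set"
  Ident :: "'o \<Rightarrow> 'm"
  Comp :: "'o \<Rightarrow> 'o \<Rightarrow> 'o \<Rightarrow> 'm \<Rightarrow> 'm \<Rightarrow> 'm"

text \<open>\<open>Comp C X Y Z g f\<close> is the composite of \<open>f : X \<rightarrow> Y\<close> followed by \<open>g : Y \<rightarrow> Z\<close>.  Hom-sets of
  different pairs of objects may overlap; all operations carry their objects explicitly.\<close>

definition category :: "('o, 'm) cat \<Rightarrow> bool" where
  "category C \<longleftrightarrow>
     (\<forall>X\<in>Ob C. Ident C X \<in> Hom C X X) \<and>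
     (\<forall>X\<in>Ob C. \<forall>Y\<in>Ob C. \<forall>Z\<in>Ob C. \<forall>f\<in>Hom C X Y. \<forall>g\<in>Hom C Y Z.
        Comp C X Y Z g f \<in> Hom C X Z) \<and>
     (\<forall>X\<in>Ob C. \<forall>Y\<in>Ob C. \<forall>f\<in>Hom C X Y.
        Comp C X X Y f (Ident C X) = f \<and> Comp C X Y Y (Ident C Y) f = f) \<and>
     (\<forall>W\<in>Ob C. \<forall>X\<in>Ob C. \<forall>Y\<in>Ob C. \<forall>Z\<in>Ob C.
        \<forall>f\<in>Hom C W X. \<forall>g\<in>Hom C X Y. \<forall>h\<in>Hom C Y Z.
          Comp C W Y Z h (Comp C W X Y g f) = Comp C W X Z (Comp C X Y Z h g) f)"

definition is_functor ::
  "('o, 'm) cat \<Rightarrow> ('p, 'n) cat \<Rightarrow> ('o \<Rightarrow> 'p) \<Rightarrow> ('o \<Rightarrow> 'o \<Rightarrow> 'm \<Rightarrow> 'n) \<Rightarrow> bool" where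
  "is_functor C D Fo Fm \<longleftrightarrow>
     (\<forall>X\<in>Ob C. Fo X \<in> Ob D) \<and>
     (\<forall>X\<in>Ob C. \<forall>Y\<in>Ob C. \<forall>f\<in>Hom C X Y. Fm X Y f \<in> Hom D (Fo X) (Fo Y)) \<and>
     (\<forall>X\<in>Ob C. Fm X X (Ident C X) = Ident D (Fo X)) \<and>
     (\<forall>X\<in>Ob C. \<forall>Y\<in>Ob C. \<forall>Z\<in>Ob C. \<forall>f\<in>Hom C X Y. \<forall>g\<in>Hom C Y Z.
        Fm X Z (Comp C X Y Z g f) = Comp D (Fo X) (Fo Y) (Fo Z) (Fm Y Z g) (Fm X Y f))"

definition isomorphic_categories :: "('o, 'm) cat \<Rightarrow> ('p, 'n) cat \<Rightarrow> bool" where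
  "isomorphic_categories C D \<longleftrightarrow>
     category C \<and> category D \<and>
     (\<exists>Fo Fm Go Gm.
        is_functor C D Fo Fm \<and> is_functor D C Go Gm \<and>
        (\<forall>X\<in>Ob C. Go (Fo X) = X) \<and>
        (\<forall>X\<in>Ob C. \<forall>Y\<in>Ob C. \<forall>f\<in>Hom C X Y. Gm (Fo X) (Fo Y) (Fm X Y f) = f) \<and>
        (\<forall>A\<in>Ob D. Fo (Go A) = A) \<and>
        (\<forall>A\<in>Ob D. \<forall>B\<in>Ob D. \<forall>g\<in>Hom D A B. Fm (Go A) (Go B) (Gm A B g) = g))"


section \<open>Dcpos, Scott topology and domains\<close>

text \<open>A poset is given by its order relation \<open>P\<close>; its underlying set is \<open>Field P\<close>.\<close>

definition directed :: "'a rel \<Rightarrow> 'a set \<Rightarrow> bool" where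
  "directed P T \<longleftrightarrow> T \<subseteq> Field P \<and> T \<noteq> {} \<and> (\<forall>x\<in>T. \<forall>y\<in>T. \<exists>z\<in>T. (x, z) \<in> P \<and> (y, z) \<in> P)"

definition is_lub :: "'a rel \<Rightarrow> 'a set \<Rightarrow> 'a \<Rightarrow> bool" where
  "is_lub P T x \<longleftrightarrow>
     x \<in> Field P \<and> (\<forall>t\<in>T. (t, x) \<in> P) \<and> (\<forall>y\<in>Field P. (\<forall>t\<in>T. (t, y) \<in> P) \<longrightarrow> (x, y) \<in> P)"

definition dcpo :: "'a rel \<Rightarrow> bool" where
  "dcpo P \<longleftrightarrow> Partial_order P \<and> (\<forall>T. directed P T \<longrightarrow> (\<exists>x. is_lub P T x))"

definition sub_dcpo :: "'a rel \<Rightarrow> 'a set \<Rightarrow> bool" where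
  "sub_dcpo P S \<longleftrightarrow>
     S \<subseteq> Field P \<and> (\<forall>T x. T \<subseteq> S \<longrightarrow> directed P T \<longrightarrow> is_lub P T x \<longrightarrow> x \<in> S)"

definition scott_continuous :: "'a rel \<Rightarrow> 'b rel \<Rightarrow> ('a \<Rightarrow> 'b) \<Rightarrow> bool" where
  "scott_continuous P Q f \<longleftrightarrow>
     f \<in> Field P \<rightarrow> Field Q \<and>
     (\<forall>x y. (x, y) \<in> P \<longrightarrow> (f x, f y) \<in> Q) \<and>
     (\<forall>T x. directed P T \<longrightarrow> is_lub P T x \<longrightarrow> is_lub Q (f ` T) (f x))"

definition scott_opens :: "'a rel \<Rightarrow> 'a set set" where
  "scott_opens P = {U. U \<subseteq> Field P \<and>
     (\<forall>x y. x \<in> U \<longrightarrow> (x, y) \<in> P \<longrightarrow> y \<in> U) \<and>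
     (\<forall>T x. directed P T \<longrightarrow> is_lub P T x \<longrightarrow> x \<in> U \<longrightarrow> T \<inter> U \<noteq> {})}"

definition way_below :: "'a rel \<Rightarrow> 'a \<Rightarrow> 'a \<Rightarrow> bool" where
  "way_below P x y \<longleftrightarrow> x \<in> Field P \<and> y \<in> Field P \<and>
     (\<forall>T z. directed P T \<longrightarrow> is_lub P T z \<longrightarrow> (y, z) \<in> P \<longrightarrow> (\<exists>t\<in>T. (x, t) \<in> P))"

definition continuous_domain :: "'a rel \<Rightarrow> bool" where
  "continuous_domain P \<longleftrightarrow> dcpo P \<and>
     (\<forall>x\<in>Field P. directed P {y. way_below P y x} \<and> is_lub P {y. way_below P y x} x)"

definition unit_interval :: "real rel" where
  "unit_interval = {(s, t). 0 \<le> s \<and> s \<le> t \<and> t \<le> 1}"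

definition inclusion_order :: "'a set set \<Rightarrow> 'a set rel" where
  "inclusion_order \<U> = {(U, V). U \<in> \<U> \<and> V \<in> \<U> \<and> U \<subseteq> V}"


section \<open>The valuation monads\<close>

text \<open>Maps between given sets (valuations, morphisms, algebra structures, operations) are
  represented extensionally, i.e. with value \<^term>\<open>undefined\<close> outside their domain, so that equality
  of representatives is equality of maps.\<close>

definition valuations :: "'a rel \<Rightarrow> ('a set \<Rightarrow> real) set" where
  "valuations P = {\<nu> \<in> extensional (scott_opens P).
     scott_continuous (inclusion_order (scott_opens P)) unit_interval \<nu> \<and>
     \<nu> {} = 0 \<and>
     (\<forall>U\<in>scott_opens P. \<forall>V\<in>scott_opens P. \<nu> U + \<nu> V = \<nu> (U \<union> V) + \<nu> (U \<inter> V))}"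

definition val_dcpo :: "'a rel \<Rightarrow> ('a set \<Rightarrow> real) rel" where
  "val_dcpo P = {(\<nu>, \<xi>). \<nu> \<in> valuations P \<and> \<xi> \<in> valuations P \<and> (\<forall>U\<in>scott_opens P. \<nu> U \<le> \<xi> U)}"

definition dirac :: "'a rel \<Rightarrow> 'a \<Rightarrow> 'a set \<Rightarrow> real" where
  "dirac P x = (\<lambda>U\<in>scott_opens P. indicator U x)"

text \<open>The empty sum (\<open>n = 0\<close>), i.e. the zero valuation, is a simple valuation.\<close>

definition simple_valuations :: "'a rel \<Rightarrow> ('a set \<Rightarrow> real) set" where
  "simple_valuations P =
     {(\<lambda>U\<in>scott_opens P. \<Sum>i<n. c i * dirac P (x i) U) | (n::nat) c x.
        (\<forall>i<n. 0 < c i \<and> x i \<in> Field P) \<and> (\<Sum>i<n. c i) \<le> 1}"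

definition M_dcpo :: "'a rel \<Rightarrow> ('a set \<Rightarrow> real) rel" where
  "M_dcpo P = Restr (val_dcpo P)
     (\<Inter>{S. sub_dcpo (val_dcpo P) S \<and> simple_valuations P \<subseteq> S})"

definition M_map :: "'a rel \<Rightarrow> 'b rel \<Rightarrow> ('a \<Rightarrow> 'b) \<Rightarrow> ('a set \<Rightarrow> real) \<Rightarrow> 'b set \<Rightarrow> real" where
  "M_map P Q f \<nu> = (\<lambda>V\<in>scott_opens Q. \<nu> {x \<in> Field P. f x \<in> V})"

text \<open>The integral of a Scott-continuous \<open>f\<close> from \<open>P\<close> to the unit interval.\<close>

definition val_integral :: "'a rel \<Rightarrow> ('a set \<Rightarrow> real) \<Rightarrow> ('a \<Rightarrow> real) \<Rightarrow> real" where
  "val_integral P \<nu> f = integral {0..1} (\<lambda>t. \<nu> {x \<in> Field P. f x \<in> {t<..1}})"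

definition M_mult :: "'a rel \<Rightarrow> (('a set \<Rightarrow> real) set \<Rightarrow> real) \<Rightarrow> 'a set \<Rightarrow> real" where
  "M_mult P \<pi> = (\<lambda>U\<in>scott_opens P. val_integral (M_dcpo P) \<pi> (\<lambda>\<nu>. \<nu> U))"


section \<open>The Eilenberg--Moore category over domains\<close>

text \<open>A type \<^typ>\<open>'a\<close> plays the role of the universe of points.  \<open>M_dcpo P\<close> lives on another type
  than \<open>P\<close>, but the Eilenberg--Moore laws only involve \<open>P\<close>, \<open>M_dcpo P\<close> and
  \<open>M_dcpo (M_dcpo P)\<close>.\<close>

type_synonym 'a em_object = "'a rel \<times> (('a set \<Rightarrow> real) \<Rightarrow> 'a)"

definition em_algebra :: "'a em_object \<Rightarrow> bool" where
  "em_algebra = (\<lambda>(P, \<beta>).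
     continuous_domain P \<and>
     \<beta> \<in> extensional (Field (M_dcpo P)) \<and> scott_continuous (M_dcpo P) P \<beta> \<and>
     (\<forall>x\<in>Field P. \<beta> (dirac P x) = x) \<and>
     (\<forall>\<pi>\<in>Field (M_dcpo (M_dcpo P)). \<beta> (M_mult P \<pi>) = \<beta> (M_map (M_dcpo P) P \<beta> \<pi>)))"

definition em_hom :: "'a em_object \<Rightarrow> 'a em_object \<Rightarrow> ('a \<Rightarrow> 'a) set" where
  "em_hom = (\<lambda>(P, \<beta>) (Q, \<gamma>). {f \<in> extensional (Field P).
     scott_continuous P Q f \<and> (\<forall>\<nu>\<in>Field (M_dcpo P). f (\<beta> \<nu>) = \<gamma> (M_map P Q f \<nu>))})"

definition DOM_M :: "('a em_object, 'a \<Rightarrow> 'a) cat" where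
  "DOM_M = \<lparr>Ob = {X. em_algebra X}, Hom = em_hom,
     Ident = (\<lambda>X. \<lambda>x\<in>Field (fst X). x),
     Comp = (\<lambda>X Y Z g f. compose (Field (fst X)) g f)\<rparr>"


section \<open>Continuous Kegelspitzen\<close>

definition barycentric_algebra :: "'a set \<Rightarrow> (real \<Rightarrow> 'a \<Rightarrow> 'a \<Rightarrow> 'a) \<Rightarrow> bool" where
  "barycentric_algebra A pl \<longleftrightarrow>
     pl \<in> {0..1} \<rightarrow>\<^sub>E A \<rightarrow>\<^sub>E A \<rightarrow>\<^sub>E A \<and>
     (\<forall>a\<in>A. \<forall>b\<in>A. pl 1 a b = a) \<and>
     (\<forall>r\<in>{0..1}. \<forall>a\<in>A. \<forall>b\<in>A. pl r a b = pl (1 - r) b a) \<and>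
     (\<forall>r\<in>{0..1}. \<forall>a\<in>A. pl r a a = a) \<and>
     (\<forall>p\<in>{0..<1}. \<forall>r\<in>{0..<1}. \<forall>a\<in>A. \<forall>b\<in>A. \<forall>c\<in>A.
        pl r (pl p a b) c = pl (p * r) a (pl ((r - p * r) / (1 - p * r)) b c))"

record 'a kegel =
  ord :: "'a rel"
  plus_op :: "real \<Rightarrow> 'a \<Rightarrow> 'a \<Rightarrow> 'a"
  bt :: 'a

definition scale :: "'a kegel \<Rightarrow> real \<Rightarrow> 'a \<Rightarrow> 'a" where
  "scale K r a = plus_op K r a (bt K)"

definition kegelspitze :: "'a kegel \<Rightarrow> bool" where
  "kegelspitze K \<longleftrightarrow>
     dcpo (ord K) \<and> barycentric_algebra (Field (ord K)) (plus_op K) \<and> bt K \<in> Field (ord K) \<and>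
     (\<forall>r\<in>{0..1}. \<forall>b\<in>Field (ord K). scott_continuous (ord K) (ord K) (\<lambda>a. plus_op K r a b)) \<and>
     (\<forall>r\<in>{0..1}. \<forall>a\<in>Field (ord K). scott_continuous (ord K) (ord K) (\<lambda>b. plus_op K r a b)) \<and>
     (\<forall>a\<in>Field (ord K). scott_continuous unit_interval (ord K) (\<lambda>r. scale K r a)) \<and>
     (\<forall>r\<in>{0..1}. scott_continuous (ord K) (ord K) (\<lambda>a. scale K r a))"

definition continuous_kegelspitze :: "'a kegel \<Rightarrow> bool" where
  "continuous_kegelspitze K \<longleftrightarrow> kegelspitze K \<and> continuous_domain (ord K)"

definition linear_map :: "'a kegel \<Rightarrow> 'b kegel \<Rightarrow> ('a \<Rightarrow> 'b) \<Rightarrow> bool" where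
  "linear_map K L f \<longleftrightarrow>
     f \<in> Field (ord K) \<rightarrow> Field (ord L) \<and> f (bt K) = bt L \<and>
     (\<forall>r\<in>{0..1}. \<forall>a\<in>Field (ord K). \<forall>b\<in>Field (ord K).
        f (plus_op K r a b) = plus_op L r (f a) (f b))"

definition CKS :: "('a kegel, 'a \<Rightarrow> 'a) cat" where
  "CKS = \<lparr>Ob = {K. continuous_kegelspitze K},
     Hom = (\<lambda>K L. {f \<in> extensional (Field (ord K)).
              scott_continuous (ord K) (ord L) f \<and> linear_map K L f}),
     Ident = (\<lambda>K. \<lambda>x\<in>Field (ord K). x),
     Comp = (\<lambda>K L N g f. compose (Field (ord K)) g f)\<rparr>"

end

theory Submission
  imports Defs
begin

text \<open>An algebra structure \<open>\<beta> : M P \<rightarrow> P\<close> and a Kegelspitze structure on \<open>P\<close> determine each other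
  through \<open>a +\<^sub>r b = \<beta> (r \<delta>\<^sub>a + (1 - r) \<delta>\<^sub>b)\<close> and \<open>\<bottom> = \<beta> 0\<close>.  Since \<open>M P\<close> is the least sub-dcpo
  containing the simple valuations, Scott-continuous maps on \<open>M P\<close> that agree on simple valuations
  are equal; this yields uniqueness of \<open>\<beta>\<close>, its linearity and the multiplication law.

  For existence, \<open>\<beta> \<nu>\<close> is the supremum of the barycentres of the simple valuations
  \<open>\<Sum>\<^sub>i c\<^sub>i \<delta>\<^bsub>x i\<^esub>\<close> such that every nonempty set \<open>I\<close> of indices satisfies
  \<open>\<Sum>\<^bsub>i \<in> I\<^esub> c\<^sub>i < \<nu> (\<Union>\<^bsub>i \<in> I\<^esub> {y. x\<^sub>i \<lless> y})\<close>.  Only finitely many strict inequalities are involved, hence this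
  relation is inaccessible by directed suprema of \<open>\<nu>\<close>, which gives both directedness (reduced to
  simple \<open>\<nu>\<close>, where one shrinks the weights and the points slightly) and Scott continuity.  That
  barycentres are monotone is Jones' splitting lemma, i.e. a fractional Hall theorem: comparable simple
  valuations are related by a transport plan along the order.\<close>

section \<open>Transport and the free cone over a barycentric algebra\<close>

text \<open>A barycentric algebra need not be cancellative, nor embed in a vector space, so finite
  convex sums cannot be computed as linear combinations. The substitute is a cone of weighted points
  made into a total commutative monoid. Mass missing from 1 is booked as weight at bottom; every
  barycentre then has total weight 1, and a transport plan becomes a termwise comparison of two
  decompositions of the same unit of mass.

  The second obstacle is that \<open>M P\<close> is given only as a closure: a member need not be
  visible as one directed supremum of simple valuations. Hence \<open>\<beta>\<close> is not built
  by continuous extension from a chosen family below \<open>\<nu>\<close>. It is a supremum over all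
  approximants at once, which makes sense for every \<open>\<nu>\<close> as soon as these are known
  to have directed barycentres, and that is proved by induction along the closure.

  The operations of a Kegelspitze are Scott-continuous only in each argument separately, so limits
  are taken in one point or one valuation at a time throughout.\<close>

definition transport ::
  "('i \<Rightarrow> 'j \<Rightarrow> bool) \<Rightarrow> 'i set \<Rightarrow> 'j set \<Rightarrow> ('i \<Rightarrow> real) \<Rightarrow> ('j \<Rightarrow> real) \<Rightarrow> ('i \<Rightarrow> 'j \<Rightarrow> real) \<Rightarrow> bool"
where
  "transport R I J c d t \<longleftrightarrow>
     (\<forall>i\<in>I. \<forall>j\<in>J. 0 \<le> t i j \<and> (0 < t i j \<longrightarrow> R i j)) \<and>
     (\<forall>i\<in>I. sum (t i) J = c i) \<and> (\<forall>j\<in>J. (\<Sum>i\<in>I. t i j) \<le> d j)"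

text \<open>Induction on the number of sources and targets. As much mass as Hall's condition permits
  is moved along one edge from \<open>i0\<close> to \<open>j0\<close>, until the source is empty,
  the target is full, or a set of sources has become tight. The first two cases delete a vertex; a
  tight set splits the problem into two independent ones.\<close>

lemma fractional_hall:
  fixes c :: "'i \<Rightarrow> real" and d :: "'j \<Rightarrow> real"
  assumes "finite I" "finite J" "\<forall>i\<in>I. 0 \<le> c i" "\<forall>j\<in>J. 0 \<le> d j"
    and "\<forall>S\<subseteq>I. sum c S \<le> sum d {j\<in>J. \<exists>i\<in>S. R i j}"
  shows "\<exists>t. transport R I J c d t"
  using assms
proof (induction "card I + card J" arbitrary: I J c d rule: less_induct)
  case less
  note fin = less.prems(1,2) and nn = less.prems(3,4) and hall = less.prems(5)
  let ?N = "\<lambda>S. {j\<in>J. \<exists>i\<in>S. R i j}"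
  have source: "\<exists>t. transport R I J c' d' t"
    if i0: "i0 \<in> I" "c' i0 = 0" and h: "\<forall>i\<in>I. 0 \<le> c' i" "\<forall>j\<in>J. 0 \<le> d' j"
      "\<forall>S\<subseteq>I. sum c' S \<le> sum d' (?N S)" for c' :: "'i \<Rightarrow> real" and d' :: "'j \<Rightarrow> real" and i0
  proof -
    have "card (I - {i0}) + card J < card I + card J"
      using card_Diff1_less[OF fin(1) i0(1)] by linarith
    then have "\<exists>t. transport R (I - {i0}) J c' d' t"
      by (intro less.hyps) (use fin h(1,2) h(3)[rule_format] in auto)
    then obtain t where t: "transport R (I - {i0}) J c' d' t" by blast
    note t = t[unfolded transport_def]
    have "transport R I J c' d' (\<lambda>i j. if i = i0 then 0 else t i j)"
      unfolding transport_def
    proof (intro conjI ballI)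
      fix j assume "j \<in> J"
      have "(\<Sum>i\<in>I. if i = i0 then 0 else t i j) = (\<Sum>i\<in>I - {i0}. t i j)"
        using fin by (intro sum.mono_neutral_cong_right) auto
      then show "(\<Sum>i\<in>I. if i = i0 then 0 else t i j) \<le> d' j" using t \<open>j \<in> J\<close> by auto
    next
      fix i assume "i \<in> I"
      show "(\<Sum>j\<in>J. if i = i0 then 0 else t i j) = c' i"
      proof (cases "i = i0")
        case False
        then have "sum (t i) J = c' i" using t \<open>i \<in> I\<close> by auto
        then show ?thesis using False by simp
      qed (simp add: i0)
    qed (use t in auto)
    then show ?thesis by blast
  qed
  have target: "\<exists>t. transport R I J c' d' t"
    if j0: "j0 \<in> J" "d' j0 = 0" and h: "\<forall>i\<in>I. 0 \<le> c' i" "\<forall>j\<in>J. 0 \<le> d' j"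
      "\<forall>S\<subseteq>I. sum c' S \<le> sum d' (?N S)" for c' :: "'i \<Rightarrow> real" and d' :: "'j \<Rightarrow> real" and j0
  proof -
    have crd: "card I + card (J - {j0}) < card I + card J"
      using card_Diff1_less[OF fin(2) j0(1)] by linarith
    have hallJ: "sum c' S \<le> sum d' {j \<in> J - {j0}. \<exists>i\<in>S. R i j}" if "S \<subseteq> I" for S
    proof -
      have "sum d' (?N S) = sum d' {j \<in> J - {j0}. \<exists>i\<in>S. R i j}"
        using fin j0 by (intro sum.mono_neutral_right) auto
      then show ?thesis using h(3)[rule_format, OF that] by simp
    qed
    have "\<exists>t. transport R I (J - {j0}) c' d' t"
      using hallJ by (intro less.hyps[OF crd]) (use fin h(1,2) in simp_all)
    then obtain t where t: "transport R I (J - {j0}) c' d' t" by blast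
    note t = t[unfolded transport_def]
    have "transport R I J c' d' (\<lambda>i j. if j = j0 then 0 else t i j)"
      unfolding transport_def
    proof (intro conjI ballI)
      fix i assume "i \<in> I"
      have "(\<Sum>j\<in>J. if j = j0 then 0 else t i j) = (\<Sum>j\<in>J - {j0}. t i j)"
        using fin by (intro sum.mono_neutral_cong_right) auto
      then show "(\<Sum>j\<in>J. if j = j0 then 0 else t i j) = c' i" using t \<open>i \<in> I\<close> by auto
    next
      fix j assume "j \<in> J"
      then show "(\<Sum>i\<in>I. if j = j0 then 0 else t i j) \<le> d' j"
        using t j0 by (cases "j = j0") simp_all
    qed (use t in auto)
    then show ?thesis by blast
  qed
  have tight: "\<exists>t. transport R I J c' d' t"
    if S: "S \<subseteq> I" "S \<noteq> {}" "S \<noteq> I" "sum c' S = sum d' (?N S)"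
      and h: "\<forall>i\<in>I. 0 \<le> c' i" "\<forall>j\<in>J. 0 \<le> d' j"
      "\<forall>S\<subseteq>I. sum c' S \<le> sum d' (?N S)" for c' :: "'i \<Rightarrow> real" and d' :: "'j \<Rightarrow> real" and S
  proof -
    have fS: "finite S" "finite (?N S)" using S(1) fin by (auto intro: finite_subset)
    have cS: "card S < card I" using S(1-3) fin by (intro psubset_card_mono) auto
    have cN: "card (?N S) \<le> card J" using fin by (intro card_mono) auto
    have cIS: "card (I - S) < card I" using S(1-3) fin by (intro psubset_card_mono) auto
    have cJN: "card (J - ?N S) \<le> card J" using fin by (intro card_mono) auto
    have "\<exists>t. transport R S (?N S) c' d' t"
    proof (rule less.hyps)
      show "card S + card (?N S) < card I + card J" using cS cN by linarith
      show "\<forall>T\<subseteq>S. sum c' T \<le> sum d' {j \<in> ?N S. \<exists>i\<in>T. R i j}"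
      proof (intro allI impI)
        fix T assume "T \<subseteq> S"
        then have "{j \<in> ?N S. \<exists>i\<in>T. R i j} = ?N T" by auto
        then show "sum c' T \<le> sum d' {j \<in> ?N S. \<exists>i\<in>T. R i j}"
          using h(3)[rule_format, OF subset_trans[OF \<open>T \<subseteq> S\<close> S(1)]] by simp
      qed
    qed (use fS h(1,2) S(1) in auto)
    then obtain t1 where t1: "transport R S (?N S) c' d' t1" by blast
    have "\<exists>t. transport R (I - S) (J - ?N S) c' d' t"
    proof (rule less.hyps)
      show "card (I - S) + card (J - ?N S) < card I + card J" using cIS cJN by linarith
      show "\<forall>T\<subseteq>I - S. sum c' T \<le> sum d' {j \<in> J - ?N S. \<exists>i\<in>T. R i j}"
      proof (intro allI impI)
        fix T assume T: "T \<subseteq> I - S"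
        \<comment> \<open>Hall's condition for \<open>T \<union> S\<close> minus the tight equality
          for \<open>S\<close> is Hall's condition for \<open>T\<close> among the targets that are
          not neighbours of \<open>S\<close>.\<close>
        have "sum c' T + sum c' S = sum c' (T \<union> S)"
          using T fS fin by (subst sum.union_disjoint) (auto intro: finite_subset)
        also have "\<dots> \<le> sum d' (?N (T \<union> S))" using T S(1) by (intro h(3)[rule_format]) auto
        also have "?N (T \<union> S) = {j \<in> J - ?N S. \<exists>i\<in>T. R i j} \<union> ?N S" by auto
        also have "sum d' \<dots> = sum d' {j \<in> J - ?N S. \<exists>i\<in>T. R i j} + sum d' (?N S)"
          using fin by (intro sum.union_disjoint) auto
        finally show "sum c' T \<le> sum d' {j \<in> J - ?N S. \<exists>i\<in>T. R i j}" using S by linarith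
      qed
    qed (use fin h(1,2) in auto)
    then obtain t2 where t2: "transport R (I - S) (J - ?N S) c' d' t2" by blast
    define N where "N = ?N S"
    have NJ: "N \<subseteq> J" by (auto simp: N_def)
    have t1: "\<And>i j. i \<in> S \<Longrightarrow> j \<in> N \<Longrightarrow> 0 \<le> t1 i j \<and> (0 < t1 i j \<longrightarrow> R i j)"
        "\<And>i. i \<in> S \<Longrightarrow> sum (t1 i) N = c' i" "\<And>j. j \<in> N \<Longrightarrow> (\<Sum>i\<in>S. t1 i j) \<le> d' j"
      using t1 unfolding transport_def N_def by blast+
    have t2: "\<And>i j. i \<in> I - S \<Longrightarrow> j \<in> J - N \<Longrightarrow> 0 \<le> t2 i j \<and> (0 < t2 i j \<longrightarrow> R i j)"
        "\<And>i. i \<in> I - S \<Longrightarrow> sum (t2 i) (J - N) = c' i"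
        "\<And>j. j \<in> J - N \<Longrightarrow> (\<Sum>i\<in>I - S. t2 i j) \<le> d' j"
      using t2 unfolding transport_def N_def by blast+
    define t where "t = (\<lambda>i j. if i \<in> S then (if j \<in> N then t1 i j else 0)
                               else if j \<in> N then 0 else t2 i j)"
    have "transport R I J c' d' t"
      unfolding transport_def
    proof (intro conjI ballI)
      fix i j assume "i \<in> I" "j \<in> J"
      then show "0 \<le> t i j" "0 < t i j \<longrightarrow> R i j"
        using t1(1)[of i j] t2(1)[of i j] by (simp_all add: t_def)
    next
      fix i assume i: "i \<in> I"
      show "sum (t i) J = c' i"
      proof (cases "i \<in> S")
        case True
        then have "sum (t i) J = sum (t1 i) N"
          using fin(2) NJ by (intro sum.mono_neutral_cong_right) (auto simp: t_def)
        then show ?thesis using t1(2) True by simp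
      next
        case False
        then have "sum (t i) J = sum (t2 i) (J - N)"
          using fin(2) by (intro sum.mono_neutral_cong_right) (auto simp: t_def)
        then show ?thesis using t2(2) False i by simp
      qed
    next
      fix j assume j: "j \<in> J"
      show "(\<Sum>i\<in>I. t i j) \<le> d' j"
      proof (cases "j \<in> N")
        case True
        then have "(\<Sum>i\<in>I. t i j) = (\<Sum>i\<in>S. t1 i j)"
          using fin(1) S(1) by (intro sum.mono_neutral_cong_right) (auto simp: t_def)
        then show ?thesis using t1(3) True by simp
      next
        case False
        then have "(\<Sum>i\<in>I. t i j) = (\<Sum>i\<in>I - S. t2 i j)"
          using fin(1) by (intro sum.mono_neutral_cong_right) (auto simp: t_def)
        then show ?thesis using t2(3) False j by simp
      qed
    qed
    then show ?thesis by blast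
  qed
  show ?case
  proof (cases "\<exists>i0\<in>I. 0 < c i0")
    case False
    then have "transport R I J c d (\<lambda>i j. 0)" using nn by (auto simp: less_le transport_def)
    then show ?thesis by blast
  next
    case True
    then obtain i0 where i0: "i0 \<in> I" "0 < c i0" by blast
    have "0 < sum d (?N {i0})" using hall[rule_format, of "{i0}"] i0 by auto
    then have "?N {i0} \<noteq> {}" by (metis less_irrefl sum.empty)
    then obtain j0 where j0: "j0 \<in> J" "R i0 j0" by auto
    \<comment> \<open>For a set containing \<open>i0\<close> the target \<open>j0\<close> is a
      neighbour, so moving mass lowers both sides of its condition equally. Only sets that miss
      \<open>i0\<close> but have \<open>j0\<close> as a neighbour lose slack, and theirs bounds the
      amount moved.\<close>
    define slack where "slack = (\<lambda>S. sum d (?N S) - sum c S) ` {S. S \<subseteq> I \<and> i0 \<notin> S \<and> j0 \<in> ?N S}"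
    define m where "m = Min (insert (c i0) (insert (d j0) slack))"
    have "{S. S \<subseteq> I \<and> i0 \<notin> S \<and> j0 \<in> ?N S} \<subseteq> Pow I" by auto
    then have fsl: "finite slack" unfolding slack_def
      using fin(1) by (intro finite_imageI) (auto intro: finite_subset)
    have slackI: "sum d (?N S) - sum c S \<in> slack" if "S \<subseteq> I" "i0 \<notin> S" "j0 \<in> ?N S" for S
      unfolding slack_def using that by blast
    have m_le: "m \<le> u" if "u \<in> insert (c i0) (insert (d j0) slack)" for u
      unfolding m_def using fsl that by (intro Min_le) simp_all
    have mle: "m \<le> c i0" "m \<le> d j0" "\<And>S. S \<subseteq> I \<Longrightarrow> i0 \<notin> S \<Longrightarrow> j0 \<in> ?N S \<Longrightarrow> m \<le> sum d (?N S) - sum c S"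
      using m_le slackI by simp_all
    have m_in: "m \<in> insert (c i0) (insert (d j0) slack)" unfolding m_def using fsl by (intro Min_in) simp_all
    have "0 \<le> u" if u: "u \<in> slack" for u
    proof -
      obtain S where "S \<subseteq> I" "u = sum d (?N S) - sum c S" using u unfolding slack_def by blast
      then show ?thesis using hall[rule_format, of S] by simp
    qed
    then have m0: "0 \<le> m" using m_in nn i0 j0 by auto
    have mcases: "m = c i0 \<or> m = d j0 \<or> (\<exists>S. S \<subseteq> I \<and> i0 \<notin> S \<and> j0 \<in> ?N S \<and> m = sum d (?N S) - sum c S)"
      using m_in unfolding slack_def by blast
    define c' where "c' = c(i0 := c i0 - m)"
    define d' where "d' = d(j0 := d j0 - m)"
    have sc: "sum c' S = sum c S - (if i0 \<in> S then m else 0)" if "S \<subseteq> I" for S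
    proof -
      have "finite S" using that fin(1) by (rule finite_subset)
      have "c(i0 := c i0 - m) = (\<lambda>i. c i - (if i = i0 then m else 0))" by auto
      then show ?thesis unfolding c'_def using \<open>finite S\<close> by (simp add: sum_subtractf)
    qed
    have sd: "sum d' T = sum d T - (if j0 \<in> T then m else 0)" if "T \<subseteq> J" for T
    proof -
      have "finite T" using that fin(2) by (rule finite_subset)
      have "d(j0 := d j0 - m) = (\<lambda>i. d i - (if i = j0 then m else 0))" by auto
      then show ?thesis unfolding d'_def using \<open>finite T\<close> by (simp add: sum_subtractf)
    qed
    have h: "\<forall>i\<in>I. 0 \<le> c' i" "\<forall>j\<in>J. 0 \<le> d' j"
      using nn mle by (auto simp: c'_def d'_def)
    have h3: "\<forall>S\<subseteq>I. sum c' S \<le> sum d' (?N S)"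
    proof (intro allI impI)
      fix S assume S: "S \<subseteq> I"
      have sN: "sum d' (?N S) = sum d (?N S) - (if j0 \<in> ?N S then m else 0)" by (rule sd) auto
      consider "i0 \<in> S" | "i0 \<notin> S" "j0 \<in> ?N S" | "i0 \<notin> S" "j0 \<notin> ?N S" by blast
      then show "sum c' S \<le> sum d' (?N S)"
      proof cases
        case 1
        then have "j0 \<in> ?N S" using j0 by blast
        then show ?thesis using 1 sN sc[OF S] hall[rule_format, OF S] by simp
      next
        case 2
        then show ?thesis using sN sc[OF S] mle(3)[OF S] by simp
      next
        case 3
        have "sum d' (?N S) = sum d (?N S)" using sN unfolding if_not_P[OF 3(2)] by simp
        then show ?thesis using 3(1) sc[OF S] hall[rule_format, OF S] by simp
      qed
    qed
    have "\<exists>t. transport R I J c' d' t"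
      using mcases
    proof (elim disjE exE conjE)
      assume "m = c i0" then show ?thesis using source[OF i0(1) _ h h3] by (simp add: c'_def)
    next
      assume "m = d j0" then show ?thesis using target[OF j0(1) _ h h3] by (simp add: d'_def)
    next
      fix S assume S: "S \<subseteq> I" "i0 \<notin> S" "j0 \<in> ?N S" "m = sum d (?N S) - sum c S"
      have "sum d' (?N S) = sum d (?N S) - m" using sd[of "?N S"] S(3) by simp
      then have "sum c' S = sum d' (?N S)" using sc[OF S(1)] S(2,4) by simp
      moreover have "S \<noteq> {}" "S \<noteq> I" using S(2,3) i0(1) by auto
      ultimately show ?thesis using tight[OF S(1) _ _ _ h h3] by blast
    qed
    then obtain t where t: "transport R I J c' d' t" by blast
    have t: "\<And>i j. i \<in> I \<Longrightarrow> j \<in> J \<Longrightarrow> 0 \<le> t i j \<and> (0 < t i j \<longrightarrow> R i j)"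
        "\<And>i. i \<in> I \<Longrightarrow> sum (t i) J = c' i" "\<And>j. j \<in> J \<Longrightarrow> (\<Sum>i\<in>I. t i j) \<le> d' j"
      using t unfolding transport_def by blast+
    \<comment> \<open>The mass moved in advance is put back on the edge from \<open>i0\<close> to
      \<open>j0\<close>.\<close>
    define t' where "t' = (\<lambda>i j. t i j + (if i = i0 then if j = j0 then m else 0 else 0))"
    have "transport R I J c d t'"
      unfolding transport_def
    proof (intro conjI ballI)
      fix i j assume ij: "i \<in> I" "j \<in> J"
      show "0 \<le> t' i j" using t(1)[OF ij] m0 by (simp add: t'_def)
      show "0 < t' i j \<longrightarrow> R i j" using t(1)[OF ij] j0 by (auto simp: t'_def)
    next
      fix i assume "i \<in> I"
      then show "sum (t' i) J = c i" using t(2)[of i] fin(2) j0(1)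
        by (cases "i = i0") (simp_all add: t'_def sum.distrib c'_def)
    next
      fix j assume "j \<in> J"
      then show "(\<Sum>i\<in>I. t' i j) \<le> d j" using t(3)[of j] fin(1) i0(1)
        by (cases "j = j0") (simp_all add: t'_def sum.distrib d'_def)
    qed
    then show ?thesis by blast
  qed
qed

text \<open>No order is involved, so that one calculus serves both a Kegelspitze and the set
  \<open>M_set P\<close> with pointwise convex combinations, as well as the homomorphisms between
  them.\<close>

locale pointed_barycentric =
  fixes A :: "'a set" and pl :: "real \<Rightarrow> 'a \<Rightarrow> 'a \<Rightarrow> 'a" and bot :: 'a
  assumes bary_alg: "barycentric_algebra A pl" and bot_in: "bot \<in> A"
begin

lemma pl_in: "0 \<le> r \<Longrightarrow> r \<le> 1 \<Longrightarrow> a \<in> A \<Longrightarrow> b \<in> A \<Longrightarrow> pl r a b \<in> A"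
  using bary_alg unfolding barycentric_algebra_def by (meson PiE_mem atLeastAtMost_iff)

lemma pl_one: "a \<in> A \<Longrightarrow> b \<in> A \<Longrightarrow> pl 1 a b = a"
  using bary_alg unfolding barycentric_algebra_def by blast

lemma pl_commute: "0 \<le> r \<Longrightarrow> r \<le> 1 \<Longrightarrow> a \<in> A \<Longrightarrow> b \<in> A \<Longrightarrow> pl r a b = pl (1 - r) b a"
  using bary_alg unfolding barycentric_algebra_def by (meson atLeastAtMost_iff)

lemma pl_zero: "a \<in> A \<Longrightarrow> b \<in> A \<Longrightarrow> pl 0 a b = b"
  using pl_commute[of 0 a b] pl_one by simp

lemma pl_idem: "0 \<le> r \<Longrightarrow> r \<le> 1 \<Longrightarrow> a \<in> A \<Longrightarrow> pl r a a = a"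
  using bary_alg unfolding barycentric_algebra_def by (meson atLeastAtMost_iff)

lemma pl_assoc:
  "0 \<le> p \<Longrightarrow> p < 1 \<Longrightarrow> 0 \<le> r \<Longrightarrow> r < 1 \<Longrightarrow> a \<in> A \<Longrightarrow> b \<in> A \<Longrightarrow> c \<in> A \<Longrightarrow>
   pl r (pl p a b) c = pl (p * r) a (pl ((r - p * r) / (1 - p * r)) b c)"
  using bary_alg unfolding barycentric_algebra_def by (meson atLeastLessThan_iff)

text \<open>Weight zero forces the point to be \<open>bot\<close>: the zero of the cone has a single
  representative, and the unit law is an equality of pairs.\<close>

definition valid :: "real \<times> 'a \<Rightarrow> bool" where
  "valid p \<longleftrightarrow> (0 < fst p \<and> snd p \<in> A) \<or> p = (0, bot)"

text \<open>The pair \<open>(s, a)\<close> stands for \<open>s \<cdot> a\<close> in the free cone over the barycentric algebra.  Invalid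
  pairs are absorbed by \<open>(-1, bot)\<close>, so that the monoid laws hold without side conditions.\<close>

definition cadd :: "real \<times> 'a \<Rightarrow> real \<times> 'a \<Rightarrow> real \<times> 'a" where
  "cadd p q =
     (if valid p \<and> valid q then
        (if fst p = 0 then q else if fst q = 0 then p
         else (fst p + fst q, pl (fst p / (fst p + fst q)) (snd p) (snd q)))
      else if p = (0, bot) then q else if q = (0, bot) then p else (-1, bot))"

lemma valid_zero: "valid (0, bot)"
  by (simp add: valid_def)

lemma not_valid_junk: "\<not> valid (-1, bot)"
  by (simp add: valid_def)

lemma valid_cadd: "valid p \<Longrightarrow> valid q \<Longrightarrow> valid (cadd p q)"
  unfolding cadd_def by (auto simp: valid_def intro!: pl_in)

lemma fst_cadd: "valid p \<Longrightarrow> valid q \<Longrightarrow> fst (cadd p q) = fst p + fst q"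
  unfolding cadd_def by auto

lemma cadd_zero: "cadd p (0, bot) = p"
  unfolding cadd_def valid_def by auto

lemma cadd_commute: "cadd p q = cadd q p"
proof (cases "valid p \<and> valid q \<and> fst p \<noteq> 0 \<and> fst q \<noteq> 0")
  case True
  then have *: "0 < fst p" "0 < fst q" "snd p \<in> A" "snd q \<in> A" by (auto simp: valid_def)
  then have "1 - fst p / (fst p + fst q) = fst q / (fst q + fst p)" by (simp add: field_simps)
  with * True show ?thesis
    unfolding cadd_def using pl_commute[of "fst p / (fst p + fst q)" "snd p" "snd q"] by auto
next
  case False
  then show ?thesis unfolding cadd_def by (auto simp: valid_def)
qed

text \<open>With \<open>p\<close> and \<open>r\<close> the relative weights formed on the left, the
  skew associativity law of barycentric algebras is associativity of weighted sums:
  \<open>p * r\<close> is the share of \<open>s\<close> in the total, and the quotient in the law is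
  the share \<open>u / (u + v)\<close>.\<close>

lemma cadd_assoc_pos:
  assumes "0 < s" "0 < u" "0 < v" "a \<in> A" "b \<in> A" "c \<in> A"
  shows "cadd (cadd (s, a) (u, b)) (v, c) = cadd (s, a) (cadd (u, b) (v, c))"
proof -
  define p where "p = s / (s + u)"
  define r where "r = (s + u) / (s + u + v)"
  have "p * r = s / (s + u + v)" using assms by (simp add: p_def r_def)
  moreover have "(r - p * r) / (1 - p * r) = u / (u + v)"
  proof -
    have "r - p * r = u / (s + u + v)"
      unfolding \<open>p * r = _\<close> using assms by (simp add: r_def diff_divide_distrib[symmetric])
    moreover have "1 - p * r = (u + v) / (s + u + v)"
      unfolding \<open>p * r = _\<close> using assms by (simp add: field_simps)
    ultimately show ?thesis using assms by simp
  qed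
  moreover have "pl r (pl p a b) c = pl (p * r) a (pl ((r - p * r) / (1 - p * r)) b c)"
    using assms by (intro pl_assoc) (auto simp: p_def r_def)
  moreover have "pl (s / (s + u)) a b \<in> A" "pl (u / (u + v)) b c \<in> A"
    using assms by (auto intro!: pl_in)
  ultimately show ?thesis
    unfolding cadd_def using assms by (auto simp: valid_def p_def r_def add.assoc)
qed

lemma cadd_assoc: "cadd (cadd p q) w = cadd p (cadd q w)"
proof (cases "valid p \<and> valid q \<and> valid w")
  case True
  show ?thesis
  proof (cases "p = (0, bot) \<or> q = (0, bot) \<or> w = (0, bot)")
    case True
    then show ?thesis by (metis cadd_zero cadd_commute)
  next
    case False
    then show ?thesis
      using True cadd_assoc_pos[of "fst p" "fst q" "fst w" "snd p" "snd q" "snd w"]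
      by (auto simp: valid_def)
  qed
next
  case False
  \<comment> \<open>Outside the valid pairs absorption decides everything: an invalid summand with a
    nonzero partner gives \<open>(-1, bot)\<close>, which then swallows the third summand, in either
    bracketing.\<close>
  have junk: "cadd (-1, bot) x = (-1, bot)" for x unfolding cadd_def using not_valid_junk by auto
  have inv: "cadd x y = (-1, bot)" if "\<not> valid x" "y \<noteq> (0, bot)" for x y
    using that unfolding cadd_def by (auto simp: valid_zero)
  have zero_iff: "cadd x y = (0, bot) \<longleftrightarrow> x = (0, bot) \<and> y = (0, bot)" for x y
    unfolding cadd_def valid_def by auto
  show ?thesis
  proof (cases "p = (0, bot) \<or> q = (0, bot) \<or> w = (0, bot)")
    case True
    then show ?thesis by (metis cadd_zero cadd_commute)
  next
    case n0: False
    then show ?thesis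
      using False junk inv zero_iff cadd_commute not_valid_junk by metis
  qed
qed

text \<open>The purpose of the absorbing pair: \<open>comm_monoid_set\<close> demands its laws for
  all pairs and in return provides finite sums \<open>cone.F\<close> with splitting, exchange and
  reindexing.\<close>

sublocale cone: comm_monoid_set cadd "(0, bot)"
  by unfold_locales (rule cadd_assoc cadd_commute cadd_zero)+

text \<open>The formal multiple of \<open>a\<close> by \<open>r\<close>, normalised so that a zero
  weight forgets the point.\<close>

definition cpt :: "real \<Rightarrow> 'a \<Rightarrow> real \<times> 'a" where
  "cpt r a = (if r = 0 then (0, bot) else (r, a))"

lemma valid_cpt: "0 \<le> r \<Longrightarrow> a \<in> A \<Longrightarrow> valid (cpt r a)"
  by (auto simp: cpt_def valid_def)

lemma fst_cpt [simp]: "fst (cpt r a) = r"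
  by (auto simp: cpt_def)

lemma cpt_zero [simp]: "cpt 0 a = (0, bot)"
  by (simp add: cpt_def)

lemma valid_eq_cpt: "valid p \<Longrightarrow> p = cpt (fst p) (snd p)"
  by (auto simp: cpt_def valid_def)

lemma valid_snd: "valid p \<Longrightarrow> snd p \<in> A"
  by (auto simp: valid_def bot_in)

lemma valid_fst: "valid p \<Longrightarrow> 0 \<le> fst p"
  by (auto simp: valid_def)

text \<open>Idempotence of the barycentric operations is what makes masses at the same point add
  up.\<close>

lemma cpt_add: "0 \<le> r \<Longrightarrow> 0 \<le> s \<Longrightarrow> a \<in> A \<Longrightarrow> cadd (cpt r a) (cpt s a) = cpt (r + s) a"
  using pl_idem[of "r / (r + s)" a] by (auto simp: cadd_def cpt_def valid_def)

lemma snd_cadd: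
  assumes "valid p" "valid q" "fst p + fst q = 1"
  shows "snd (cadd p q) = pl (fst p) (snd p) (snd q)"
  using assms by (auto simp: cadd_def valid_def bot_in pl_zero pl_one)

lemma valid_F: "(\<And>i. i \<in> I \<Longrightarrow> valid (f i)) \<Longrightarrow> valid (cone.F f I)"
  by (induction I rule: infinite_finite_induct) (auto simp: valid_zero valid_cadd)

lemma fst_F: "(\<And>i. i \<in> I \<Longrightarrow> valid (f i)) \<Longrightarrow> fst (cone.F f I) = (\<Sum>i\<in>I. fst (f i))"
  by (induction I rule: infinite_finite_induct) (auto simp: fst_cadd valid_F)

lemma F_cpt_const:
  "(\<And>i. i \<in> I \<Longrightarrow> 0 \<le> r i) \<Longrightarrow> a \<in> A \<Longrightarrow> cone.F (\<lambda>i. cpt (r i) a) I = cpt (sum r I) a"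
  by (induction I rule: infinite_finite_induct) (auto simp: cpt_add sum_nonneg)

section \<open>Barycentres of finite subprobability families\<close>

definition weights :: "'i set \<Rightarrow> ('i \<Rightarrow> real) \<Rightarrow> ('i \<Rightarrow> 'a) \<Rightarrow> bool" where
  "weights I c x \<longleftrightarrow> finite I \<and> (\<forall>i\<in>I. 0 \<le> c i \<and> x i \<in> A) \<and> sum c I \<le> 1"

text \<open>The mass missing from 1 sits at \<open>bot\<close>. The sum therefore has weight exactly
  1, and its point is the barycentre.\<close>

definition csum :: "'i set \<Rightarrow> ('i \<Rightarrow> real) \<Rightarrow> ('i \<Rightarrow> 'a) \<Rightarrow> real \<times> 'a" where
  "csum I c x = cadd (cone.F (\<lambda>i. cpt (c i) (x i)) I) (cpt (1 - sum c I) bot)"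

definition bary :: "'i set \<Rightarrow> ('i \<Rightarrow> real) \<Rightarrow> ('i \<Rightarrow> 'a) \<Rightarrow> 'a" where
  "bary I c x = snd (csum I c x)"

lemma valid_csum: "weights I c x \<Longrightarrow> valid (csum I c x)"
  unfolding csum_def weights_def using bot_in by (intro valid_cadd valid_F valid_cpt) auto

lemma fst_csum: "weights I c x \<Longrightarrow> fst (csum I c x) = 1"
  unfolding csum_def weights_def using bot_in
  by (subst fst_cadd) (auto simp: fst_F valid_cpt valid_F)

lemma csum_eq: "weights I c x \<Longrightarrow> csum I c x = cpt 1 (bary I c x)"
  using valid_eq_cpt[OF valid_csum] fst_csum unfolding bary_def by metis

lemma bary_in: "weights I c x \<Longrightarrow> bary I c x \<in> A"
  unfolding bary_def by (intro valid_snd valid_csum)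

lemma bary_empty: "bary {} c x = bot"
  by (simp add: bary_def csum_def cadd_commute[of "(0, bot)"] cadd_zero) (simp add: cpt_def)

lemma bary_cong: "(\<And>i. i \<in> I \<Longrightarrow> c i = c' i) \<Longrightarrow> (\<And>i. i \<in> I \<Longrightarrow> x i = x' i) \<Longrightarrow> bary I c x = bary I c' x'"
  unfolding bary_def csum_def by (metis (mono_tags, lifting) cone.cong sum.cong)

lemma bary_reindex:
  "inj_on h I \<Longrightarrow> bary (h ` I) c x = bary I (c \<circ> h) (x \<circ> h)"
  unfolding bary_def csum_def by (simp add: cone.reindex sum.reindex o_def)

text \<open>With all other summands frozen, the barycentre depends on the point at \<open>k\<close>
  through a single barycentric operation. This is how continuity in each argument is brought to bear
  on one point of a long sum.\<close>

lemma bary_remove: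
  assumes "weights I c x" "k \<in> I"
  obtains b where "b \<in> A" "\<And>a. a \<in> A \<Longrightarrow> bary I c (x(k := a)) = pl (c k) a b"
proof -
  define q where "q = cadd (cone.F (\<lambda>i. cpt (c i) (x i)) (I - {k})) (cpt (1 - sum c I) bot)"
  have vF: "valid (cone.F (\<lambda>i. cpt (c i) (x i)) (I - {k}))"
    using assms by (intro valid_F) (auto simp: weights_def valid_cpt)
  have vb: "valid (cpt (1 - sum c I) bot)" using assms bot_in by (auto simp: weights_def valid_cpt)
  have vq: "valid q" unfolding q_def using vF vb by (rule valid_cadd)
  have "fst (cone.F (\<lambda>i. cpt (c i) (x i)) (I - {k})) = sum c (I - {k})"
    using assms by (subst fst_F) (auto simp: weights_def valid_cpt)
  then have fq: "fst q = 1 - c k"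
    unfolding q_def using vF vb assms by (simp add: fst_cadd sum_diff1 weights_def)
  show ?thesis
  proof
    show "snd q \<in> A" using vq by (rule valid_snd)
    fix a assume a: "a \<in> A"
    have vk: "valid (cpt (c k) a)" using assms a by (auto simp: weights_def valid_cpt)
    have "cone.F (\<lambda>i. cpt (c i) ((x(k := a)) i)) (I - {k}) = cone.F (\<lambda>i. cpt (c i) (x i)) (I - {k})"
      by (rule cone.cong) auto
    then have "csum I c (x(k := a)) = cadd (cpt (c k) a) q"
      using assms by (simp add: csum_def q_def cone.remove[of I k] weights_def cadd_assoc)
    then have "bary I c (x(k := a)) = pl (c k) (snd (cpt (c k) a)) (snd q)"
      unfolding bary_def using snd_cadd[OF vk vq] fq by simp
    \<comment> \<open>If \<open>c k = 0\<close>, the pair \<open>cpt (c k) a\<close> has forgotten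
      \<open>a\<close>, but then \<open>pl 0\<close> ignores its first argument.\<close>
    also have "\<dots> = pl (c k) a (snd q)"
      using a valid_snd[OF vq] bot_in by (cases "c k = 0") (auto simp: cpt_def pl_zero)
    finally show "bary I c (x(k := a)) = pl (c k) a (snd q)" .
  qed
qed

definition csc :: "real \<Rightarrow> real \<times> 'a \<Rightarrow> real \<times> 'a" where
  "csc r p = cpt (r * fst p) (snd p)"

text \<open>Relative weights do not change under a common positive factor, and the factor 0
  collapses both sides to the zero of the cone.\<close>

lemma csc_cadd:
  assumes "0 \<le> r" "valid p" "valid q"
  shows "csc r (cadd p q) = cadd (csc r p) (csc r q)"
proof -
  consider "r = 0" | "fst p = 0" | "fst q = 0" | "0 < r" "0 < fst p" "0 < fst q"
    using assms valid_fst[of p] valid_fst[of q] by fastforce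
  then show ?thesis
  proof cases
    case 4
    then have "r * fst p / (r * fst p + r * fst q) = fst p / (fst p + fst q)"
      by (simp add: distrib_left[symmetric])
    then show ?thesis using assms 4
      by (auto simp: csc_def cpt_def cadd_def valid_def distrib_left)
  qed (use assms in \<open>auto simp: csc_def cadd_def valid_def cpt_def\<close>)
qed

lemma csc_cpt: "csc r (cpt s a) = cpt (r * s) a"
  by (auto simp: csc_def cpt_def)

lemma csc_F:
  assumes "0 \<le> r" "\<And>i. i \<in> I \<Longrightarrow> valid (f i)"
  shows "csc r (cone.F f I) = cone.F (\<lambda>i. csc r (f i)) I"
  using assms(2)
  by (induction I rule: infinite_finite_induct) (auto simp: csc_cadd assms(1) valid_F, auto simp: csc_def)

lemma csc_csum:
  assumes "weights I c x" "0 \<le> r"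
  shows "csc r (csum I c x) =
    cadd (cone.F (\<lambda>i. cpt (r * c i) (x i)) I) (cpt (r * (1 - sum c I)) bot)"
proof -
  have "csc r (csum I c x) = cadd (csc r (cone.F (\<lambda>i. cpt (c i) (x i)) I)) (csc r (cpt (1 - sum c I) bot))"
    unfolding csum_def using assms bot_in
    by (intro csc_cadd valid_F valid_cpt) (auto simp: weights_def)
  also have "csc r (cone.F (\<lambda>i. cpt (c i) (x i)) I) = cone.F (\<lambda>i. cpt (r * c i) (x i)) I"
    using assms by (subst csc_F) (auto simp: weights_def valid_cpt csc_cpt)
  finally show ?thesis by (simp add: csc_cpt)
qed

text \<open>In the cone, the disjoint union of the rescaled families is the sum of the rescaled
  totals. The weights at \<open>bot\<close> fit as well, since
  \<open>r * (1 - sum c I) + (1 - r) * (1 - sum d J)\<close> is the deficit of the union.\<close>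

lemma bary_mix:
  assumes "weights I c x" "weights J d y" "0 \<le> r" "r \<le> 1"
  shows "bary (I <+> J) (case_sum (\<lambda>i. r * c i) (\<lambda>j. (1 - r) * d j)) (case_sum x y)
       = pl r (bary I c x) (bary J d y)"
proof -
  have total: "sum (case_sum (\<lambda>i. r * c i) (\<lambda>j. (1 - r) * d j)) (I <+> J) = r * sum c I + (1 - r) * sum d J"
    using assms by (simp add: sum.Plus weights_def sum_distrib_left)
  have rest: "cpt (1 - sum (case_sum (\<lambda>i. r * c i) (\<lambda>j. (1 - r) * d j)) (I <+> J)) bot
     = cadd (cpt (r * (1 - sum c I)) bot) (cpt ((1 - r) * (1 - sum d J)) bot)"
  proof -
    have "0 \<le> r * (1 - sum c I)" "0 \<le> (1 - r) * (1 - sum d J)" using assms by (auto simp: weights_def)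
    then show ?thesis unfolding total using bot_in by (simp add: cpt_add) (simp add: algebra_simps)
  qed
  have "csum (I <+> J) (case_sum (\<lambda>i. r * c i) (\<lambda>j. (1 - r) * d j)) (case_sum x y)
     = cadd (csc r (csum I c x)) (csc (1 - r) (csum J d y))"
    using assms unfolding csc_csum[OF assms(1,3)] csc_csum[OF assms(2), of "1 - r", simplified, OF assms(4)]
    unfolding csum_def rest by (simp add: cone.Plus weights_def o_def cadd_assoc cadd_commute cone.left_commute)
  also have "\<dots> = cadd (cpt r (bary I c x)) (cpt (1 - r) (bary J d y))"
    using assms by (simp add: csum_eq csc_cpt)
  finally have "bary (I <+> J) (case_sum (\<lambda>i. r * c i) (\<lambda>j. (1 - r) * d j)) (case_sum x y)
      = snd (cadd (cpt r (bary I c x)) (cpt (1 - r) (bary J d y)))" by (simp add: bary_def)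
  also have "\<dots> = pl r (snd (cpt r (bary I c x))) (snd (cpt (1 - r) (bary J d y)))"
    using assms by (subst snd_cadd) (auto simp: bary_in valid_cpt)
  also have "\<dots> = pl r (bary I c x) (bary J d y)"
    using assms bot_in bary_in[OF assms(1)] bary_in[OF assms(2)]
    by (cases "r = 0"; cases "r = 1") (auto simp: cpt_def pl_zero pl_one)
  finally show ?thesis .
qed

lemma bary_single: "a \<in> A \<Longrightarrow> bary {i} (\<lambda>_. 1) (\<lambda>_. a) = a"
  by (simp add: bary_def csum_def cadd_zero) (simp add: cpt_def)

text \<open>Scaling is mixing with the empty family, whose barycentre is \<open>bot\<close>; the
  index set is then identified with \<open>I\<close> along \<open>Inl\<close>.\<close>

lemma bary_scale:
  assumes "weights I c x" "0 \<le> r" "r \<le> 1"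
  shows "bary I (\<lambda>i. r * c i) x = pl r (bary I c x) bot"
proof -
  have w: "weights ({}::nat set) (\<lambda>_. 0) (\<lambda>_. bot)" by (simp add: weights_def)
  have "I <+> ({}::nat set) = Inl ` I" by auto
  then show ?thesis
    using bary_mix[OF assms(1) w assms(2,3)]
      bary_reindex[of Inl I "case_sum (\<lambda>i. r * c i) (\<lambda>j::nat. 0)" "case_sum x (\<lambda>j::nat. bot)"]
    by (simp add: bary_empty comp_def)
qed

end

text \<open>Applying \<open>f\<close> to points while keeping weights is additive from one cone to
  the other, on valid pairs only, because \<open>f\<close> is controlled only on
  \<open>A\<close>.\<close>

lemma bary_hom:
  assumes "pointed_barycentric A pl z" "pointed_barycentric B pl' z'"
    and f: "f \<in> A \<rightarrow> B" "f z = z'"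
      "\<And>r a b. 0 \<le> r \<Longrightarrow> r \<le> 1 \<Longrightarrow> a \<in> A \<Longrightarrow> b \<in> A \<Longrightarrow> f (pl r a b) = pl' r (f a) (f b)"
    and w: "pointed_barycentric.weights A I c x"
  shows "f (pointed_barycentric.bary A pl z I c x) = pointed_barycentric.bary B pl' z' I c (\<lambda>i. f (x i))"
proof -
  interpret A: pointed_barycentric A pl z by fact
  interpret B: pointed_barycentric B pl' z' by fact
  define h where "h = (\<lambda>p::real \<times> _. (fst p, f (snd p)))"
  have hv: "B.valid (h p)" if "A.valid p" for p
    using that f by (auto simp: A.valid_def B.valid_def h_def)
  have hadd: "h (A.cadd p q) = B.cadd (h p) (h q)" if "A.valid p" "A.valid q" for p q
    using that hv[OF that(1)] hv[OF that(2)] f(3)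
    by (auto simp: A.cadd_def B.cadd_def h_def A.valid_def)
  have hF: "h (A.cone.F g I) = B.cone.F (\<lambda>i. h (g i)) I" if "\<And>i. i \<in> I \<Longrightarrow> A.valid (g i)" for g
    using that by (induction I rule: infinite_finite_induct) (auto simp: hadd A.valid_F, auto simp: h_def f)
  have hcpt: "h (A.cpt r a) = B.cpt r (f a)" for r a by (auto simp: h_def A.cpt_def B.cpt_def f)
  have w': "finite I" "\<And>i. i \<in> I \<Longrightarrow> A.valid (A.cpt (c i) (x i))" "A.valid (A.cpt (1 - sum c I) z)"
    using w by (auto simp: A.weights_def A.valid_cpt A.bot_in)
  have "h (A.csum I c x) = B.csum I c (\<lambda>i. f (x i))"
    unfolding A.csum_def B.csum_def using w'
    by (subst hadd) (auto simp: hF A.valid_F hcpt f)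
  then show ?thesis unfolding A.bary_def B.bary_def h_def by (metis snd_conv)
qed

text \<open>Sending \<open>(s, a)\<close> to \<open>s * h a\<close> turns addition in the cone into
  addition of reals, and the mass at the distinguished point contributes nothing because
  \<open>h z = 0\<close>.\<close>

lemma bary_affine:
  fixes h :: "'a \<Rightarrow> real"
  assumes "pointed_barycentric A pl z"
    and f: "h z = 0" "\<And>r a b. 0 \<le> r \<Longrightarrow> r \<le> 1 \<Longrightarrow> a \<in> A \<Longrightarrow> b \<in> A \<Longrightarrow> h (pl r a b) = r * h a + (1 - r) * h b"
    and w: "pointed_barycentric.weights A I c x"
  shows "h (pointed_barycentric.bary A pl z I c x) = (\<Sum>i\<in>I. c i * h (x i))"
proof -
  interpret A: pointed_barycentric A pl z by fact
  define g where "g = (\<lambda>p::real \<times> _. fst p * h (snd p))"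
  have gadd: "g (A.cadd p q) = g p + g q" if "A.valid p" "A.valid q" for p q
  proof (cases "fst p = 0 \<or> fst q = 0")
    case True
    then show ?thesis using that f(1) by (auto simp: A.cadd_def g_def A.valid_def)
  next
    case False
    define s where "s = fst p + fst q"
    have *: "0 < fst p" "0 < fst q" "snd p \<in> A" "snd q \<in> A"
      using that False by (auto simp: A.valid_def)
    then have "h (pl (fst p / s) (snd p) (snd q)) = fst p / s * h (snd p) + (1 - fst p / s) * h (snd q)"
      by (intro f(2)) (auto simp: s_def)
    moreover have "1 - fst p / s = fst q / s" "s \<noteq> 0" using * by (auto simp: s_def field_simps)
    ultimately have "s * h (pl (fst p / s) (snd p) (snd q)) = fst p * h (snd p) + fst q * h (snd q)"
      by (simp add: distrib_left)
    then show ?thesis using that False by (simp add: A.cadd_def g_def s_def)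
  qed
  have gF: "g (A.cone.F u I) = (\<Sum>i\<in>I. g (u i))" if "\<And>i. i \<in> I \<Longrightarrow> A.valid (u i)" for u
    using that by (induction I rule: infinite_finite_induct) (auto simp: gadd A.valid_F, auto simp: g_def f)
  have gcpt: "g (A.cpt r a) = r * h a" for r a by (auto simp: g_def A.cpt_def f)
  have w': "finite I" "\<And>i. i \<in> I \<Longrightarrow> A.valid (A.cpt (c i) (x i))" "A.valid (A.cpt (1 - sum c I) z)"
    using w by (auto simp: A.weights_def A.valid_cpt A.bot_in)
  have "g (A.csum I c x) = (\<Sum>i\<in>I. c i * h (x i))"
    unfolding A.csum_def using w' by (subst gadd) (auto simp: gF A.valid_F gcpt f)
  then show ?thesis using A.fst_csum[OF w] unfolding A.bary_def g_def by simp
qed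


section \<open>Scott topology and valuations\<close>

lemma po_refl: "Partial_order P \<Longrightarrow> x \<in> Field P \<Longrightarrow> (x, x) \<in> P"
  by (auto simp: partial_order_on_def preorder_on_def refl_on_def)

lemma po_trans: "Partial_order P \<Longrightarrow> (x, y) \<in> P \<Longrightarrow> (y, z) \<in> P \<Longrightarrow> (x, z) \<in> P"
  by (meson partial_order_on_def preorder_on_def transE)

lemma po_antisym: "Partial_order P \<Longrightarrow> (x, y) \<in> P \<Longrightarrow> (y, x) \<in> P \<Longrightarrow> x = y"
  by (meson partial_order_on_def antisymD)

lemma Partial_orderI:
  assumes "\<And>x. x \<in> Field P \<Longrightarrow> (x, x) \<in> P"
    and "\<And>x y z. (x, y) \<in> P \<Longrightarrow> (y, z) \<in> P \<Longrightarrow> (x, z) \<in> P"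
    and "\<And>x y. (x, y) \<in> P \<Longrightarrow> (y, x) \<in> P \<Longrightarrow> x = y"
  shows "Partial_order P"
  unfolding partial_order_on_def preorder_on_def refl_on_def
proof (intro conjI)
  show "P \<subseteq> Field P \<times> Field P" by (auto simp: Field_def)
  show "trans P" using assms(2) by (rule transI)
  show "antisym P" using assms(3) by (rule antisymI)
qed (use assms(1) in blast)

lemma is_lub_unique: "Partial_order P \<Longrightarrow> is_lub P T x \<Longrightarrow> is_lub P T y \<Longrightarrow> x = y"
  unfolding is_lub_def by (meson po_antisym)

lemma scott_continuous_in: "scott_continuous P Q f \<Longrightarrow> x \<in> Field P \<Longrightarrow> f x \<in> Field Q"
  unfolding scott_continuous_def by blast

lemma scott_continuous_mono: "scott_continuous P Q f \<Longrightarrow> (x, y) \<in> P \<Longrightarrow> (f x, f y) \<in> Q"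
  unfolding scott_continuous_def by blast

lemma scott_continuous_lub:
  "scott_continuous P Q f \<Longrightarrow> directed P T \<Longrightarrow> is_lub P T x \<Longrightarrow> is_lub Q (f ` T) (f x)"
  unfolding scott_continuous_def by blast

lemma directed_image:
  assumes "\<And>x y. (x, y) \<in> P \<Longrightarrow> (f x, f y) \<in> Q" "directed P T"
  shows "directed Q (f ` T)"
  unfolding directed_def
proof (intro conjI ballI)
  show "f ` T \<subseteq> Field Q"
  proof
    fix y assume "y \<in> f ` T"
    then obtain x where x: "x \<in> T" "y = f x" by blast
    then obtain z where "(x, z) \<in> P" using assms(2) unfolding directed_def by blast
    then show "y \<in> Field Q" using assms(1) x by (meson FieldI1)
  qed
  show "f ` T \<noteq> {}" using assms(2) by (auto simp: directed_def)
  fix a b assume "a \<in> f ` T" "b \<in> f ` T"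
  then obtain x y where "x \<in> T" "a = f x" "y \<in> T" "b = f y" by blast
  moreover then obtain z where "z \<in> T" "(x, z) \<in> P" "(y, z) \<in> P"
    using assms(2) unfolding directed_def by blast
  ultimately show "\<exists>z\<in>f ` T. (a, z) \<in> Q \<and> (b, z) \<in> Q" using assms(1) by blast
qed

lemma scott_continuous_comp:
  assumes "scott_continuous P Q f" "scott_continuous Q R g"
  shows "scott_continuous P R (\<lambda>x. g (f x))"
  unfolding scott_continuous_def
proof (intro conjI allI impI)
  show "(\<lambda>x. g (f x)) \<in> Field P \<rightarrow> Field R"
    using scott_continuous_in[OF assms(2) scott_continuous_in[OF assms(1)]] by simp
  show "(g (f x), g (f y)) \<in> R" if "(x, y) \<in> P" for x y
    using scott_continuous_mono[OF assms(2) scott_continuous_mono[OF assms(1) that]] .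
  fix T x assume "directed P T" "is_lub P T x"
  then have "is_lub R (g ` f ` T) (g (f x))"
    using scott_continuous_lub[OF assms(2) directed_image[OF scott_continuous_mono[OF assms(1)]]
        scott_continuous_lub[OF assms(1)]] by simp
  then show "is_lub R ((\<lambda>x. g (f x)) ` T) (g (f x))" by (simp add: image_image)
qed

text \<open>Morphisms and structure maps are \<open>undefined\<close> outside their domain, so a
  composite often agrees with a known continuous map only on the carrier.\<close>

lemma scott_continuous_cong:
  assumes "scott_continuous P Q f" "\<And>x. x \<in> Field P \<Longrightarrow> f x = g x"
  shows "scott_continuous P Q g"
  unfolding scott_continuous_def
proof (intro conjI allI impI)
  show "g \<in> Field P \<rightarrow> Field Q" using scott_continuous_in[OF assms(1)] assms(2) by fastforce
  show "(g x, g y) \<in> Q" if "(x, y) \<in> P" for x y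
    using scott_continuous_mono[OF assms(1) that] assms(2)[OF FieldI1[OF that]] assms(2)[OF FieldI2[OF that]] by simp
  fix T x assume T: "directed P T" "is_lub P T x"
  then have "f ` T = g ` T" "f x = g x" using assms(2) by (auto simp: directed_def is_lub_def intro!: image_cong)
  then show "is_lub Q (g ` T) (g x)" using scott_continuous_lub[OF assms(1) T] by simp
qed

lemma scott_continuous_ident: "scott_continuous P P (\<lambda>x. x)"
  by (simp add: scott_continuous_def)

lemma scott_opens_subset: "U \<in> scott_opens P \<Longrightarrow> U \<subseteq> Field P"
  by (simp add: scott_opens_def)

lemma scott_opens_up: "U \<in> scott_opens P \<Longrightarrow> x \<in> U \<Longrightarrow> (x, y) \<in> P \<Longrightarrow> y \<in> U"
  unfolding scott_opens_def by blast

lemma scott_opens_meet: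
  "U \<in> scott_opens P \<Longrightarrow> directed P T \<Longrightarrow> is_lub P T x \<Longrightarrow> x \<in> U \<Longrightarrow> \<exists>t\<in>T. t \<in> U"
  unfolding scott_opens_def by blast

lemma scott_opensI:
  assumes "U \<subseteq> Field P" "\<And>x y. x \<in> U \<Longrightarrow> (x, y) \<in> P \<Longrightarrow> y \<in> U"
    and "\<And>T x. directed P T \<Longrightarrow> is_lub P T x \<Longrightarrow> x \<in> U \<Longrightarrow> \<exists>t\<in>T. t \<in> U"
  shows "U \<in> scott_opens P"
  unfolding scott_opens_def using assms by blast

lemma scott_opens_empty: "{} \<in> scott_opens P"
  by (rule scott_opensI) auto

lemma scott_opens_Union: "\<D> \<subseteq> scott_opens P \<Longrightarrow> \<Union>\<D> \<in> scott_opens P"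
proof (rule scott_opensI)
  assume D: "\<D> \<subseteq> scott_opens P"
  show "\<Union>\<D> \<subseteq> Field P" using D scott_opens_subset by blast
  show "\<And>x y. x \<in> \<Union>\<D> \<Longrightarrow> (x, y) \<in> P \<Longrightarrow> y \<in> \<Union>\<D>"
    using D scott_opens_up[of _ P] by (meson UnionE UnionI subsetD)
  fix T x assume T: "directed P T" "is_lub P T x" and "x \<in> \<Union>\<D>"
  then obtain U where U: "U \<in> \<D>" "x \<in> U" by blast
  then have "\<exists>t\<in>T. t \<in> U" using D T by (intro scott_opens_meet[of U P T x]) auto
  then show "\<exists>t\<in>T. t \<in> \<Union>\<D>" using U(1) by blast
qed

lemma scott_opens_Un: "U \<in> scott_opens P \<Longrightarrow> V \<in> scott_opens P \<Longrightarrow> U \<union> V \<in> scott_opens P"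
  using scott_opens_Union[of "{U, V}" P] by simp

lemma scott_opens_Int:
  assumes "U \<in> scott_opens P" "V \<in> scott_opens P"
  shows "U \<inter> V \<in> scott_opens P"
proof (rule scott_opensI)
  show "U \<inter> V \<subseteq> Field P" using assms scott_opens_subset by blast
  show "\<And>x y. x \<in> U \<inter> V \<Longrightarrow> (x, y) \<in> P \<Longrightarrow> y \<in> U \<inter> V"
    using scott_opens_up[OF assms(1)] scott_opens_up[OF assms(2)] by blast
  fix T x assume T: "directed P T" "is_lub P T x" "x \<in> U \<inter> V"
  obtain s where s: "s \<in> T" "s \<in> U" using scott_opens_meet[OF assms(1) T(1,2)] T(3) by auto
  obtain t where t: "t \<in> T" "t \<in> V" using scott_opens_meet[OF assms(2) T(1,2)] T(3) by auto
  obtain w where "w \<in> T" "(s, w) \<in> P" "(t, w) \<in> P"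
    using T(1) s(1) t(1) unfolding directed_def by blast
  then show "\<exists>t\<in>T. t \<in> U \<inter> V"
    using scott_opens_up[OF assms(1) s(2)] scott_opens_up[OF assms(2) t(2)] by auto
qed

lemma scott_opens_vimage:
  assumes f: "scott_continuous P Q f" and V: "V \<in> scott_opens Q"
  shows "{x \<in> Field P. f x \<in> V} \<in> scott_opens P"
proof (rule scott_opensI)
  show "\<And>x y. x \<in> {x \<in> Field P. f x \<in> V} \<Longrightarrow> (x, y) \<in> P \<Longrightarrow> y \<in> {x \<in> Field P. f x \<in> V}"
    by (auto intro: FieldI2 scott_opens_up[OF V] scott_continuous_mono[OF f])
  fix T x assume T: "directed P T" "is_lub P T x" "x \<in> {x \<in> Field P. f x \<in> V}"
  have "directed Q (f ` T)" using scott_continuous_mono[OF f] T(1) by (rule directed_image)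
  then have "\<exists>t\<in>f ` T. t \<in> V"
    using scott_opens_meet[OF V _ scott_continuous_lub[OF f T(1,2)]] T(3) by simp
  then show "\<exists>t\<in>T. t \<in> {x \<in> Field P. f x \<in> V}" using T(1) by (auto simp: directed_def)
qed auto

lemma Field_inclusion_order [simp]: "Field (inclusion_order \<U>) = \<U>"
  by (auto simp: inclusion_order_def Field_def)

lemma Partial_order_inclusion_order: "Partial_order (inclusion_order \<U>)"
  by (rule Partial_orderI) (auto simp: inclusion_order_def Field_def)

lemma is_lub_inclusion_order:
  assumes "\<D> \<subseteq> scott_opens P"
  shows "is_lub (inclusion_order (scott_opens P)) \<D> W \<longleftrightarrow> W = \<Union>\<D>"
proof -
  have "is_lub (inclusion_order (scott_opens P)) \<D> (\<Union>\<D>)"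
    unfolding is_lub_def Field_inclusion_order
    using assms scott_opens_Union[OF assms] by (auto simp: inclusion_order_def)
  then show ?thesis using is_lub_unique[OF Partial_order_inclusion_order] by blast
qed

text \<open>Along the filter of tails of a directed set, monotone real functions converge to their
  suprema; suprema of sums and the like thus follow from the limit calculus.\<close>

definition tails :: "'a rel \<Rightarrow> 'a set \<Rightarrow> 'a filter" where
  "tails P T = (INF t\<in>T. principal {s \<in> T. (t, s) \<in> P})"

lemma eventually_tails:
  assumes "Partial_order P" "directed P T"
  shows "eventually Q (tails P T) \<longleftrightarrow> (\<exists>t\<in>T. \<forall>s\<in>T. (t, s) \<in> P \<longrightarrow> Q s)"
proof -
  have "\<exists>x\<in>T. principal {s \<in> T. (x, s) \<in> P} \<le> inf (principal {s \<in> T. (a, s) \<in> P}) (principal {s \<in> T. (b, s) \<in> P})"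
    if ab: "a \<in> T" "b \<in> T" for a b
  proof -
    obtain x where "x \<in> T" "(a, x) \<in> P" "(b, x) \<in> P" using assms(2) ab unfolding directed_def by blast
    then show ?thesis using po_trans[OF assms(1)] by (intro bexI[of _ x]) auto
  qed
  then show ?thesis
    unfolding tails_def using assms(2)
    by (subst eventually_INF_base) (auto simp: eventually_principal directed_def)
qed

lemma tails_nontrivial:
  assumes "Partial_order P" "directed P T"
  shows "tails P T \<noteq> bot"
proof
  assume "tails P T = bot"
  then have "eventually (\<lambda>_. False) (tails P T)" by simp
  then obtain t where "t \<in> T" "\<forall>s\<in>T. (t, s) \<notin> P"
    unfolding eventually_tails[OF assms] by blast
  moreover have "(t, t) \<in> P" using po_refl assms \<open>t \<in> T\<close> by (metis directed_def subsetD)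
  ultimately show False by blast
qed

lemma eventually_tails_above:
  assumes "Partial_order P" "directed P T" "t \<in> T"
  shows "eventually (\<lambda>s. s \<in> T \<and> (t, s) \<in> P) (tails P T)"
  unfolding eventually_tails[OF assms(1,2)] using assms(3) by blast

lemma eventually_tails_in:
  assumes "Partial_order P" "directed P T"
  shows "eventually (\<lambda>s. s \<in> T) (tails P T)"
  unfolding eventually_tails[OF assms] using assms(2) by (auto simp: directed_def)

text \<open>Every value is eventually dominated by later ones, so a limit is an upper bound, and it
  stays below every other bound. Conversely, a value exceeding \<open>a < l\<close> persists on the
  whole tail that it starts.\<close>

lemma tendsto_tails_iff:
  fixes f :: "'a \<Rightarrow> real"
  assumes P: "Partial_order P" "directed P T"
    and mono: "\<And>s t. s \<in> T \<Longrightarrow> t \<in> T \<Longrightarrow> (s, t) \<in> P \<Longrightarrow> f s \<le> f t"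
  shows "(f \<longlongrightarrow> l) (tails P T) \<longleftrightarrow> (\<forall>t\<in>T. f t \<le> l) \<and> (\<forall>b. (\<forall>t\<in>T. f t \<le> b) \<longrightarrow> l \<le> b)"
proof
  assume l: "(f \<longlongrightarrow> l) (tails P T)"
  show "(\<forall>t\<in>T. f t \<le> l) \<and> (\<forall>b. (\<forall>t\<in>T. f t \<le> b) \<longrightarrow> l \<le> b)"
  proof (intro conjI ballI allI impI)
    fix t assume t: "t \<in> T"
    have "eventually (\<lambda>s. f t \<le> f s) (tails P T)"
      using eventually_tails_above[OF P t] by eventually_elim (use mono t in blast)
    then show "f t \<le> l" using l tails_nontrivial[OF P] by (intro tendsto_lowerbound)
  next
    fix b assume "\<forall>t\<in>T. f t \<le> b"
    then have "eventually (\<lambda>s. f s \<le> b) (tails P T)"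
      using eventually_tails_in[OF P] by (auto elim: eventually_mono)
    then show "l \<le> b" using l tails_nontrivial[OF P] by (intro tendsto_upperbound)
  qed
next
  assume l: "(\<forall>t\<in>T. f t \<le> l) \<and> (\<forall>b. (\<forall>t\<in>T. f t \<le> b) \<longrightarrow> l \<le> b)"
  show "(f \<longlongrightarrow> l) (tails P T)"
  proof (rule order_tendstoI)
    fix a assume "a < l"
    then obtain t where t: "t \<in> T" "a < f t" using l by (meson not_le)
    show "eventually (\<lambda>s. a < f s) (tails P T)"
      using eventually_tails_above[OF P t(1)] by eventually_elim (use mono t in force)
  next
    fix a assume "l < a"
    show "eventually (\<lambda>s. f s < a) (tails P T)"
      using eventually_tails_in[OF P] by eventually_elim (use l \<open>l < a\<close> in force)
  qed
qed

lemma tendsto_tails_Sup: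
  fixes f :: "'a \<Rightarrow> real"
  assumes P: "Partial_order P" "directed P T"
    and mono: "\<And>s t. s \<in> T \<Longrightarrow> t \<in> T \<Longrightarrow> (s, t) \<in> P \<Longrightarrow> f s \<le> f t"
    and b: "\<And>t. t \<in> T \<Longrightarrow> f t \<le> b"
  shows "(f \<longlongrightarrow> Sup (f ` T)) (tails P T)"
proof -
  have "T \<noteq> {}" using P(2) by (simp add: directed_def)
  have bdd: "bdd_above (f ` T)" using b by (auto simp: bdd_above_def)
  then show ?thesis
    using \<open>T \<noteq> {}\<close> by (subst tendsto_tails_iff[OF P mono]) (auto intro: cSup_upper cSup_least)
qed

section \<open>Scott continuity into the unit interval\<close>

lemma unit_interval_iff: "(s, t) \<in> unit_interval \<longleftrightarrow> 0 \<le> s \<and> s \<le> t \<and> t \<le> 1"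
  by (simp add: unit_interval_def)

lemma Field_unit_interval [simp]: "Field unit_interval = {0..1}"
  by (force simp: unit_interval_def Field_def)

lemma Partial_order_unit_interval: "Partial_order unit_interval"
  by (rule Partial_orderI) (auto simp: unit_interval_iff)

text \<open>Nonemptiness excludes the one discrepancy: the empty set has the supremum 0 in the
  interval and none in the reals.\<close>

lemma is_lub_unit_interval:
  assumes "S \<subseteq> {0..1}" "S \<noteq> {}"
  shows "is_lub unit_interval S l \<longleftrightarrow> (\<forall>x\<in>S. x \<le> l) \<and> (\<forall>b. (\<forall>x\<in>S. x \<le> b) \<longrightarrow> l \<le> b)"
proof
  obtain x where x: "x \<in> S" "0 \<le> x" "x \<le> 1" using assms by fastforce
  {
    assume l: "is_lub unit_interval S l"
    have "l \<le> b" if b: "\<forall>x\<in>S. x \<le> b" for b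
    proof (cases "b \<le> 1")
      case True
      then have "b \<in> {0..1}" "\<forall>t\<in>S. (t, b) \<in> unit_interval"
        using x b assms(1) by (force simp: unit_interval_iff)+
      then show ?thesis using l by (simp add: is_lub_def) (simp add: unit_interval_iff)
    next
      case False
      then show ?thesis using l by (simp add: is_lub_def)
    qed
    then show "(\<forall>x\<in>S. x \<le> l) \<and> (\<forall>b. (\<forall>x\<in>S. x \<le> b) \<longrightarrow> l \<le> b)"
      using l by (auto simp: is_lub_def unit_interval_iff)
  }
  assume l: "(\<forall>x\<in>S. x \<le> l) \<and> (\<forall>b. (\<forall>x\<in>S. x \<le> b) \<longrightarrow> l \<le> b)"
  then have "0 \<le> l" "l \<le> 1" using x assms(1) by force+
  then show "is_lub unit_interval S l" using l assms(1) by (auto simp: is_lub_def unit_interval_iff)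
qed

lemma scott_continuous_unit_interval_iff:
  assumes P: "Partial_order P"
  shows "scott_continuous P unit_interval f \<longleftrightarrow>
    (\<forall>x\<in>Field P. 0 \<le> f x \<and> f x \<le> 1) \<and> (\<forall>x y. (x, y) \<in> P \<longrightarrow> f x \<le> f y) \<and>
    (\<forall>T x. directed P T \<longrightarrow> is_lub P T x \<longrightarrow> (f \<longlongrightarrow> f x) (tails P T))"
proof -
  have "is_lub unit_interval (f ` T) (f x) \<longleftrightarrow> (f \<longlongrightarrow> f x) (tails P T)"
    if "\<forall>x\<in>Field P. 0 \<le> f x \<and> f x \<le> 1" "\<forall>x y. (x, y) \<in> P \<longrightarrow> f x \<le> f y" "directed P T" for T x
  proof -
    have "f ` T \<subseteq> {0..1}" "f ` T \<noteq> {}" using that by (auto simp: directed_def)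
    moreover have "(f \<longlongrightarrow> f x) (tails P T) \<longleftrightarrow> (\<forall>t\<in>T. f t \<le> f x) \<and> (\<forall>b. (\<forall>t\<in>T. f t \<le> b) \<longrightarrow> f x \<le> b)"
      using that P by (intro tendsto_tails_iff) auto
    ultimately show ?thesis by (simp add: is_lub_unit_interval)
  qed
  moreover have "(\<forall>x\<in>Field P. 0 \<le> f x \<and> f x \<le> 1) \<and> (\<forall>x y. (x, y) \<in> P \<longrightarrow> f x \<le> f y)
    \<longleftrightarrow> f \<in> Field P \<rightarrow> Field unit_interval \<and> (\<forall>x y. (x, y) \<in> P \<longrightarrow> (f x, f y) \<in> unit_interval)"
  proof
    assume "(\<forall>x\<in>Field P. 0 \<le> f x \<and> f x \<le> 1) \<and> (\<forall>x y. (x, y) \<in> P \<longrightarrow> f x \<le> f y)"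
    then show "f \<in> Field P \<rightarrow> Field unit_interval \<and> (\<forall>x y. (x, y) \<in> P \<longrightarrow> (f x, f y) \<in> unit_interval)"
      by (auto simp: unit_interval_iff FieldI1 FieldI2)
  qed (auto simp: unit_interval_iff)
  ultimately show ?thesis unfolding scott_continuous_def by blast
qed

section \<open>Valuations and their pointwise limits\<close>

abbreviation opens_order :: "'a rel \<Rightarrow> 'a set rel" where
  "opens_order P \<equiv> inclusion_order (scott_opens P)"

lemma directed_opens_subset: "directed (opens_order P) \<D> \<Longrightarrow> \<D> \<subseteq> scott_opens P"
  by (simp add: directed_def)

lemma valuations_iff:
  "\<nu> \<in> valuations P \<longleftrightarrow>
     \<nu> \<in> extensional (scott_opens P) \<and> (\<forall>U\<in>scott_opens P. 0 \<le> \<nu> U \<and> \<nu> U \<le> 1) \<and>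
     (\<forall>U\<in>scott_opens P. \<forall>V\<in>scott_opens P. U \<subseteq> V \<longrightarrow> \<nu> U \<le> \<nu> V) \<and>
     (\<forall>\<D>. directed (opens_order P) \<D> \<longrightarrow> (\<nu> \<longlongrightarrow> \<nu> (\<Union>\<D>)) (tails (opens_order P) \<D>)) \<and>
     \<nu> {} = 0 \<and> (\<forall>U\<in>scott_opens P. \<forall>V\<in>scott_opens P. \<nu> U + \<nu> V = \<nu> (U \<union> V) + \<nu> (U \<inter> V))"
proof -
  have "(\<forall>\<D> W. directed (opens_order P) \<D> \<longrightarrow> is_lub (opens_order P) \<D> W \<longrightarrow>
          (\<nu> \<longlongrightarrow> \<nu> W) (tails (opens_order P) \<D>)) \<longleftrightarrow>
        (\<forall>\<D>. directed (opens_order P) \<D> \<longrightarrow> (\<nu> \<longlongrightarrow> \<nu> (\<Union>\<D>)) (tails (opens_order P) \<D>))"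
    using is_lub_inclusion_order directed_opens_subset by metis
  moreover have "(\<forall>U V. (U, V) \<in> opens_order P \<longrightarrow> \<nu> U \<le> \<nu> V) \<longleftrightarrow>
    (\<forall>U\<in>scott_opens P. \<forall>V\<in>scott_opens P. U \<subseteq> V \<longrightarrow> \<nu> U \<le> \<nu> V)"
    by (auto simp: inclusion_order_def)
  ultimately show ?thesis
    unfolding valuations_def scott_continuous_unit_interval_iff[OF Partial_order_inclusion_order]
    by simp
qed

lemma valuations_ext: "\<nu> \<in> valuations P \<Longrightarrow> \<nu> \<in> extensional (scott_opens P)"
  and valuations_nonneg: "\<nu> \<in> valuations P \<Longrightarrow> U \<in> scott_opens P \<Longrightarrow> 0 \<le> \<nu> U"
  and valuations_le_one: "\<nu> \<in> valuations P \<Longrightarrow> U \<in> scott_opens P \<Longrightarrow> \<nu> U \<le> 1"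
  and valuations_mono:
    "\<nu> \<in> valuations P \<Longrightarrow> U \<in> scott_opens P \<Longrightarrow> V \<in> scott_opens P \<Longrightarrow> U \<subseteq> V \<Longrightarrow> \<nu> U \<le> \<nu> V"
  by (simp_all add: valuations_iff)

lemma val_dcpo_iff:
  "(\<nu>, \<xi>) \<in> val_dcpo P \<longleftrightarrow>
     \<nu> \<in> valuations P \<and> \<xi> \<in> valuations P \<and> (\<forall>U\<in>scott_opens P. \<nu> U \<le> \<xi> U)"
  by (simp add: val_dcpo_def)

lemma Field_val_dcpo [simp]: "Field (val_dcpo P) = valuations P"
  by (force simp: val_dcpo_def Field_def)

lemma valuation_eqI:
  assumes "\<nu> \<in> extensional (scott_opens P)" "\<xi> \<in> extensional (scott_opens P)"
    "\<And>U. U \<in> scott_opens P \<Longrightarrow> \<nu> U = \<xi> U"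
  shows "\<nu> = \<xi>"
  using assms by (rule extensionalityI)

text \<open>Modularity and the value at the empty set pass to limits by limit arithmetic; Scott
  continuity is an exchange of two directed suprema.\<close>

lemma valuations_limit:
  assumes I: "Partial_order I" "directed I T"
    and val: "\<And>t. t \<in> T \<Longrightarrow> F t \<in> valuations P"
    and mono: "\<And>s t U. s \<in> T \<Longrightarrow> t \<in> T \<Longrightarrow> (s, t) \<in> I \<Longrightarrow> U \<in> scott_opens P \<Longrightarrow> F s U \<le> F t U"
    and ext: "\<nu> \<in> extensional (scott_opens P)"
    and lim: "\<And>U. U \<in> scott_opens P \<Longrightarrow> ((\<lambda>t. F t U) \<longlongrightarrow> \<nu> U) (tails I T)"
  shows "\<nu> \<in> valuations P"
proof -
  note nt = tails_nontrivial[OF I] and ev = eventually_tails_in[OF I]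
  have sup: "(\<forall>t\<in>T. F t U \<le> \<nu> U) \<and> (\<forall>b. (\<forall>t\<in>T. F t U \<le> b) \<longrightarrow> \<nu> U \<le> b)" if "U \<in> scott_opens P" for U
    using lim[OF that] tendsto_tails_iff[OF I mono[OF _ _ _ that]] by simp
  have le: "\<nu> U \<le> \<nu> V" if "U \<in> scott_opens P" "V \<in> scott_opens P" "U \<subseteq> V" for U V
  proof -
    have "F t U \<le> \<nu> V" if t: "t \<in> T" for t
      using valuations_mono[OF val[OF t], of U V] sup[of V] \<open>U \<subseteq> V\<close> \<open>U \<in> _\<close> \<open>V \<in> _\<close> t by force
    then show ?thesis using sup[of U] that by simp
  qed
  show ?thesis
    unfolding valuations_iff
  proof (intro conjI ballI allI impI)
    show "\<nu> \<in> extensional (scott_opens P)" by (rule ext)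
    fix U assume U: "U \<in> scott_opens P"
    obtain t where t: "t \<in> T" using I(2) by (auto simp: directed_def)
    show "0 \<le> \<nu> U" using sup[OF U] valuations_nonneg[OF val[OF t] U] t by force
    show "\<nu> U \<le> 1" using sup[OF U] valuations_le_one[OF val U] by simp
    fix V assume V: "V \<in> scott_opens P"
    show "\<nu> U \<le> \<nu> V" if "U \<subseteq> V" using le U V that by blast
    have "((\<lambda>t. F t U + F t V) \<longlongrightarrow> \<nu> U + \<nu> V) (tails I T)"
      using lim U V by (intro tendsto_add) auto
    moreover have lim2: "((\<lambda>t. F t (U \<union> V) + F t (U \<inter> V)) \<longlongrightarrow> \<nu> (U \<union> V) + \<nu> (U \<inter> V)) (tails I T)"
      using lim U V by (intro tendsto_add) (auto intro: scott_opens_Un scott_opens_Int)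
    moreover have ev2: "eventually (\<lambda>t. F t (U \<union> V) + F t (U \<inter> V) = F t U + F t V) (tails I T)"
      using ev by eventually_elim (use val U V in \<open>simp add: valuations_iff\<close>)
    ultimately show "\<nu> U + \<nu> V = \<nu> (U \<union> V) + \<nu> (U \<inter> V)"
      using tendsto_unique[OF nt _ Lim_transform_eventually[OF lim2 ev2]] by simp
  next
    have "eventually (\<lambda>t. F t {} = 0) (tails I T)"
      using ev by eventually_elim (use val in \<open>simp add: valuations_iff\<close>)
    then have "((\<lambda>t. F t {}) \<longlongrightarrow> 0) (tails I T)" by (rule tendsto_eventually)
    then show "\<nu> {} = 0" using tendsto_unique[OF nt lim[OF scott_opens_empty]] by blast
  next
    fix \<D> assume D: "directed (opens_order P) \<D>"
    have sub: "\<D> \<subseteq> scott_opens P" by (rule directed_opens_subset[OF D])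
    have W: "\<Union>\<D> \<in> scott_opens P" by (rule scott_opens_Union[OF sub])
    show "(\<nu> \<longlongrightarrow> \<nu> (\<Union>\<D>)) (tails (opens_order P) \<D>)"
    proof (subst tendsto_tails_iff[OF Partial_order_inclusion_order D])
      show "\<nu> U \<le> \<nu> V" if "U \<in> \<D>" "V \<in> \<D>" "(U, V) \<in> opens_order P" for U V
        using that le by (auto simp: inclusion_order_def)
      show "(\<forall>U\<in>\<D>. \<nu> U \<le> \<nu> (\<Union>\<D>)) \<and> (\<forall>b. (\<forall>U\<in>\<D>. \<nu> U \<le> b) \<longrightarrow> \<nu> (\<Union>\<D>) \<le> b)"
      proof (intro conjI ballI allI impI)
        show "\<nu> U \<le> \<nu> (\<Union>\<D>)" if "U \<in> \<D>" for U using that sub W by (intro le) auto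
        fix b assume b: "\<forall>U\<in>\<D>. \<nu> U \<le> b"
        \<comment> \<open>The exchange: each \<open>F t\<close> is continuous along
          \<open>\<D>\<close>, and its values there lie below those of \<open>\<nu>\<close>, hence
          below \<open>b\<close>.\<close>
        have "F t (\<Union>\<D>) \<le> b" if t: "t \<in> T" for t
        proof -
          have "(F t \<longlongrightarrow> F t (\<Union>\<D>)) (tails (opens_order P) \<D>)"
            using val[OF t] D by (simp add: valuations_iff)
          moreover have "eventually (\<lambda>U. F t U \<le> b) (tails (opens_order P) \<D>)"
            using eventually_tails_in[OF Partial_order_inclusion_order D]
          proof eventually_elim
            fix U assume "U \<in> \<D>"
            then show "F t U \<le> b" using sup[of U] sub b t by force
          qed
          ultimately show ?thesis
            using tails_nontrivial[OF Partial_order_inclusion_order D] by (intro tendsto_upperbound)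
        qed
        then show "\<nu> (\<Union>\<D>) \<le> b" using sup[OF W] by blast
      qed
    qed
  qed
qed

definition simple_val :: "'a rel \<Rightarrow> 'i set \<Rightarrow> ('i \<Rightarrow> real) \<Rightarrow> ('i \<Rightarrow> 'a) \<Rightarrow> 'a set \<Rightarrow> real" where
  "simple_val P I c x = (\<lambda>U\<in>scott_opens P. \<Sum>i\<in>I. c i * indicator U (x i))"

lemma simple_valuations_eq:
  "simple_valuations P = {simple_val P {..<n} c x | (n::nat) c x.
     (\<forall>i<n. 0 < c i \<and> x i \<in> Field P) \<and> (\<Sum>i<n. c i) \<le> 1}"
proof -
  have "(\<lambda>U\<in>scott_opens P. \<Sum>i<n. c i * dirac P (x i) U) = simple_val P {..<n} c x" for n :: nat and c x
    by (auto simp: simple_val_def dirac_def intro!: restrict_ext)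
  then show ?thesis unfolding simple_valuations_def by simp
qed

text \<open>Back to strictly positive weights indexed by an initial segment: the indices of weight
  zero are dropped and the others enumerated by \<open>h\<close>.\<close>

lemma simple_val_in_simple_valuations:
  assumes "finite I" "\<And>i. i \<in> I \<Longrightarrow> 0 \<le> c i \<and> x i \<in> Field P" "sum c I \<le> 1"
  shows "simple_val P I c x \<in> simple_valuations P"
proof -
  define J where "J = {i \<in> I. c i \<noteq> 0}"
  have J: "finite J" "J \<subseteq> I" using assms(1) by (auto simp: J_def)
  obtain h where h: "bij_betw h {0..<card J} J" using ex_bij_betw_nat_finite[OF J(1)] by blast
  then have h: "bij_betw h {..<card J} J" by (simp add: lessThan_atLeast0)
  have sumJ: "sum g I = sum g J" if "\<And>i. i \<in> I \<Longrightarrow> c i = 0 \<Longrightarrow> g i = 0" for g :: "_ \<Rightarrow> real"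
    using assms(1) J(2) that by (intro sum.mono_neutral_right) (auto simp: J_def)
  have re: "(\<Sum>i<card J. g (h i)) = sum g J" for g :: "_ \<Rightarrow> real"
    by (rule sum.reindex_bij_betw[OF h])
  have "simple_val P I c x = simple_val P {..<card J} (\<lambda>i. c (h i)) (\<lambda>i. x (h i))"
    unfolding simple_val_def
  proof (rule restrict_ext)
    fix U
    show "(\<Sum>i\<in>I. c i * indicator U (x i)) = (\<Sum>i<card J. c (h i) * indicator U (x (h i)))"
      using re[of "\<lambda>i. c i * indicator U (x i)"] by (simp add: sumJ)
  qed
  moreover have "0 < c (h i) \<and> x (h i) \<in> Field P" if "i < card J" for i
  proof -
    have "h i \<in> J" using h that by (auto simp: bij_betw_def)
    then show ?thesis using assms(2)[of "h i"] by (auto simp: J_def less_le)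
  qed
  moreover have "(\<Sum>i<card J. c (h i)) \<le> 1" using re[of c] sumJ[of c] assms(3) by simp
  ultimately show ?thesis unfolding simple_valuations_eq by blast
qed

lemma simple_valuationsE:
  assumes "\<sigma> \<in> simple_valuations P"
  obtains n :: nat and c x where "\<sigma> = simple_val P {..<n} c x"
    "\<And>i. i < n \<Longrightarrow> 0 < c i" "\<And>i. i < n \<Longrightarrow> x i \<in> Field P" "(\<Sum>i<n. c i) \<le> 1"
  using assms unfolding simple_valuations_eq by blast

lemma simple_val_in_valuations:
  assumes "finite I" "\<And>i. i \<in> I \<Longrightarrow> 0 \<le> c i \<and> x i \<in> Field P" "sum c I \<le> 1"
  shows "simple_val P I c x \<in> valuations P"
  unfolding valuations_iff
proof (intro conjI ballI allI impI)
  show "simple_val P I c x \<in> extensional (scott_opens P)" by (simp add: simple_val_def)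
  show "simple_val P I c x {} = 0" by (simp add: simple_val_def scott_opens_empty)
  fix U assume U: "U \<in> scott_opens P"
  show "0 \<le> simple_val P I c x U"
    unfolding simple_val_def using assms U by (auto intro!: sum_nonneg)
  have "(\<Sum>i\<in>I. c i * indicator U (x i)) \<le> sum c I"
    using assms by (intro sum_mono) (auto simp: indicator_def)
  then show "simple_val P I c x U \<le> 1" using assms(3) U by (simp add: simple_val_def)
  fix V assume V: "V \<in> scott_opens P"
  show "simple_val P I c x U \<le> simple_val P I c x V" if "U \<subseteq> V"
  proof -
    have "(\<Sum>i\<in>I. c i * indicator U (x i)) \<le> (\<Sum>i\<in>I. c i * indicator V (x i))"
      using assms that by (intro sum_mono mult_left_mono) (auto simp: indicator_def)
    then show ?thesis using U V by (simp add: simple_val_def)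
  qed
  have "c i * indicator U (x i) + c i * indicator V (x i)
      = c i * indicator (U \<union> V) (x i) + c i * indicator (U \<inter> V) (x i)" for i
    by (auto simp: indicator_def)
  then show "simple_val P I c x U + simple_val P I c x V
      = simple_val P I c x (U \<union> V) + simple_val P I c x (U \<inter> V)"
    using U V by (simp add: simple_val_def scott_opens_Un scott_opens_Int sum.distrib[symmetric])
next
  fix \<D> assume D: "directed (opens_order P) \<D>"
  note sub = directed_opens_subset[OF D]
  \<comment> \<open>The indicator is eventually constant: if some member of \<open>\<D>\<close>
    contains \<open>a\<close>, so do all larger members; otherwise none does.\<close>
  have ind: "((\<lambda>U. indicator U a :: real) \<longlongrightarrow> indicator (\<Union>\<D>) a) (tails (opens_order P) \<D>)" for a
  proof (rule tendsto_eventually)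
    show "eventually (\<lambda>U. indicator U a = (indicator (\<Union>\<D>) a :: real)) (tails (opens_order P) \<D>)"
    proof (cases "\<exists>V\<in>\<D>. a \<in> V")
      case True
      then obtain V where V: "V \<in> \<D>" "a \<in> V" by blast
      show ?thesis using eventually_tails_above[OF Partial_order_inclusion_order D V(1)]
        by eventually_elim (use V in \<open>auto simp: indicator_def inclusion_order_def\<close>)
    next
      case False
      show ?thesis using eventually_tails_in[OF Partial_order_inclusion_order D]
        by eventually_elim (use False in \<open>auto simp: indicator_def\<close>)
    qed
  qed
  have "((\<lambda>U. \<Sum>i\<in>I. c i * indicator U (x i)) \<longlongrightarrow> (\<Sum>i\<in>I. c i * indicator (\<Union>\<D>) (x i)))
     (tails (opens_order P) \<D>)"
    by (intro tendsto_intros ind)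
  moreover have "eventually (\<lambda>U. simple_val P I c x U = (\<Sum>i\<in>I. c i * indicator U (x i))) (tails (opens_order P) \<D>)"
    using eventually_tails_in[OF Partial_order_inclusion_order D]
    by eventually_elim (use sub in \<open>auto simp: simple_val_def\<close>)
  ultimately show "(simple_val P I c x \<longlongrightarrow> simple_val P I c x (\<Union>\<D>)) (tails (opens_order P) \<D>)"
    using scott_opens_Union[OF sub] by (simp add: filterlim_cong simple_val_def)
qed

lemma dirac_eq_simple_val: "dirac P a = simple_val P {i} (\<lambda>_. 1) (\<lambda>_. a)"
  by (simp add: dirac_def simple_val_def)

section \<open>The least sub-dcpo containing the simple valuations\<close>

definition M_set :: "'a rel \<Rightarrow> ('a set \<Rightarrow> real) set" where
  "M_set P = \<Inter>{S. sub_dcpo (val_dcpo P) S \<and> simple_valuations P \<subseteq> S}"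

lemma simple_valuations_subset_M: "simple_valuations P \<subseteq> M_set P"
  unfolding M_set_def by blast

lemma simple_valuations_subset_valuations: "simple_valuations P \<subseteq> valuations P"
proof
  fix \<sigma> assume "\<sigma> \<in> simple_valuations P"
  then obtain n :: nat and c x where "\<sigma> = simple_val P {..<n} c x"
    "\<And>i. i < n \<Longrightarrow> 0 < c i" "\<And>i. i < n \<Longrightarrow> x i \<in> Field P" "(\<Sum>i<n. c i) \<le> 1"
    by (rule simple_valuationsE) blast
  then show "\<sigma> \<in> valuations P"
    using simple_val_in_valuations[of "{..<n}" c x P] by (simp add: less_imp_le)
qed

lemma M_set_subset_valuations: "M_set P \<subseteq> valuations P"
proof -
  have "sub_dcpo (val_dcpo P) (valuations P)"
    unfolding sub_dcpo_def by (auto simp: is_lub_def)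
  then show ?thesis unfolding M_set_def using simple_valuations_subset_valuations by blast
qed

lemma M_valuation: "\<nu> \<in> M_set P \<Longrightarrow> \<nu> \<in> valuations P"
  using M_set_subset_valuations by blast

lemma M_dcpo_iff:
  "(\<nu>, \<xi>) \<in> M_dcpo P \<longleftrightarrow> \<nu> \<in> M_set P \<and> \<xi> \<in> M_set P \<and> (\<forall>U\<in>scott_opens P. \<nu> U \<le> \<xi> U)"
  unfolding M_dcpo_def M_set_def[symmetric] using M_valuation[of _ P] by (auto simp: val_dcpo_iff)

lemma Field_M_dcpo [simp]: "Field (M_dcpo P) = M_set P"
  by (auto simp: Field_def M_dcpo_iff)

lemma Partial_order_M_dcpo: "Partial_order (M_dcpo P)"
proof (rule Partial_orderI)
  show "\<nu> = \<xi>" if "(\<nu>, \<xi>) \<in> M_dcpo P" "(\<xi>, \<nu>) \<in> M_dcpo P" for \<nu> \<xi>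
    using that by (intro valuation_eqI) (auto simp: M_dcpo_iff valuations_ext M_valuation intro: antisym)
  show "(\<nu>, \<zeta>) \<in> M_dcpo P" if "(\<nu>, \<xi>) \<in> M_dcpo P" "(\<xi>, \<zeta>) \<in> M_dcpo P" for \<nu> \<xi> \<zeta>
    using that by (auto simp: M_dcpo_iff intro: order_trans)
qed (auto simp: M_dcpo_iff)

lemma sub_dcpo_M_set: "sub_dcpo (val_dcpo P) (M_set P)"
  unfolding sub_dcpo_def
proof (intro conjI allI impI)
  show "M_set P \<subseteq> Field (val_dcpo P)" by (simp add: M_set_subset_valuations)
  fix T \<nu> assume *: "T \<subseteq> M_set P" "directed (val_dcpo P) T" "is_lub (val_dcpo P) T \<nu>"
  show "\<nu> \<in> M_set P"
    unfolding M_set_def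
  proof (intro InterI, elim CollectE conjE)
    fix S assume S: "sub_dcpo (val_dcpo P) S" "simple_valuations P \<subseteq> S"
    then have "T \<subseteq> S" using *(1) unfolding M_set_def by blast
    then show "\<nu> \<in> S" using S(1) *(2,3) unfolding sub_dcpo_def by blast
  qed
qed

text \<open>The family is directed in the order of valuations and its pointwise limit is the
  supremum there, so closure under directed suprema applies.\<close>

lemma M_set_limit:
  assumes I: "Partial_order I" "directed I T"
    and val: "\<And>t. t \<in> T \<Longrightarrow> F t \<in> M_set P"
    and mono: "\<And>s t U. s \<in> T \<Longrightarrow> t \<in> T \<Longrightarrow> (s, t) \<in> I \<Longrightarrow> U \<in> scott_opens P \<Longrightarrow> F s U \<le> F t U"
    and ext: "\<nu> \<in> extensional (scott_opens P)"
    and lim: "\<And>U. U \<in> scott_opens P \<Longrightarrow> ((\<lambda>t. F t U) \<longlongrightarrow> \<nu> U) (tails I T)"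
  shows "\<nu> \<in> M_set P"
proof -
  have sup: "(\<forall>t\<in>T. F t U \<le> \<nu> U) \<and> (\<forall>b. (\<forall>t\<in>T. F t U \<le> b) \<longrightarrow> \<nu> U \<le> b)" if "U \<in> scott_opens P" for U
    using lim[OF that] tendsto_tails_iff[OF I mono[OF _ _ _ that]] by simp
  have \<nu>: "\<nu> \<in> valuations P"
    using valuations_limit[OF I _ _ ext, of F] val mono lim M_valuation[of _ P] by blast
  have "directed (val_dcpo P) (F ` T)"
    unfolding directed_def
  proof (intro conjI ballI)
    show "F ` T \<subseteq> Field (val_dcpo P)" using val M_valuation[of _ P] by auto
    show "F ` T \<noteq> {}" using I(2) by (auto simp: directed_def)
    fix a b assume "a \<in> F ` T" "b \<in> F ` T"
    then obtain s t where st: "s \<in> T" "a = F s" "t \<in> T" "b = F t" by blast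
    then obtain u where u: "u \<in> T" "(s, u) \<in> I" "(t, u) \<in> I" using I(2) unfolding directed_def by blast
    then have "(a, F u) \<in> val_dcpo P" "(b, F u) \<in> val_dcpo P"
      using st mono val M_valuation[of _ P] by (auto simp: val_dcpo_iff)
    then show "\<exists>z\<in>F ` T. (a, z) \<in> val_dcpo P \<and> (b, z) \<in> val_dcpo P" using u(1) by blast
  qed
  moreover have "is_lub (val_dcpo P) (F ` T) \<nu>"
    unfolding is_lub_def
  proof (intro conjI ballI impI)
    show "\<nu> \<in> Field (val_dcpo P)" using \<nu> by simp
    show "(\<xi>, \<nu>) \<in> val_dcpo P" if "\<xi> \<in> F ` T" for \<xi>
      using that sup \<nu> val M_valuation[of _ P] by (auto simp: val_dcpo_iff)
    fix \<xi> assume \<xi>: "\<xi> \<in> Field (val_dcpo P)" "\<forall>t\<in>F ` T. (t, \<xi>) \<in> val_dcpo P"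
    have "\<nu> U \<le> \<xi> U" if U: "U \<in> scott_opens P" for U
    proof -
      have "\<forall>t\<in>T. F t U \<le> \<xi> U" using \<xi>(2) U by (simp add: val_dcpo_iff)
      then show ?thesis using sup[OF U] by blast
    qed
    then show "(\<nu>, \<xi>) \<in> val_dcpo P" using \<nu> \<xi>(1) by (simp add: val_dcpo_iff)
  qed
  moreover have "F ` T \<subseteq> M_set P" using val by blast
  ultimately show ?thesis using sub_dcpo_M_set unfolding sub_dcpo_def by blast
qed

lemma is_lub_M_image:
  assumes I: "Partial_order I" "directed I T"
    and val: "\<And>t. t \<in> T \<Longrightarrow> F t \<in> M_set P"
    and mono: "\<And>s t U. s \<in> T \<Longrightarrow> t \<in> T \<Longrightarrow> (s, t) \<in> I \<Longrightarrow> U \<in> scott_opens P \<Longrightarrow> F s U \<le> F t U"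
    and ext: "\<nu> \<in> extensional (scott_opens P)"
    and lim: "\<And>U. U \<in> scott_opens P \<Longrightarrow> ((\<lambda>t. F t U) \<longlongrightarrow> \<nu> U) (tails I T)"
  shows "is_lub (M_dcpo P) (F ` T) \<nu>"
proof -
  have sup: "(\<forall>t\<in>T. F t U \<le> \<nu> U) \<and> (\<forall>b. (\<forall>t\<in>T. F t U \<le> b) \<longrightarrow> \<nu> U \<le> b)" if "U \<in> scott_opens P" for U
    using lim[OF that] tendsto_tails_iff[OF I mono[OF _ _ _ that]] by simp
  have \<nu>: "\<nu> \<in> M_set P"
    using M_set_limit[OF I _ _ ext, of F] val mono lim by blast
  show ?thesis
    unfolding is_lub_def
  proof (intro conjI ballI impI)
    show "\<nu> \<in> Field (M_dcpo P)" using \<nu> by simp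
    show "(\<xi>, \<nu>) \<in> M_dcpo P" if "\<xi> \<in> F ` T" for \<xi>
      using that sup \<nu> val by (auto simp: M_dcpo_iff)
    fix \<xi> assume \<xi>: "\<xi> \<in> Field (M_dcpo P)" "\<forall>t\<in>F ` T. (t, \<xi>) \<in> M_dcpo P"
    have "\<nu> U \<le> \<xi> U" if U: "U \<in> scott_opens P" for U
    proof -
      have "\<forall>t\<in>T. F t U \<le> \<xi> U" using \<xi>(2) U by (simp add: M_dcpo_iff)
      then show ?thesis using sup[OF U] by blast
    qed
    then show "(\<nu>, \<xi>) \<in> M_dcpo P" using \<nu> \<xi>(1) by (simp add: M_dcpo_iff)
  qed
qed

text \<open>Suprema in \<open>M_dcpo P\<close> are computed open by open: the pointwise supremum
  \<open>\<nu>'\<close> belongs to \<open>M_set P\<close> and is a least upper bound, and least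
  upper bounds are unique.\<close>

lemma is_lub_M_tendsto:
  assumes T: "directed (M_dcpo P) T" and lub: "is_lub (M_dcpo P) T \<nu>" and U: "U \<in> scott_opens P"
  shows "((\<lambda>\<xi>. \<xi> U) \<longlongrightarrow> \<nu> U) (tails (M_dcpo P) T)"
proof -
  have T_sub: "T \<subseteq> M_set P" using T by (simp add: directed_def)
  define \<nu>' where "\<nu>' = (\<lambda>U\<in>scott_opens P. Sup ((\<lambda>\<xi>. \<xi> U) ` T))"
  have lim: "((\<lambda>\<xi>. \<xi> V) \<longlongrightarrow> \<nu>' V) (tails (M_dcpo P) T)" if V: "V \<in> scott_opens P" for V
  proof -
    have "\<xi> V \<le> 1" if "\<xi> \<in> T" for \<xi>
      using that T_sub V by (meson M_valuation valuations_le_one subsetD)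
    then have "((\<lambda>\<xi>. \<xi> V) \<longlongrightarrow> Sup ((\<lambda>\<xi>. \<xi> V) ` T)) (tails (M_dcpo P) T)"
      using V by (intro tendsto_tails_Sup[OF Partial_order_M_dcpo T, of _ 1]) (auto simp: M_dcpo_iff)
    then show ?thesis using V by (simp add: \<nu>'_def)
  qed
  have "is_lub (M_dcpo P) ((\<lambda>\<xi>. \<xi>) ` T) \<nu>'"
    by (rule is_lub_M_image[OF Partial_order_M_dcpo T]) (use T_sub lim in \<open>auto simp: M_dcpo_iff \<nu>'_def\<close>)
  then have "\<nu> = \<nu>'" using lub is_lub_unique[OF Partial_order_M_dcpo] by fastforce
  then show ?thesis using lim[OF U] by simp
qed

text \<open>The members with property \<open>Q\<close> form a sub-dcpo containing the simple
  valuations. Directedness and suprema are translated from \<open>val_dcpo P\<close> to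
  \<open>M_dcpo P\<close>, the order to which Scott continuity refers.\<close>

lemma M_induct [consumes 1, case_names simple lub]:
  assumes "\<nu> \<in> M_set P"
    and simple: "\<And>\<sigma>. \<sigma> \<in> simple_valuations P \<Longrightarrow> Q \<sigma>"
    and lub: "\<And>T \<xi>. directed (M_dcpo P) T \<Longrightarrow> is_lub (M_dcpo P) T \<xi> \<Longrightarrow> \<xi> \<in> M_set P \<Longrightarrow>
       (\<And>\<tau>. \<tau> \<in> T \<Longrightarrow> \<tau> \<in> M_set P) \<Longrightarrow> (\<And>\<tau>. \<tau> \<in> T \<Longrightarrow> Q \<tau>) \<Longrightarrow> Q \<xi>"
  shows "Q \<nu>"
proof -
  have "sub_dcpo (val_dcpo P) {\<nu> \<in> M_set P. Q \<nu>}"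
    unfolding sub_dcpo_def
  proof (intro conjI allI impI)
    show "{\<nu> \<in> M_set P. Q \<nu>} \<subseteq> Field (val_dcpo P)" using M_valuation[of _ P] by auto
    fix T \<xi> assume *: "T \<subseteq> {\<nu> \<in> M_set P. Q \<nu>}" "directed (val_dcpo P) T" "is_lub (val_dcpo P) T \<xi>"
    have T: "T \<subseteq> M_set P" using *(1) by blast
    have \<xi>: "\<xi> \<in> M_set P" using sub_dcpo_M_set T *(2,3) unfolding sub_dcpo_def by blast
    have eq: "(\<alpha>, \<beta>) \<in> M_dcpo P \<longleftrightarrow> (\<alpha>, \<beta>) \<in> val_dcpo P" if "\<alpha> \<in> M_set P" "\<beta> \<in> M_set P" for \<alpha> \<beta>
      using that M_valuation[of _ P] by (simp add: M_dcpo_iff val_dcpo_iff)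
    have "directed (M_dcpo P) T"
      unfolding directed_def
    proof (intro conjI ballI)
      fix a b assume ab: "a \<in> T" "b \<in> T"
      then obtain z where "z \<in> T" "(a, z) \<in> val_dcpo P" "(b, z) \<in> val_dcpo P"
        using *(2) unfolding directed_def by blast
      then show "\<exists>z\<in>T. (a, z) \<in> M_dcpo P \<and> (b, z) \<in> M_dcpo P" using ab T eq by blast
    qed (use T *(2) in \<open>auto simp: directed_def\<close>)
    moreover have "is_lub (M_dcpo P) T \<xi>"
      unfolding is_lub_def
    proof (intro conjI ballI impI)
      show "(t, \<xi>) \<in> M_dcpo P" if "t \<in> T" for t
        using that *(3) T \<xi> eq unfolding is_lub_def by blast
      fix \<zeta> assume \<zeta>: "\<zeta> \<in> Field (M_dcpo P)" "\<forall>t\<in>T. (t, \<zeta>) \<in> M_dcpo P"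
      then have "\<forall>t\<in>T. (t, \<zeta>) \<in> val_dcpo P" using T eq by auto
      then have "(\<xi>, \<zeta>) \<in> val_dcpo P" using *(3) \<zeta>(1) M_valuation[of _ P] unfolding is_lub_def by simp
      then show "(\<xi>, \<zeta>) \<in> M_dcpo P" using \<xi> \<zeta>(1) eq by simp
    qed (use \<xi> in simp)
    ultimately have "Q \<xi>" using lub[of T \<xi>] \<xi> *(1) by blast
    then show "\<xi> \<in> {\<nu> \<in> M_set P. Q \<nu>}" using \<xi> by blast
  qed
  moreover have "simple_valuations P \<subseteq> {\<nu> \<in> M_set P. Q \<nu>}"
    using simple simple_valuations_subset_M by blast
  ultimately show ?thesis using assms(1) unfolding M_set_def by blast
qed

lemma M_maps_agree:
  assumes "scott_continuous (M_dcpo P) Q f" "scott_continuous (M_dcpo P) Q g" "Partial_order Q"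
    and "\<And>\<sigma>. \<sigma> \<in> simple_valuations P \<Longrightarrow> f \<sigma> = g \<sigma>" and "\<nu> \<in> M_set P"
  shows "f \<nu> = g \<nu>"
  using assms(5)
proof (induction rule: M_induct)
  case (lub T \<xi>)
  have "f ` T = g ` T" using lub.IH by (auto intro!: image_cong)
  then show ?case
    using scott_continuous_lub[OF assms(1) lub.hyps(1,2)] scott_continuous_lub[OF assms(2) lub.hyps(1,2)]
      is_lub_unique[OF assms(3)] by simp
qed (use assms(4) in blast)

lemma scott_continuous_into_M:
  assumes P: "Partial_order P"
    and val: "\<And>x. x \<in> Field P \<Longrightarrow> f x \<in> M_set Q"
    and mono: "\<And>x y U. (x, y) \<in> P \<Longrightarrow> U \<in> scott_opens Q \<Longrightarrow> f x U \<le> f y U"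
    and lim: "\<And>T x U. directed P T \<Longrightarrow> is_lub P T x \<Longrightarrow> U \<in> scott_opens Q \<Longrightarrow>
      ((\<lambda>t. f t U) \<longlongrightarrow> f x U) (tails P T)"
  shows "scott_continuous P (M_dcpo Q) f"
  unfolding scott_continuous_def
proof (intro conjI allI impI)
  show "f \<in> Field P \<rightarrow> Field (M_dcpo Q)" using val by simp
  show "(f x, f y) \<in> M_dcpo Q" if "(x, y) \<in> P" for x y
    using that val mono by (simp add: M_dcpo_iff FieldI1 FieldI2)
  fix T x assume T: "directed P T" "is_lub P T x"
  have "f x \<in> extensional (scott_opens Q)" using T(2) val by (auto simp: is_lub_def M_valuation valuations_ext)
  then show "is_lub (M_dcpo Q) (f ` T) (f x)"
    using T val mono lim by (intro is_lub_M_image[OF P T(1)]) (auto simp: directed_def)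
qed

text \<open>That a formula stays within \<open>M_set Q\<close> has to be checked on simple
  valuations only, provided that it is monotone and commutes with pointwise directed limits. Convex
  combinations, image valuations and the multiplication all arise in this way.\<close>

lemma M_transform:
  assumes simple: "\<And>\<sigma>. \<sigma> \<in> simple_valuations P \<Longrightarrow> h \<sigma> \<in> M_set Q"
    and ext: "\<And>\<nu>. \<nu> \<in> M_set P \<Longrightarrow> h \<nu> \<in> extensional (scott_opens Q)"
    and mono: "\<And>\<nu> \<xi> U. (\<nu>, \<xi>) \<in> M_dcpo P \<Longrightarrow> U \<in> scott_opens Q \<Longrightarrow> h \<nu> U \<le> h \<xi> U"
    and lim: "\<And>T \<nu> U. directed (M_dcpo P) T \<Longrightarrow> is_lub (M_dcpo P) T \<nu> \<Longrightarrow> U \<in> scott_opens Q \<Longrightarrow>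
      ((\<lambda>\<xi>. h \<xi> U) \<longlongrightarrow> h \<nu> U) (tails (M_dcpo P) T)"
  shows "scott_continuous (M_dcpo P) (M_dcpo Q) h"
proof (rule scott_continuous_into_M[OF Partial_order_M_dcpo])
  fix \<nu> assume "\<nu> \<in> Field (M_dcpo P)"
  then have "\<nu> \<in> M_set P" by simp
  then show "h \<nu> \<in> M_set Q"
  proof (induction rule: M_induct)
    case (lub T \<xi>)
    show ?case
      by (rule M_set_limit[OF Partial_order_M_dcpo lub.hyps(1), of h])
        (simp_all add: lub.IH mono ext lub.hyps lim[OF lub.hyps(1,2)])
  qed (rule simple)
qed (use mono lim in auto)


section \<open>The valuation monad\<close>

lemma simple_val_in_M:
  "finite I \<Longrightarrow> (\<And>i. i \<in> I \<Longrightarrow> 0 \<le> c i \<and> x i \<in> Field P) \<Longrightarrow> sum c I \<le> 1 \<Longrightarrow> simple_val P I c x \<in> M_set P"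
  using simple_val_in_simple_valuations[of I c x P] simple_valuations_subset_M[of P] by blast

lemma dirac_in_M: "a \<in> Field P \<Longrightarrow> dirac P a \<in> M_set P"
  unfolding dirac_eq_simple_val[of P a "0::nat"] by (rule simple_val_in_M) auto

lemma M_set_ext: "\<nu> \<in> M_set P \<Longrightarrow> \<nu> \<in> extensional (scott_opens P)"
  by (simp add: M_valuation valuations_ext)

section \<open>Convex combinations of valuations\<close>

definition zero_val :: "'a rel \<Rightarrow> 'a set \<Rightarrow> real" where
  "zero_val P = (\<lambda>U\<in>scott_opens P. 0)"

lemma zero_val_eq_simple_val: "zero_val P = simple_val P {} c x"
  by (simp add: zero_val_def simple_val_def)

lemma zero_val_in_M: "zero_val P \<in> M_set P"
  unfolding zero_val_eq_simple_val[of P "\<lambda>_::nat. 0" undefined] by (rule simple_val_in_M) auto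

definition mix :: "'a rel \<Rightarrow> real \<Rightarrow> ('a set \<Rightarrow> real) \<Rightarrow> ('a set \<Rightarrow> real) \<Rightarrow> 'a set \<Rightarrow> real" where
  "mix P r \<nu> \<xi> = (\<lambda>U\<in>scott_opens P. r * \<nu> U + (1 - r) * \<xi> U)"

lemma mix_commute: "mix P r \<nu> \<xi> = mix P (1 - r) \<xi> \<nu>"
  by (auto simp: mix_def)

lemma mix_simple_val:
  assumes "finite I" "finite J"
  shows "mix P r (simple_val P I c x) (simple_val P J d y) =
    simple_val P (I <+> J) (case_sum (\<lambda>i. r * c i) (\<lambda>j. (1 - r) * d j)) (case_sum x y)"
  unfolding mix_def simple_val_def
proof (rule restrict_ext)
  fix U assume "U \<in> scott_opens P"
  then show "r * (\<lambda>U\<in>scott_opens P. \<Sum>i\<in>I. c i * indicator U (x i)) U +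
      (1 - r) * (\<lambda>U\<in>scott_opens P. \<Sum>i\<in>J. d i * indicator U (y i)) U =
    (\<Sum>i\<in>I <+> J. case_sum (\<lambda>i. r * c i) (\<lambda>j. (1 - r) * d j) i * indicator U (case_sum x y i))"
    using assms by (simp add: sum.Plus sum_distrib_left mult.assoc del: sum_mult_indicator)
qed

lemma mix_simple_valuations:
  assumes r: "0 \<le> r" "r \<le> 1" and "\<sigma> \<in> simple_valuations P" "\<tau> \<in> simple_valuations P"
  shows "mix P r \<sigma> \<tau> \<in> simple_valuations P"
proof -
  from assms(3) obtain n :: nat and c x where \<sigma>: "\<sigma> = simple_val P {..<n} c x"
    "\<And>i. i < n \<Longrightarrow> 0 < c i" "\<And>i. i < n \<Longrightarrow> x i \<in> Field P" "(\<Sum>i<n. c i) \<le> 1"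
    by (rule simple_valuationsE) blast
  from assms(4) obtain m :: nat and d y where \<tau>: "\<tau> = simple_val P {..<m} d y"
    "\<And>i. i < m \<Longrightarrow> 0 < d i" "\<And>i. i < m \<Longrightarrow> y i \<in> Field P" "(\<Sum>i<m. d i) \<le> 1"
    by (rule simple_valuationsE) blast
  have "sum (case_sum (\<lambda>i. r * c i) (\<lambda>j. (1 - r) * d j)) ({..<n} <+> {..<m})
      = r * (\<Sum>i<n. c i) + (1 - r) * (\<Sum>i<m. d i)"
    by (simp add: sum.Plus sum_distrib_left)
  also have "\<dots> \<le> r * 1 + (1 - r) * 1"
    using r \<sigma>(4) \<tau>(4) by (intro add_mono mult_left_mono) auto
  finally have total: "sum (case_sum (\<lambda>i. r * c i) (\<lambda>j. (1 - r) * d j)) ({..<n} <+> {..<m}) \<le> 1" by simp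
  show ?thesis
    unfolding \<sigma>(1) \<tau>(1) mix_simple_val[OF finite_lessThan finite_lessThan]
    using r \<sigma>(2,3) \<tau>(2,3) total
    by (intro simple_val_in_simple_valuations) (auto simp: less_imp_le)
qed

lemma mix_continuous_aux:
  assumes r: "0 \<le> r" "r \<le> 1"
    and "\<And>\<sigma>. \<sigma> \<in> simple_valuations P \<Longrightarrow> mix P r \<sigma> \<xi> \<in> M_set P"
  shows "scott_continuous (M_dcpo P) (M_dcpo P) (\<lambda>\<nu>. mix P r \<nu> \<xi>)"
proof (rule M_transform)
  show "mix P r \<nu> \<xi> U \<le> mix P r \<nu>' \<xi> U" if "(\<nu>, \<nu>') \<in> M_dcpo P" "U \<in> scott_opens P" for \<nu> \<nu>' U
    using that r by (auto simp: mix_def M_dcpo_iff intro!: mult_left_mono)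
  show "((\<lambda>\<nu>. mix P r \<nu> \<xi> U) \<longlongrightarrow> mix P r \<nu> \<xi> U) (tails (M_dcpo P) T)"
    if "directed (M_dcpo P) T" "is_lub (M_dcpo P) T \<nu>" "U \<in> scott_opens P" for T \<nu> U
    using is_lub_M_tendsto[OF that] that(3) by (auto simp: mix_def intro!: tendsto_intros)
qed (use assms(3) in \<open>auto simp: mix_def\<close>)

text \<open>Membership is extended one argument at a time: against a fixed simple
  \<open>\<sigma>\<close> the valuation \<open>\<xi>\<close> is reached first, through the commuted
  combination; then \<open>\<sigma>\<close> may be replaced by any member.\<close>

lemma mix_continuous_left:
  assumes r: "0 \<le> r" "r \<le> 1" and "\<xi> \<in> M_set P"
  shows "scott_continuous (M_dcpo P) (M_dcpo P) (\<lambda>\<nu>. mix P r \<nu> \<xi>)"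
proof (rule mix_continuous_aux[OF r])
  fix \<sigma> assume \<sigma>: "\<sigma> \<in> simple_valuations P"
  have "mix P (1 - r) \<tau> \<sigma> \<in> M_set P" if "\<tau> \<in> simple_valuations P" for \<tau>
    using mix_simple_valuations[of "1 - r" \<tau> P \<sigma>] r \<sigma> that simple_valuations_subset_M[of P] by auto
  then have "scott_continuous (M_dcpo P) (M_dcpo P) (\<lambda>\<nu>. mix P (1 - r) \<nu> \<sigma>)"
    using r by (intro mix_continuous_aux) auto
  then have "mix P (1 - r) \<xi> \<sigma> \<in> M_set P" using scott_continuous_in assms(3) by fastforce
  then show "mix P r \<sigma> \<xi> \<in> M_set P" using mix_commute[of P r \<sigma> \<xi>] by simp
qed

lemma mix_continuous_right:
  assumes r: "0 \<le> r" "r \<le> 1" and "\<nu> \<in> M_set P"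
  shows "scott_continuous (M_dcpo P) (M_dcpo P) (\<lambda>\<xi>. mix P r \<nu> \<xi>)"
  using mix_continuous_left[of "1 - r" \<nu> P] assms by (simp add: mix_commute[of P r])

lemma mix_in_M: "0 \<le> r \<Longrightarrow> r \<le> 1 \<Longrightarrow> \<nu> \<in> M_set P \<Longrightarrow> \<xi> \<in> M_set P \<Longrightarrow> mix P r \<nu> \<xi> \<in> M_set P"
  using scott_continuous_in[OF mix_continuous_left, of r \<xi> P \<nu>] by simp

definition M_pl :: "'a rel \<Rightarrow> real \<Rightarrow> ('a set \<Rightarrow> real) \<Rightarrow> ('a set \<Rightarrow> real) \<Rightarrow> 'a set \<Rightarrow> real" where
  "M_pl P = (\<lambda>r\<in>{0..1}. \<lambda>\<nu>\<in>M_set P. \<lambda>\<xi>\<in>M_set P. mix P r \<nu> \<xi>)"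

lemma mix_eqI: "(\<And>U. U \<in> scott_opens P \<Longrightarrow> r * \<nu> U + (1 - r) * \<xi> U = \<zeta> U) \<Longrightarrow> \<zeta> \<in> extensional (scott_opens P)
  \<Longrightarrow> mix P r \<nu> \<xi> = \<zeta>"
  by (rule valuation_eqI[of _ P]) (auto simp: mix_def)

lemma M_pl_eq: "0 \<le> r \<Longrightarrow> r \<le> 1 \<Longrightarrow> \<nu> \<in> M_set P \<Longrightarrow> \<xi> \<in> M_set P \<Longrightarrow> M_pl P r \<nu> \<xi> = mix P r \<nu> \<xi>"
  by (simp add: M_pl_def)

lemma mix_assoc:
  assumes "0 \<le> p" "p < 1" "0 \<le> r" "r < 1"
  shows "mix P r (mix P p \<alpha> \<beta>) \<gamma> = mix P (p * r) \<alpha> (mix P ((r - p * r) / (1 - p * r)) \<beta> \<gamma>)"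
proof (rule mix_eqI)
  have "p * r \<le> p * 1" using assms by (intro mult_left_mono) auto
  then have ne: "1 - p * r \<noteq> 0" using assms by linarith
  \<comment> \<open>The weights of \<open>\<beta>\<close> and \<open>\<gamma>\<close> on the nested
    side are \<open>(1 - p * r) * q = r - p * r\<close> and
    \<open>(1 - p * r) * (1 - q) = 1 - r\<close>, as on the other side.\<close>
  define q where "q = (r - p * r) / (1 - p * r)"
  have q: "(1 - p * r) * q = r - p * r" using ne by (simp add: q_def)
  then have q': "(1 - p * r) * (1 - q) = 1 - r" by (simp add: algebra_simps)
  fix U assume U: "U \<in> scott_opens P"
  have "p * r * \<alpha> U + (1 - p * r) * (q * \<beta> U + (1 - q) * \<gamma> U)
    = p * r * \<alpha> U + ((1 - p * r) * q) * \<beta> U + ((1 - p * r) * (1 - q)) * \<gamma> U"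
    by (simp add: algebra_simps)
  also have "\<dots> = r * (p * \<alpha> U + (1 - p) * \<beta> U) + (1 - r) * \<gamma> U"
    unfolding q q' by (simp add: algebra_simps)
  finally show "r * mix P p \<alpha> \<beta> U + (1 - r) * \<gamma> U
      = mix P (p * r) \<alpha> (mix P ((r - p * r) / (1 - p * r)) \<beta> \<gamma>) U"
    using U by (simp add: mix_def q_def)
qed (simp add: mix_def)

lemma pointed_barycentric_M: "pointed_barycentric (M_set P) (M_pl P) (zero_val P)"
proof
  show "zero_val P \<in> M_set P" by (rule zero_val_in_M)
  show "barycentric_algebra (M_set P) (M_pl P)"
    unfolding barycentric_algebra_def
  proof (intro conjI ballI)
    show "M_pl P \<in> {0..1} \<rightarrow>\<^sub>E M_set P \<rightarrow>\<^sub>E M_set P \<rightarrow>\<^sub>E M_set P"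
      unfolding M_pl_def by (intro restrict_PiE_iff[THEN iffD2] ballI mix_in_M) auto
  next
    fix \<alpha> \<beta> assume "\<alpha> \<in> M_set P" "\<beta> \<in> M_set P"
    then show "M_pl P 1 \<alpha> \<beta> = \<alpha>" by (simp add: M_pl_eq mix_eqI M_set_ext)
  next
    fix r :: real and \<alpha> \<beta> assume "r \<in> {0..1}" "\<alpha> \<in> M_set P" "\<beta> \<in> M_set P"
    then show "M_pl P r \<alpha> \<beta> = M_pl P (1 - r) \<beta> \<alpha>" using mix_commute[of P r \<alpha> \<beta>] by (simp add: M_pl_eq)
  next
    fix r :: real and \<alpha> assume "r \<in> {0..1}" "\<alpha> \<in> M_set P"
    then show "M_pl P r \<alpha> \<alpha> = \<alpha>" by (simp add: M_pl_eq mix_eqI M_set_ext algebra_simps)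
  next
    fix p r :: real and \<alpha> \<beta> \<gamma>
    assume *: "p \<in> {0..<1}" "r \<in> {0..<1}" "\<alpha> \<in> M_set P" "\<beta> \<in> M_set P" "\<gamma> \<in> M_set P"
    have pr: "0 \<le> p * r" "p * r \<le> 1" "p * r \<le> r" using * by (auto simp: mult_le_one mult_left_le_one_le)
    then have q: "0 \<le> (r - p * r) / (1 - p * r)" "(r - p * r) / (1 - p * r) \<le> 1"
      using * by (auto simp: divide_le_eq_1)
    show "M_pl P r (M_pl P p \<alpha> \<beta>) \<gamma> = M_pl P (p * r) \<alpha> (M_pl P ((r - p * r) / (1 - p * r)) \<beta> \<gamma>)"
      using * pr q by (simp add: M_pl_eq mix_in_M mix_assoc)
  qed
qed

text \<open>Evaluation at an open set is affine and vanishes at the zero valuation, so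
  \<open>bary_affine\<close> computes the abstract barycentre open by open.\<close>

lemma bary_M:
  assumes "finite I" "\<And>i. i \<in> I \<Longrightarrow> 0 \<le> c i \<and> \<nu> i \<in> M_set P" "sum c I \<le> 1"
  shows "pointed_barycentric.bary (M_set P) (M_pl P) (zero_val P) I c \<nu>
       = (\<lambda>U\<in>scott_opens P. \<Sum>i\<in>I. c i * \<nu> i U)"
proof -
  interpret pointed_barycentric "M_set P" "M_pl P" "zero_val P" by (rule pointed_barycentric_M)
  have w: "weights I c \<nu>" using assms by (auto simp: weights_def)
  show ?thesis
  proof (rule valuation_eqI[of _ P])
    show "bary I c \<nu> \<in> extensional (scott_opens P)" using bary_in[OF w] by (rule M_set_ext)
    fix U assume U: "U \<in> scott_opens P"
    have "bary I c \<nu> U = (\<Sum>i\<in>I. c i * \<nu> i U)"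
      by (rule bary_affine[OF pointed_barycentric_M _ _ w, of "\<lambda>\<xi>. \<xi> U"])
        (use U in \<open>simp_all add: zero_val_def M_pl_eq mix_def\<close>)
    then show "bary I c \<nu> U = (\<lambda>U\<in>scott_opens P. \<Sum>i\<in>I. c i * \<nu> i U) U" using U by simp
  qed simp
qed

text \<open>Simple valuations are thereby generated by Dirac valuations: a map preserving the
  operations and the zero is determined on them by its values on Dirac valuations.\<close>

lemma simple_val_eq_bary:
  assumes "finite I" "\<And>i. i \<in> I \<Longrightarrow> 0 \<le> c i \<and> x i \<in> Field P" "sum c I \<le> 1"
  shows "simple_val P I c x = pointed_barycentric.bary (M_set P) (M_pl P) (zero_val P) I c (\<lambda>i. dirac P (x i))"
proof -
  have "simple_val P I c x = (\<lambda>U\<in>scott_opens P. \<Sum>i\<in>I. c i * dirac P (x i) U)"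
    unfolding simple_val_def by (rule restrict_ext) (simp add: dirac_def)
  then show ?thesis using assms by (subst bary_M) (auto simp: dirac_in_M)
qed

lemma dirac_mono: "(x, y) \<in> P \<Longrightarrow> U \<in> scott_opens P \<Longrightarrow> dirac P x U \<le> dirac P y U"
  using scott_opens_up[of U P x y] by (auto simp: dirac_def indicator_def)

lemma dirac_continuous:
  assumes P: "Partial_order P"
  shows "scott_continuous P (M_dcpo P) (dirac P)"
proof (rule scott_continuous_into_M[OF P])
  fix T x U assume T: "directed P T" "is_lub P T x" and U: "U \<in> scott_opens P"
  show "((\<lambda>t. dirac P t U) \<longlongrightarrow> dirac P x U) (tails P T)"
  proof (rule tendsto_eventually)
    \<comment> \<open>If \<open>x\<close> lies in the open set \<open>U\<close>, then
      \<open>T\<close> enters \<open>U\<close> and stays there; otherwise \<open>T\<close> avoids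
      \<open>U\<close>, which is upward closed.\<close>
    show "eventually (\<lambda>t. dirac P t U = dirac P x U) (tails P T)"
    proof (cases "x \<in> U")
      case True
      then obtain t where t: "t \<in> T" "t \<in> U" using scott_opens_meet[OF U T] by blast
      have "s \<in> U" if "(t, s) \<in> P" for s using scott_opens_up[OF U t(2) that] .
      then show ?thesis using eventually_tails_above[OF P T(1) t(1)]
        by (auto elim!: eventually_mono simp: dirac_def True indicator_def)
    next
      case False
      have "t \<notin> U" if "t \<in> T" for t
        using scott_opens_up[OF U, of t x] T(2) that False unfolding is_lub_def by blast
      then show ?thesis using eventually_tails_in[OF P T(1)]
        by (auto elim!: eventually_mono simp: dirac_def False indicator_def)
    qed
  qed
qed (simp_all add: dirac_in_M dirac_mono)

lemma scale_continuous_M: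
  assumes "\<nu> \<in> M_set P"
  shows "scott_continuous unit_interval (M_dcpo P) (\<lambda>r. mix P r \<nu> (zero_val P))"
proof (rule scott_continuous_into_M[OF Partial_order_unit_interval])
  show "mix P r \<nu> (zero_val P) \<in> M_set P" if "r \<in> Field unit_interval" for r
    using that assms zero_val_in_M by (intro mix_in_M) auto
  show "mix P r \<nu> (zero_val P) U \<le> mix P s \<nu> (zero_val P) U" if "(r, s) \<in> unit_interval" "U \<in> scott_opens P" for r s U
    using that valuations_nonneg[OF M_valuation[OF assms] that(2)]
    by (auto simp: mix_def zero_val_def unit_interval_iff intro: mult_right_mono)
  fix T :: "real set" and s U
  assume T: "directed unit_interval T" "is_lub unit_interval T s" and U: "U \<in> scott_opens P"
  have "((\<lambda>r. r) \<longlongrightarrow> s) (tails unit_interval T)"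
  proof -
    have "T \<subseteq> {0..1}" "T \<noteq> {}" using T(1) by (auto simp: directed_def)
    then have "(\<forall>x\<in>T. x \<le> s) \<and> (\<forall>b. (\<forall>x\<in>T. x \<le> b) \<longrightarrow> s \<le> b)" using T(2) is_lub_unit_interval by blast
    then show ?thesis
      by (subst tendsto_tails_iff[OF Partial_order_unit_interval T(1)]) (auto simp: unit_interval_iff)
  qed
  then show "((\<lambda>r. mix P r \<nu> (zero_val P) U) \<longlongrightarrow> mix P s \<nu> (zero_val P) U) (tails unit_interval T)"
    using U by (auto simp: mix_def zero_val_def intro!: tendsto_intros)
qed

section \<open>Image valuations\<close>

lemma M_map_simple_val:
  assumes "scott_continuous P Q f" "\<And>i. i \<in> I \<Longrightarrow> x i \<in> Field P"
  shows "M_map P Q f (simple_val P I c x) = simple_val Q I c (\<lambda>i. f (x i))"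
  unfolding M_map_def simple_val_def
proof (rule restrict_ext)
  fix V assume V: "V \<in> scott_opens Q"
  show "(\<lambda>U\<in>scott_opens P. \<Sum>i\<in>I. c i * indicator U (x i)) {x \<in> Field P. f x \<in> V}
     = (\<Sum>i\<in>I. c i * indicator V (f (x i)))"
    using scott_opens_vimage[OF assms(1) V] assms(2) by (auto simp: indicator_def intro!: sum.cong)
qed

lemma M_map_dirac: "scott_continuous P Q f \<Longrightarrow> a \<in> Field P \<Longrightarrow> M_map P Q f (dirac P a) = dirac Q (f a)"
  unfolding dirac_eq_simple_val[of _ _ "0::nat"] by (rule M_map_simple_val) auto

lemma M_map_continuous:
  assumes f: "scott_continuous P Q f"
  shows "scott_continuous (M_dcpo P) (M_dcpo Q) (M_map P Q f)"
proof (rule M_transform)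
  fix \<sigma> assume "\<sigma> \<in> simple_valuations P"
  then obtain n :: nat and c x where \<sigma>: "\<sigma> = simple_val P {..<n} c x"
    "\<And>i. i < n \<Longrightarrow> 0 < c i" "\<And>i. i < n \<Longrightarrow> x i \<in> Field P" "(\<Sum>i<n. c i) \<le> 1"
    by (rule simple_valuationsE) blast
  have "M_map P Q f \<sigma> = simple_val Q {..<n} c (\<lambda>i. f (x i))"
    unfolding \<sigma>(1) using \<sigma>(3) by (intro M_map_simple_val[OF f]) auto
  also have "\<dots> \<in> M_set Q"
    using \<sigma>(2-4) scott_continuous_in[OF f] by (intro simple_val_in_M) (auto simp: less_imp_le)
  finally show "M_map P Q f \<sigma> \<in> M_set Q" .
next
  show "M_map P Q f \<nu> V \<le> M_map P Q f \<xi> V" if "(\<nu>, \<xi>) \<in> M_dcpo P" "V \<in> scott_opens Q" for \<nu> \<xi> V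
    using that scott_opens_vimage[OF f that(2)] by (simp add: M_map_def M_dcpo_iff)
  show "((\<lambda>\<nu>. M_map P Q f \<nu> V) \<longlongrightarrow> M_map P Q f \<nu> V) (tails (M_dcpo P) T)"
    if "directed (M_dcpo P) T" "is_lub (M_dcpo P) T \<nu>" "V \<in> scott_opens Q" for T \<nu> V
    using is_lub_M_tendsto[OF that(1,2) scott_opens_vimage[OF f that(3)]] that(3) by (simp add: M_map_def)
qed (simp add: M_map_def)

section \<open>Integrals of antitone functions and the multiplication\<close>

lemma antitone_integrable:
  fixes g :: "real \<Rightarrow> real"
  assumes "\<And>s t. a \<le> s \<Longrightarrow> s \<le> t \<Longrightarrow> t \<le> b \<Longrightarrow> g t \<le> g s"
  shows "g integrable_on {a..b}"
proof -
  have "(\<lambda>t. - g t) integrable_on {a..b}"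
    using assms by (intro integrable_on_mono_on mono_onI) auto
  then show ?thesis using integrable_neg_iff by blast
qed

text \<open>On each of the \<open>n\<close> intervals the integral lies between the two end values
  divided by \<open>n\<close>, and the errors telescope. The bound depends on \<open>g\<close> only
  through \<open>g 0 - g 1\<close>, hence is uniform over functions with values between 0 and
  1.\<close>

lemma antitone_riemann_sum:
  fixes g :: "real \<Rightarrow> real"
  assumes g: "\<And>s t. 0 \<le> s \<Longrightarrow> s \<le> t \<Longrightarrow> t \<le> 1 \<Longrightarrow> g t \<le> g s" and n: "n > 0"
  shows "\<bar>integral {0..1} g - (\<Sum>k<n. g (real (Suc k) / n)) / n\<bar> \<le> (g 0 - g 1) / n"
proof -
  have part: "integral {0..real m / n} g - (\<Sum>k<m. g (real (Suc k) / n)) / n \<in> {0..(g 0 - g (real m / n)) / n}"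
    if "m \<le> n" for m
    using that
  proof (induction m)
    case (Suc m)
    define a where "a = real m / n"
    define b where "b = real (Suc m) / n"
    have ab: "0 \<le> a" "a \<le> b" "b \<le> 1" "b - a = 1 / n"
      using Suc.prems n by (auto simp: a_def b_def field_simps)
    have int: "g integrable_on {u..v}" if "0 \<le> u" "v \<le> 1" for u v
      using g that by (intro antitone_integrable) auto
    have split: "integral {0..b} g = integral {0..a} g + integral {a..b} g"
      using ab by (subst Henstock_Kurzweil_Integration.integral_combine) (auto intro: int)
    have "integral {a..b} (\<lambda>_. g b) \<le> integral {a..b} g"
      using ab g by (intro integral_le int) auto
    moreover have "integral {a..b} g \<le> integral {a..b} (\<lambda>_. g a)"
      using ab g by (intro integral_le int) auto
    ultimately have "g b / n \<le> integral {a..b} g" "integral {a..b} g \<le> g a / n"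
      using ab by simp_all
    moreover have "integral {0..a} g - (\<Sum>k<m. g (real (Suc k) / n)) / n \<in> {0..(g 0 - g a) / n}"
      using Suc by (simp add: a_def)
    ultimately show ?case
      unfolding b_def[symmetric] split sum.lessThan_Suc
      by (auto simp: b_def[symmetric] add_divide_distrib diff_divide_distrib)
  qed simp
  show ?thesis using part[of n] n by auto
qed

text \<open>The tails of a directed set need not form a countably generated filter, so convergence
  theorems for sequences do not apply. Instead, one \<open>n\<close> brings all the integrals within
  \<open>e / 3\<close> of their Riemann sums, and these involve finitely many values only.\<close>

lemma antitone_integral_limit:
  fixes g :: "'i \<Rightarrow> real \<Rightarrow> real"
  assumes ev: "eventually (\<lambda>i. (\<forall>s t. 0 \<le> s \<longrightarrow> s \<le> t \<longrightarrow> t \<le> 1 \<longrightarrow> g i t \<le> g i s) \<and> 0 \<le> g i 1 \<and> g i 0 \<le> 1) F"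
    and G: "\<And>s t. 0 \<le> s \<Longrightarrow> s \<le> t \<Longrightarrow> t \<le> 1 \<Longrightarrow> G t \<le> G s" "0 \<le> G 1" "G 0 \<le> 1"
    and lim: "\<And>t. 0 \<le> t \<Longrightarrow> t \<le> 1 \<Longrightarrow> ((\<lambda>i. g i t) \<longlongrightarrow> G t) F"
  shows "((\<lambda>i. integral {0..1} (g i)) \<longlongrightarrow> integral {0..1} G) F"
proof (rule tendstoI)
  fix e :: real assume e: "0 < e"
  obtain m :: nat where m: "inverse (real (Suc m)) < e / 3"
    using reals_Archimedean[of "e / 3"] e by auto
  define n where "n = Suc m"
  have n: "n > 0" "1 / n < e / 3" using m by (simp_all add: n_def inverse_eq_divide)
  define R where "R h = (\<Sum>k<n. h (real (Suc k) / n)) / n" for h :: "real \<Rightarrow> real"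
  have close: "\<bar>integral {0..1} h - R h\<bar> < e / 3"
    if "\<And>s t. 0 \<le> s \<Longrightarrow> s \<le> t \<Longrightarrow> t \<le> 1 \<Longrightarrow> h t \<le> h s" "0 \<le> h 1" "h 0 \<le> 1" for h
  proof -
    have "\<bar>integral {0..1} h - R h\<bar> \<le> (h 0 - h 1) / n"
      unfolding R_def by (rule antitone_riemann_sum[OF that(1) n(1)])
    also have "\<dots> \<le> 1 / n" using that n by (intro divide_right_mono) auto
    finally show ?thesis using n(2) by simp
  qed
  have "((\<lambda>i. R (g i)) \<longlongrightarrow> R G) F"
    unfolding R_def using n by (intro tendsto_divide tendsto_sum lim tendsto_const) auto
  then have "eventually (\<lambda>i. dist (R (g i)) (R G) < e / 3) F" using e by (intro tendstoD) auto
  with ev show "eventually (\<lambda>i. dist (integral {0..1} (g i)) (integral {0..1} G) < e) F"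
  proof eventually_elim
    case (elim i)
    have "\<bar>integral {0..1} (g i) - R (g i)\<bar> < e / 3" using elim(1) by (intro close) auto
    moreover have "\<bar>integral {0..1} G - R G\<bar> < e / 3" using G by (intro close) auto
    ultimately show ?case using elim(2) unfolding dist_real_def by linarith
  qed
qed

text \<open>The superlevel sets of evaluation at \<open>U\<close>, over which the multiplication
  integrates. The upper bound 1 is automatic for open \<open>U\<close>.\<close>

definition level :: "'a rel \<Rightarrow> 'a set \<Rightarrow> real \<Rightarrow> ('a set \<Rightarrow> real) set" where
  "level P U t = {\<nu> \<in> M_set P. \<nu> U \<in> {t<..1}}"

lemma level_open:
  assumes U: "U \<in> scott_opens P"
  shows "level P U t \<in> scott_opens (M_dcpo P)"
proof (rule scott_opensI)
  show "level P U t \<subseteq> Field (M_dcpo P)" by (auto simp: level_def)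
  show "\<xi> \<in> level P U t" if "\<nu> \<in> level P U t" "(\<nu>, \<xi>) \<in> M_dcpo P" for \<nu> \<xi>
  proof -
    have "\<xi> \<in> M_set P" "\<nu> U \<le> \<xi> U" "t < \<nu> U" using that U by (auto simp: M_dcpo_iff level_def)
    then show ?thesis using valuations_le_one[OF M_valuation U] by (auto simp: level_def)
  qed
  fix T \<nu> assume T: "directed (M_dcpo P) T" "is_lub (M_dcpo P) T \<nu>" and \<nu>: "\<nu> \<in> level P U t"
  have "eventually (\<lambda>\<xi>. t < \<xi> U) (tails (M_dcpo P) T)"
    using is_lub_M_tendsto[OF T U] \<nu> by (intro order_tendstoD) (auto simp: level_def)
  then have "eventually (\<lambda>\<xi>. t < \<xi> U \<and> \<xi> \<in> T) (tails (M_dcpo P) T)"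
    using eventually_tails_in[OF Partial_order_M_dcpo T(1)] by eventually_elim simp
  then obtain \<xi> where "t < \<xi> U" "\<xi> \<in> T"
    using eventually_happens'[OF tails_nontrivial[OF Partial_order_M_dcpo T(1)]] by blast
  moreover then have "\<xi> \<in> M_set P" using T(1) by (auto simp: directed_def)
  ultimately show "\<exists>\<xi>\<in>T. \<xi> \<in> level P U t"
    using valuations_le_one[OF M_valuation U] by (auto simp: level_def)
qed

lemma M_mult_eq:
  "M_mult P \<pi> = (\<lambda>U\<in>scott_opens P. integral {0..1} (\<lambda>t. \<pi> (level P U t)))"
  by (simp add: M_mult_def val_integral_def level_def)

text \<open>The layer-cake formula for a single number; \<open>t = a\<close> is the exceptional
  point, where the indicator of the closed interval differs.\<close>

lemma has_integral_below:
  fixes a :: real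
  assumes "0 \<le> a" "a \<le> 1"
  shows "((\<lambda>t. if t < a then 1 else 0) has_integral a) {0..1}"
proof (rule has_integral_spike_finite)
  have "((\<lambda>_. 1::real) has_integral a) {0..a}"
    using has_integral_const_real[of "1::real" 0 a] assms by simp
  then show "((\<lambda>t. if t \<in> {0..a} then 1 else 0) has_integral a) {0..1}"
    using assms by (subst has_integral_restrict) auto
  show "finite {a}" by simp
  show "\<And>t. t \<in> {0..1} - {a} \<Longrightarrow> (if t < a then 1 else 0) = (if t \<in> {0..a} then 1 else (0::real))" by auto
qed

text \<open>For a unit mass at \<open>\<nu> i\<close> the integrand is the indicator of
  \<open>t < \<nu> i U\<close>, whose integral is \<open>\<nu> i U\<close>; the rest is
  linearity.\<close>

lemma M_mult_simple_val:
  assumes "finite I" "\<And>i. i \<in> I \<Longrightarrow> \<nu> i \<in> M_set P"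
  shows "M_mult P (simple_val (M_dcpo P) I c \<nu>) = (\<lambda>U\<in>scott_opens P. \<Sum>i\<in>I. c i * \<nu> i U)"
  unfolding M_mult_eq
proof (rule restrict_ext)
  fix U assume U: "U \<in> scott_opens P"
  have le: "0 \<le> \<nu> i U" "\<nu> i U \<le> 1" if "i \<in> I" for i
    using valuations_nonneg[OF M_valuation U] valuations_le_one[OF M_valuation U] assms(2) that by auto
  have "((\<lambda>t. \<Sum>i\<in>I. c i * (if t < \<nu> i U then 1 else 0)) has_integral (\<Sum>i\<in>I. c i * \<nu> i U)) {0..1}"
    using le assms(1) by (intro has_integral_sum has_integral_mult_right has_integral_below) auto
  moreover have "simple_val (M_dcpo P) I c \<nu> (level P U t) = (\<Sum>i\<in>I. c i * (if t < \<nu> i U then 1 else 0))" for t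
    using level_open[OF U] assms(2) le
    by (auto simp: simple_val_def level_def indicator_def intro!: sum.cong)
  ultimately show "integral {0..1} (\<lambda>t. simple_val (M_dcpo P) I c \<nu> (level P U t)) = (\<Sum>i\<in>I. c i * \<nu> i U)"
    by (simp add: integral_unique)
qed

lemma M_mult_continuous: "scott_continuous (M_dcpo (M_dcpo P)) (M_dcpo P) (M_mult P)"
proof -
  have anti: "\<pi> (level P U t) \<le> \<pi> (level P U s)" if "\<pi> \<in> M_set (M_dcpo P)" "U \<in> scott_opens P" "s \<le> t" for \<pi> U s t
  proof -
    have "level P U t \<subseteq> level P U s" using that(3) by (auto simp: level_def)
    then show ?thesis
      using valuations_mono[OF M_valuation[OF that(1)] level_open[OF that(2)] level_open[OF that(2)]] by blast
  qed
  have bounds: "0 \<le> \<pi> (level P U t)" "\<pi> (level P U t) \<le> 1"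
    if "\<pi> \<in> M_set (M_dcpo P)" "U \<in> scott_opens P" for \<pi> U t
    using that by (auto intro!: valuations_nonneg[OF M_valuation] valuations_le_one[OF M_valuation] level_open)
  show ?thesis
  proof (rule M_transform)
    fix \<sigma> assume "\<sigma> \<in> simple_valuations (M_dcpo P)"
    then obtain n :: nat and c x where \<sigma>: "\<sigma> = simple_val (M_dcpo P) {..<n} c x"
      "\<And>i. i < n \<Longrightarrow> 0 < c i" "\<And>i. i < n \<Longrightarrow> x i \<in> Field (M_dcpo P)" "(\<Sum>i<n. c i) \<le> 1"
      by (rule simple_valuationsE) blast
    interpret pointed_barycentric "M_set P" "M_pl P" "zero_val P" by (rule pointed_barycentric_M)
    \<comment> \<open>Membership of this pointwise convex sum in \<open>M_set P\<close> comes from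
      its being a barycentre of members.\<close>
    have "M_mult P \<sigma> = bary {..<n} c x"
      unfolding \<sigma>(1) using \<sigma>(2-4) M_mult_simple_val[of "{..<n}" x P c] bary_M[of "{..<n}" c x P]
      by (simp add: less_imp_le)
    also have "\<dots> \<in> M_set P"
      using \<sigma>(2-4) by (intro bary_in) (auto simp: weights_def less_imp_le)
    finally show "M_mult P \<sigma> \<in> M_set P" .
  next
    show "M_mult P \<pi> U \<le> M_mult P \<rho> U" if "(\<pi>, \<rho>) \<in> M_dcpo (M_dcpo P)" "U \<in> scott_opens P" for \<pi> \<rho> U
      using that anti level_open[OF that(2)] unfolding M_mult_eq M_dcpo_iff[of _ _ "M_dcpo P"]
      by (simp, intro integral_le antitone_integrable) auto
    fix T \<pi> U assume T: "directed (M_dcpo (M_dcpo P)) T" "is_lub (M_dcpo (M_dcpo P)) T \<pi>"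
      and U: "U \<in> scott_opens P"
    have \<pi>: "\<pi> \<in> M_set (M_dcpo P)" using T(2) by (simp add: is_lub_def)
    have T_sub: "T \<subseteq> M_set (M_dcpo P)" using T(1) by (simp add: directed_def)
    have "((\<lambda>\<rho>. integral {0..1} (\<lambda>t. \<rho> (level P U t))) \<longlongrightarrow> integral {0..1} (\<lambda>t. \<pi> (level P U t)))
      (tails (M_dcpo (M_dcpo P)) T)"
    proof (rule antitone_integral_limit)
      show "eventually (\<lambda>\<rho>. (\<forall>s t. 0 \<le> s \<longrightarrow> s \<le> t \<longrightarrow> t \<le> 1 \<longrightarrow> \<rho> (level P U t) \<le> \<rho> (level P U s)) \<and>
          0 \<le> \<rho> (level P U 1) \<and> \<rho> (level P U 0) \<le> 1) (tails (M_dcpo (M_dcpo P)) T)"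
        using eventually_tails_in[OF Partial_order_M_dcpo T(1)]
      proof eventually_elim
        fix \<rho> assume "\<rho> \<in> T"
        then have "\<rho> \<in> M_set (M_dcpo P)" using T_sub by blast
        then show "(\<forall>s t. 0 \<le> s \<longrightarrow> s \<le> t \<longrightarrow> t \<le> 1 \<longrightarrow> \<rho> (level P U t) \<le> \<rho> (level P U s)) \<and>
          0 \<le> \<rho> (level P U 1) \<and> \<rho> (level P U 0) \<le> 1"
          using anti bounds U by simp
      qed
    qed (use \<pi> U in \<open>simp_all add: anti bounds is_lub_M_tendsto[OF T level_open]\<close>)
    then show "((\<lambda>\<rho>. M_mult P \<rho> U) \<longlongrightarrow> M_mult P \<pi> U) (tails (M_dcpo (M_dcpo P)) T)"
      using U by (simp add: M_mult_eq)
  qed (simp add: M_mult_eq)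
qed


section \<open>Barycentres in continuous Kegelspitzen\<close>

lemma continuous_domain_po: "continuous_domain P \<Longrightarrow> Partial_order P"
  by (simp add: continuous_domain_def dcpo_def)

lemma way_below_directed: "continuous_domain P \<Longrightarrow> y \<in> Field P \<Longrightarrow> directed P {x. way_below P x y}"
  by (simp add: continuous_domain_def)

lemma way_below_lub: "continuous_domain P \<Longrightarrow> y \<in> Field P \<Longrightarrow> is_lub P {x. way_below P x y} y"
  by (simp add: continuous_domain_def)

lemma way_below_Field: "way_below P x y \<Longrightarrow> x \<in> Field P" "way_below P x y \<Longrightarrow> y \<in> Field P"
  by (simp_all add: way_below_def)

lemma way_belowD:
  "way_below P x y \<Longrightarrow> directed P T \<Longrightarrow> is_lub P T z \<Longrightarrow> (y, z) \<in> P \<Longrightarrow> \<exists>t\<in>T. (x, t) \<in> P"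
  unfolding way_below_def by blast

lemma way_below_le:
  assumes "Partial_order P" "way_below P x y"
  shows "(x, y) \<in> P"
proof -
  have y: "y \<in> Field P" "(y, y) \<in> P" using assms po_refl way_below_Field(2) by metis+
  then have "directed P {y}" "is_lub P {y} y" by (auto simp: directed_def is_lub_def)
  then show ?thesis using way_belowD[OF assms(2) _ _ y(2), of "{y}"] by simp
qed

lemma way_below_mono:
  assumes P: "Partial_order P" and "(x', x) \<in> P" "way_below P x y" "(y, y') \<in> P"
  shows "way_below P x' y'"
  unfolding way_below_def
proof (intro conjI allI impI)
  show "x' \<in> Field P" "y' \<in> Field P" using assms by (auto intro: FieldI1 FieldI2)
  fix T z assume T: "directed P T" "is_lub P T z" "(y', z) \<in> P"
  obtain t where "t \<in> T" "(x, t) \<in> P"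
    using way_belowD[OF assms(3) T(1,2) po_trans[OF P assms(4) T(3)]] by blast
  then show "\<exists>t\<in>T. (x', t) \<in> P" using po_trans[OF P assms(2)] by blast
qed

text \<open>The elements two way-below steps beneath \<open>y\<close> form a directed set with
  supremum \<open>y\<close>. Since \<open>x \<lless> y\<close>, one of them lies above
  \<open>x\<close>, and its intermediate element is the interpolant.\<close>

lemma way_below_interpolate:
  assumes D: "continuous_domain P" and xy: "way_below P x y"
  shows "\<exists>z. way_below P x z \<and> way_below P z y"
proof -
  note P = continuous_domain_po[OF D]
  have y: "y \<in> Field P" using way_below_Field(2)[OF xy] .
  define T where "T = {w. \<exists>z. way_below P w z \<and> way_below P z y}"
  have dir: "\<exists>z. way_below P z u \<and> (a, z) \<in> P \<and> (b, z) \<in> P" if "way_below P a u" "way_below P b u" for a b u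
    using way_below_directed[OF D way_below_Field(2)[OF that(1)]] that unfolding directed_def by blast
  have ne: "\<exists>w. way_below P w z" if "z \<in> Field P" for z
    using way_below_directed[OF D that] unfolding directed_def by blast
  have "directed P T"
    unfolding directed_def
  proof (intro conjI ballI)
    show "T \<subseteq> Field P" by (auto simp: T_def way_below_Field)
    show "T \<noteq> {}" using ne[OF y] ne way_below_Field(1)[of P] unfolding T_def by blast
    fix a b assume "a \<in> T" "b \<in> T"
    then obtain za zb where z: "way_below P a za" "way_below P za y" "way_below P b zb" "way_below P zb y"
      unfolding T_def by blast
    obtain z where z': "way_below P z y" "(za, z) \<in> P" "(zb, z) \<in> P" using dir[OF z(2,4)] by blast
    have "(a, a) \<in> P" "(b, b) \<in> P" using po_refl[OF P] way_below_Field(1) z(1,3) by metis+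
    then have "way_below P a z" "way_below P b z"
      using way_below_mono[OF P _ z(1) z'(2)] way_below_mono[OF P _ z(3) z'(3)] by auto
    then obtain w where "way_below P w z" "(a, w) \<in> P" "(b, w) \<in> P" using dir by blast
    then show "\<exists>z\<in>T. (a, z) \<in> P \<and> (b, z) \<in> P" using z'(1) unfolding T_def by blast
  qed
  moreover have "is_lub P T y"
    unfolding is_lub_def
  proof (intro conjI ballI impI)
    show "y \<in> Field P" by (rule y)
    show "(t, y) \<in> P" if "t \<in> T" for t
      using that way_below_le[OF P] po_trans[OF P] unfolding T_def by blast
    fix u assume u: "u \<in> Field P" "\<forall>t\<in>T. (t, u) \<in> P"
    have "(z, u) \<in> P" if z: "way_below P z y" for z
      using way_below_lub[OF D way_below_Field(1)[OF z]] u z unfolding is_lub_def T_def by blast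
    then show "(y, u) \<in> P" using way_below_lub[OF D y] u(1) unfolding is_lub_def by blast
  qed
  ultimately obtain w where "w \<in> T" "(x, w) \<in> P"
    using way_belowD[OF xy _ _ po_refl[OF P y]] by blast
  then obtain z where "way_below P w z" "way_below P z y" unfolding T_def by blast
  moreover have "way_below P x z"
    using way_below_mono[OF P \<open>(x, w) \<in> P\<close> \<open>way_below P w z\<close> po_refl[OF P]]
      way_below_Field(2)[OF \<open>way_below P w z\<close>] by blast
  ultimately show ?thesis by blast
qed

lemma way_above_open:
  assumes D: "continuous_domain P"
  shows "{y. way_below P x y} \<in> scott_opens P"
proof (rule scott_opensI)
  note P = continuous_domain_po[OF D]
  show "{y. way_below P x y} \<subseteq> Field P" by (auto simp: way_below_Field)
  show "z \<in> {y. way_below P x y}" if "y \<in> {y. way_below P x y}" "(y, z) \<in> P" for y z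
    using way_below_mono[OF P po_refl[OF P way_below_Field(1)] _ that(2), of x] that(1) by simp
  fix T y assume T: "directed P T" "is_lub P T y" "y \<in> {y. way_below P x y}"
  then obtain z where z: "way_below P x z" "way_below P z y" using way_below_interpolate[OF D] by blast
  have "(y, y) \<in> P" using po_refl[OF P way_below_Field(2)[OF z(2)]] .
  then obtain t where "t \<in> T" "(z, t) \<in> P" using way_belowD[OF z(2) T(1,2)] by blast
  then show "\<exists>t\<in>T. t \<in> {y. way_below P x y}"
    using way_below_mono[OF P po_refl[OF P way_below_Field(1)[OF z(1)]] z(1)] by blast
qed

lemma directed_finite_bound:
  assumes P: "Partial_order P" "directed P T" and "finite F" "F \<subseteq> T"
  shows "\<exists>z\<in>T. \<forall>f\<in>F. (f, z) \<in> P"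
  using assms(3,4)
proof (induction F)
  case empty
  then show ?case using P(2) by (auto simp: directed_def)
next
  case (insert f F)
  then obtain z where z: "z \<in> T" "\<forall>f\<in>F. (f, z) \<in> P" by blast
  obtain w where "w \<in> T" "(f, w) \<in> P" "(z, w) \<in> P"
    using P(2) z(1) insert.prems unfolding directed_def by blast
  then show ?case using z(2) po_trans[OF P(1)] by (intro bexI[of _ w]) auto
qed

section \<open>Approximation of valuations by finite families\<close>

definition way_above :: "'a rel \<Rightarrow> ('i \<Rightarrow> 'a) \<Rightarrow> 'i set \<Rightarrow> 'a set" where
  "way_above P x I = (\<Union>i\<in>I. {y. way_below P (x i) y})"

lemma way_above_opens: "continuous_domain P \<Longrightarrow> way_above P x I \<in> scott_opens P"
  unfolding way_above_def using way_above_open[of P] by (intro scott_opens_Union) auto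

text \<open>This is the concrete description of the way-below relation between simple valuations and
  arbitrary ones on a continuous domain.\<close>

definition approx :: "'a rel \<Rightarrow> nat \<Rightarrow> (nat \<Rightarrow> real) \<Rightarrow> (nat \<Rightarrow> 'a) \<Rightarrow> ('a set \<Rightarrow> real) \<Rightarrow> bool" where
  "approx P n c x \<nu> \<longleftrightarrow>
     (\<forall>i<n. 0 < c i \<and> x i \<in> Field P) \<and> (\<Sum>i<n. c i) \<le> 1 \<and>
     (\<forall>I\<subseteq>{..<n}. I \<noteq> {} \<longrightarrow> sum c I < \<nu> (way_above P x I))"

lemma approx_mono:
  assumes "continuous_domain P" "approx P n c x \<nu>" "(\<nu>, \<xi>) \<in> M_dcpo P"
  shows "approx P n c x \<xi>"
proof -
  have "\<nu> (way_above P x I) \<le> \<xi> (way_above P x I)" for I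
    using assms(3) way_above_opens[OF assms(1), of x I] by (simp add: M_dcpo_iff)
  then show ?thesis using assms(2) unfolding approx_def by (meson less_le_trans)
qed

lemma approx_lub:
  assumes D: "continuous_domain P" and a: "approx P n c x \<nu>"
    and T: "directed (M_dcpo P) T" "is_lub (M_dcpo P) T \<nu>"
  shows "\<exists>\<tau>\<in>T. approx P n c x \<tau>"
proof -
  have "eventually (\<lambda>\<tau>. sum c I < \<tau> (way_above P x I)) (tails (M_dcpo P) T)"
    if "I \<in> Pow {..<n} - {{}}" for I
  proof (rule order_tendstoD(1)[OF is_lub_M_tendsto[OF T way_above_opens[OF D]]])
    show "sum c I < \<nu> (way_above P x I)" using a that by (simp add: approx_def)
  qed
  then have "eventually (\<lambda>\<tau>. \<forall>I\<in>Pow {..<n} - {{}}. sum c I < \<tau> (way_above P x I)) (tails (M_dcpo P) T)"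
    by (intro eventually_ball_finite) auto
  then have "eventually (\<lambda>\<tau>. \<tau> \<in> T \<and> (\<forall>I\<in>Pow {..<n} - {{}}. sum c I < \<tau> (way_above P x I))) (tails (M_dcpo P) T)"
    using eventually_tails_in[OF Partial_order_M_dcpo T(1)] by eventually_elim simp
  then obtain \<tau> where "\<tau> \<in> T" "\<forall>I\<in>Pow {..<n} - {{}}. sum c I < \<tau> (way_above P x I)"
    using eventually_happens'[OF tails_nontrivial[OF Partial_order_M_dcpo T(1)]] by blast
  then show ?thesis using a unfolding approx_def by blast
qed

lemma simple_val_way_above:
  assumes "continuous_domain P"
  shows "simple_val P I c y (way_above P x S) = (\<Sum>i\<in>I. c i * indicator (way_above P x S) (y i))"
  using way_above_opens[OF assms, of x S] by (simp add: simple_val_def del: sum_mult_indicator)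

lemma approx_shrink:
  assumes D: "continuous_domain P"
    and c: "\<And>i. i < n \<Longrightarrow> 0 < c i" "(\<Sum>i<n. c i) \<le> 1" and r: "0 < r" "r < 1"
    and y: "\<And>i. i < n \<Longrightarrow> way_below P (y' i) (y i)"
  shows "approx P n (\<lambda>i. r * c i) y' (simple_val P {..<n} c y)"
  unfolding approx_def
proof (intro conjI allI impI)
  show "0 < r * c i" "y' i \<in> Field P" if "i < n" for i
    using c(1) r way_below_Field(1)[OF y] that by auto
  have "0 \<le> (\<Sum>i<n. c i)" by (rule sum_nonneg) (simp add: c less_imp_le)
  then have "r * (\<Sum>i<n. c i) \<le> 1 * 1" using r c(2) by (intro mult_mono) auto
  then show "(\<Sum>i<n. r * c i) \<le> 1" by (simp add: sum_distrib_left)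
  fix I assume I: "I \<subseteq> {..<n}" "I \<noteq> {}"
  have fin: "finite I" using I finite_subset by blast
  \<comment> \<open>The factor \<open>r < 1\<close> supplies strictness, as \<open>I\<close> is
    nonempty and the weights are positive. Moving the points down to \<open>y'\<close> loses no
    mass, since each \<open>y i\<close> with \<open>i \<in> I\<close> lies in
    \<open>way_above P y' I\<close>.\<close>
  have "(\<Sum>i\<in>I. r * c i) < sum c I"
    using I fin c(1) r by (intro sum_strict_mono) auto
  also have "\<dots> = (\<Sum>i\<in>I. c i * indicator (way_above P y' I) (y i))"
    using I y by (intro sum.cong) (auto simp: way_above_def indicator_def)
  also have "\<dots> \<le> (\<Sum>i<n. c i * indicator (way_above P y' I) (y i))"
    using I c(1) by (intro sum_mono2) (auto simp: less_imp_le)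
  finally show "(\<Sum>i\<in>I. r * c i) < simple_val P {..<n} c y (way_above P y' I)"
    using simple_val_way_above[OF D] by metis
qed

section \<open>Order on weighted points and monotonicity of barycentres\<close>

locale cont_kegelspitze =
  fixes K :: "'a kegel"
  assumes ck: "continuous_kegelspitze K"
begin

abbreviation P where "P \<equiv> ord K"
abbreviation A where "A \<equiv> Field (ord K)"
abbreviation pl where "pl \<equiv> plus_op K"

lemma D: "continuous_domain P"
  using ck by (simp add: continuous_kegelspitze_def)

lemma po: "Partial_order P"
  by (rule continuous_domain_po[OF D])

sublocale pointed_barycentric A "plus_op K" "bt K"
  using ck by unfold_locales (simp_all add: continuous_kegelspitze_def kegelspitze_def)

lemma pl_continuous_left: "0 \<le> r \<Longrightarrow> r \<le> 1 \<Longrightarrow> b \<in> A \<Longrightarrow> scott_continuous P P (\<lambda>a. pl r a b)"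
  and pl_continuous_right: "0 \<le> r \<Longrightarrow> r \<le> 1 \<Longrightarrow> a \<in> A \<Longrightarrow> scott_continuous P P (\<lambda>b. pl r a b)"
  and scale_continuous: "a \<in> A \<Longrightarrow> scott_continuous unit_interval P (\<lambda>r. pl r a (bt K))"
  using ck unfolding continuous_kegelspitze_def kegelspitze_def scale_def by auto

lemma pl_mono:
  assumes r: "0 \<le> r" "r \<le> 1" and ab: "(a, a') \<in> P" "(b, b') \<in> P"
  shows "(pl r a b, pl r a' b') \<in> P"
proof -
  have F: "b \<in> A" "a' \<in> A" using ab by (auto intro: FieldI1 FieldI2)
  have "(pl r a b, pl r a' b) \<in> P"
    using scott_continuous_mono[OF pl_continuous_left[OF r F(1)] ab(1)] .
  moreover have "(pl r a' b, pl r a' b') \<in> P"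
    using scott_continuous_mono[OF pl_continuous_right[OF r F(2)] ab(2)] .
  ultimately show ?thesis by (rule po_trans[OF po])
qed

text \<open>A Kegelspitze is not defined with a least distinguished point; this follows from
  monotonicity of scaling between the factors 0 and 1.\<close>

lemma bot_least:
  assumes "a \<in> A"
  shows "(bt K, a) \<in> P"
proof -
  have "(0, 1) \<in> unit_interval" by (simp add: unit_interval_iff)
  then have "(pl 0 a (bt K), pl 1 a (bt K)) \<in> P" using scott_continuous_mono[OF scale_continuous[OF assms]] by blast
  then show ?thesis using assms bot_in by (simp add: pl_zero pl_one)
qed

text \<open>Only pairs of equal weight are comparable; a surplus of mass has to be traded against
  weight at bottom first.\<close>

definition cle :: "real \<times> 'a \<Rightarrow> real \<times> 'a \<Rightarrow> bool" where
  "cle p q \<longleftrightarrow> valid p \<and> valid q \<and> fst p = fst q \<and> (snd p, snd q) \<in> P"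

lemma cle_cadd:
  assumes "cle p q" "cle p' q'"
  shows "cle (cadd p p') (cadd q q')"
proof -
  have v: "valid p" "valid q" "valid p'" "valid q'" and f: "fst p = fst q" "fst p' = fst q'"
    and s: "(snd p, snd q) \<in> P" "(snd p', snd q') \<in> P" using assms by (auto simp: cle_def)
  have "(snd (cadd p p'), snd (cadd q q')) \<in> P"
  proof (cases "fst p = 0 \<or> fst p' = 0")
    case True
    then show ?thesis using v f s by (auto simp: cadd_def)
  next
    case False
    then have "0 < fst p" "0 < fst p'" using v valid_fst[of p] valid_fst[of p'] by auto
    then have "(pl (fst p / (fst p + fst p')) (snd p) (snd p'), pl (fst p / (fst p + fst p')) (snd q) (snd q')) \<in> P"
      using s by (intro pl_mono) auto
    then show ?thesis using v f False by (simp add: cadd_def)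
  qed
  then show ?thesis using v f by (simp add: cle_def valid_cadd fst_cadd)
qed

lemma cle_refl: "valid p \<Longrightarrow> cle p p"
  using po_refl[OF po] valid_snd by (simp add: cle_def)

lemma cle_F: "(\<And>i. i \<in> I \<Longrightarrow> cle (f i) (g i)) \<Longrightarrow> cle (cone.F f I) (cone.F g I)"
  by (induction I rule: infinite_finite_induct) (auto simp: cle_cadd cle_refl valid_zero)

lemma cle_cpt: "0 \<le> r \<Longrightarrow> a \<in> A \<Longrightarrow> b \<in> A \<Longrightarrow> (0 < r \<Longrightarrow> (a, b) \<in> P) \<Longrightarrow> cle (cpt r a) (cpt r b)"
  using po_refl[OF po bot_in] by (cases "r = 0") (auto simp: cle_def valid_cpt valid_zero, auto simp: cpt_def)

text \<open>The plan cuts \<open>c i\<close> into portions \<open>t i j\<close>, and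
  \<open>d j\<close> into the portions received plus a remainder \<open>e j\<close>. Both totals
  being 1, the remainders are matched by weight at bottom on the left. The comparison is then
  termwise: \<open>x i\<close> below \<open>y j\<close> on the portions, bottom below
  \<open>y j\<close> on the remainders.\<close>

lemma bary_mono:
  assumes w: "weights I c x" "weights J d y"
    and hall: "\<And>S. S \<subseteq> I \<Longrightarrow> sum c S \<le> sum d {j \<in> J. \<exists>i\<in>S. (x i, y j) \<in> P}"
  shows "(bary I c x, bary J d y) \<in> P"
proof -
  have I: "finite I" "\<And>i. i \<in> I \<Longrightarrow> 0 \<le> c i" "\<And>i. i \<in> I \<Longrightarrow> x i \<in> A" "sum c I \<le> 1"
    and J: "finite J" "\<And>j. j \<in> J \<Longrightarrow> 0 \<le> d j" "\<And>j. j \<in> J \<Longrightarrow> y j \<in> A" "sum d J \<le> 1"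
    using w by (auto simp: weights_def)
  obtain t where "transport (\<lambda>i j. (x i, y j) \<in> P) I J c d t"
    using fractional_hall[of I J c d "\<lambda>i j. (x i, y j) \<in> P"] I J hall by blast
  then have t: "\<And>i j. i \<in> I \<Longrightarrow> j \<in> J \<Longrightarrow> 0 \<le> t i j" "\<And>i j. i \<in> I \<Longrightarrow> j \<in> J \<Longrightarrow> 0 < t i j \<Longrightarrow> (x i, y j) \<in> P"
    "\<And>i. i \<in> I \<Longrightarrow> sum (t i) J = c i" "\<And>j. j \<in> J \<Longrightarrow> (\<Sum>i\<in>I. t i j) \<le> d j"
    unfolding transport_def by blast+
  define e where "e j = d j - (\<Sum>i\<in>I. t i j)" for j
  have e0: "0 \<le> e j" if "j \<in> J" for j using t(4)[OF that] by (simp add: e_def)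
  have te: "(\<Sum>i\<in>I. t i j) + e j = d j" for j by (simp add: e_def)
  have st0: "0 \<le> (\<Sum>i\<in>I. t i j)" if "j \<in> J" for j using t(1) that by (intro sum_nonneg) auto
  have "sum e J = sum d J - (\<Sum>j\<in>J. \<Sum>i\<in>I. t i j)" by (simp add: e_def sum_subtractf)
  also have "(\<Sum>j\<in>J. \<Sum>i\<in>I. t i j) = (\<Sum>i\<in>I. sum (t i) J)" by (rule sum.swap)
  also have "\<dots> = sum c I" using t(3) by simp
  finally have se: "sum e J = sum d J - sum c I" .
  have x_split: "cone.F (\<lambda>i. cpt (c i) (x i)) I = cone.F (\<lambda>i. cone.F (\<lambda>j. cpt (t i j) (x i)) J) I"
  proof (rule cone.cong)
    fix i assume i: "i \<in> I"
    show "cpt (c i) (x i) = cone.F (\<lambda>j. cpt (t i j) (x i)) J"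
      using F_cpt_const[of J "t i" "x i"] t(1,3) i I(3) by simp
  qed simp
  have y_split: "cone.F (\<lambda>j. cpt (d j) (y j)) J
      = cadd (cone.F (\<lambda>i. cone.F (\<lambda>j. cpt (t i j) (y j)) J) I) (cone.F (\<lambda>j. cpt (e j) (y j)) J)"
  proof -
    have "cone.F (\<lambda>i. cone.F (\<lambda>j. cpt (t i j) (y j)) J) I = cone.F (\<lambda>j. cone.F (\<lambda>i. cpt (t i j) (y j)) I) J"
      by (rule cone.swap)
    also have "\<dots> = cone.F (\<lambda>j. cpt (\<Sum>i\<in>I. t i j) (y j)) J"
    proof (rule cone.cong)
      show "cone.F (\<lambda>i. cpt (t i j) (y j)) I = cpt (\<Sum>i\<in>I. t i j) (y j)" if "j \<in> J" for j
        using F_cpt_const[of I "\<lambda>i. t i j" "y j"] t(1) J(3) that by simp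
    qed simp
    finally have "cadd (cone.F (\<lambda>i. cone.F (\<lambda>j. cpt (t i j) (y j)) J) I) (cone.F (\<lambda>j. cpt (e j) (y j)) J)
      = cone.F (\<lambda>j. cadd (cpt (\<Sum>i\<in>I. t i j) (y j)) (cpt (e j) (y j))) J"
      by (simp add: cone.distrib)
    also have "\<dots> = cone.F (\<lambda>j. cpt (d j) (y j)) J"
      by (rule cone.cong) (simp_all add: cpt_add st0 e0 te J(3))
    finally show ?thesis by simp
  qed
  have bot_split: "cpt (1 - sum c I) (bt K)
      = cadd (cone.F (\<lambda>j. cpt (e j) (bt K)) J) (cpt (1 - sum d J) (bt K))"
  proof -
    have "cone.F (\<lambda>j. cpt (e j) (bt K)) J = cpt (sum e J) (bt K)"
      using e0 bot_in by (intro F_cpt_const) auto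
    moreover have "0 \<le> sum e J" using e0 by (rule sum_nonneg)
    ultimately show ?thesis using J(4) bot_in by (simp add: cpt_add se)
  qed
  have "cle (csum I c x) (csum J d y)"
    unfolding csum_def x_split y_split bot_split cadd_assoc
  proof (intro cle_cadd cle_F)
    show "cle (cpt (t i j) (x i)) (cpt (t i j) (y j))" if "i \<in> I" "j \<in> J" for i j
      using that t(1,2) I(3) J(3) by (intro cle_cpt) auto
    show "cle (cpt (e j) (bt K)) (cpt (e j) (y j))" if "j \<in> J" for j
      using that e0 J(3) bot_in bot_least by (intro cle_cpt) auto
    show "cle (cpt (1 - sum d J) (bt K)) (cpt (1 - sum d J) (bt K))"
      using J(4) bot_in by (intro cle_refl valid_cpt) auto
  qed
  then show ?thesis by (simp add: cle_def bary_def)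
qed

section \<open>Barycentres of the approximants of a valuation\<close>

definition lower :: "('a set \<Rightarrow> real) \<Rightarrow> 'a set" where
  "lower \<nu> = {bary {..<n} c x | (n::nat) c x. approx P n c x \<nu>}"

lemma lowerI: "approx P n c x \<nu> \<Longrightarrow> bary {..<n} c x \<in> lower \<nu>"
  unfolding lower_def by blast

lemma lowerE:
  assumes "a \<in> lower \<nu>"
  obtains n c x where "approx P n c x \<nu>" "a = bary {..<n} c x"
  using assms unfolding lower_def by blast

lemma approx_weights: "approx P n c x \<nu> \<Longrightarrow> weights {..<n} c x"
  by (auto simp: approx_def weights_def less_imp_le)

lemma lower_subset: "lower \<nu> \<subseteq> A"
  unfolding lower_def using bary_in[OF approx_weights] by blast

text \<open>The empty family approximates every valuation, even zero. This is why
  \<open>approx\<close> constrains nonempty index sets only: at the empty set the strict inequality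
  would read \<open>0 < 0\<close>.\<close>

lemma lower_nonempty: "lower \<nu> \<noteq> {}"
  using lowerI[of 0 "\<lambda>_. 0" "\<lambda>_. bt K" \<nu>] by (auto simp: approx_def)

lemma lower_mono: "(\<nu>, \<xi>) \<in> M_dcpo P \<Longrightarrow> lower \<nu> \<subseteq> lower \<xi>"
  unfolding lower_def using approx_mono[OF D] by blast

text \<open>Hall's condition from approximation: \<open>sum d S\<close> is at most \<open>r\<close>
  times the weight of those \<open>y j\<close> that are way above some \<open>x i\<close> with
  \<open>i \<in> S\<close>, and the hypothesis on \<open>y'\<close> makes each such \<open>j\<close>
  a neighbour of \<open>S\<close>. The lemma serves shrunk families with \<open>r < 1\<close> and
  the original family with \<open>r = 1\<close>.\<close>

lemma approx_dominated:
  fixes n :: nat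
  assumes a: "approx P m d x (simple_val P {..<n} c y)"
    and c: "\<And>i. i < n \<Longrightarrow> 0 < c i" and w: "weights {..<n} (\<lambda>i. r * c i) y'" and r: "0 < r"
    and strict: "\<And>S. S \<subseteq> {..<m} \<Longrightarrow> S \<noteq> {} \<Longrightarrow> sum d S < r * simple_val P {..<n} c y (way_above P x S)"
    and y': "\<And>i j. i < m \<Longrightarrow> j < n \<Longrightarrow> way_below P (x i) (y j) \<Longrightarrow> (x i, y' j) \<in> P"
  shows "(bary {..<m} d x, bary {..<n} (\<lambda>i. r * c i) y') \<in> P"
proof (rule bary_mono[OF approx_weights[OF a] w])
  fix S assume S: "S \<subseteq> {..<m}"
  let ?N = "{j \<in> {..<n}. \<exists>i\<in>S. (x i, y' j) \<in> P}"
  show "sum d S \<le> (\<Sum>j\<in>?N. r * c j)"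
  proof (cases "S = {}")
    case False
    have "sum d S \<le> r * (\<Sum>j<n. c j * indicator (way_above P x S) (y j))"
      using strict[OF S False] simple_val_way_above[OF D] by (metis less_imp_le)
    also have "(\<Sum>j<n. c j * indicator (way_above P x S) (y j)) \<le> (\<Sum>j<n. if j \<in> ?N then c j else 0)"
    proof (rule sum_mono)
      fix j assume j: "j \<in> {..<n}"
      show "c j * indicator (way_above P x S) (y j) \<le> (if j \<in> ?N then c j else 0)"
        using y'[of _ j] c[of j] S j by (auto simp: way_above_def indicator_def)
    qed
    also have "(\<Sum>j<n. if j \<in> ?N then c j else 0) = sum c ?N"
      by (rule sum.mono_neutral_cong_right) auto
    finally show ?thesis using r by (simp add: sum_distrib_left)
  qed simp
qed

lemma approx_eventually_strict:
  assumes "approx P m d x \<nu>"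
  shows "eventually (\<lambda>r. \<forall>S\<in>Pow {..<m} - {{}}. sum d S < r * \<nu> (way_above P x S)) (at_left 1)"
proof (rule eventually_ball_finite)
  show "\<forall>S\<in>Pow {..<m} - {{}}. eventually (\<lambda>r. sum d S < r * \<nu> (way_above P x S)) (at_left 1)"
  proof
    fix S assume "S \<in> Pow {..<m} - {{}}"
    then have "sum d S < 1 * \<nu> (way_above P x S)" using assms by (simp add: approx_def)
    moreover have "((\<lambda>r. r * \<nu> (way_above P x S)) \<longlongrightarrow> 1 * \<nu> (way_above P x S)) (at_left 1)"
      by (intro tendsto_intros)
    ultimately show "eventually (\<lambda>r. sum d S < r * \<nu> (way_above P x S)) (at_left 1)"
      by (intro order_tendstoD(1))
  qed
qed simp

lemma lower_directed_simple:
  fixes n :: nat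
  assumes c: "\<And>i. i < n \<Longrightarrow> 0 < c i" "(\<Sum>i<n. c i) \<le> 1" and y: "\<And>i. i < n \<Longrightarrow> y i \<in> A"
  shows "directed P (lower (simple_val P {..<n} c y))" (is "directed P (lower ?\<sigma>)")
  unfolding directed_def
proof (intro conjI ballI)
  fix a b assume "a \<in> lower ?\<sigma>" "b \<in> lower ?\<sigma>"
  then obtain m1 d1 x1 m2 d2 x2 where a: "approx P m1 d1 x1 ?\<sigma>" "a = bary {..<m1} d1 x1"
    and b: "approx P m2 d2 x2 ?\<sigma>" "b = bary {..<m2} d2 x2"
    by (elim lowerE)
  \<comment> \<open>Finitely many points of the two approximants lie way below \<open>y j\<close>,
    and the points way below \<open>y j\<close> are directed, so one \<open>z\<close> dominates them
    all.\<close>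
  have "\<exists>z. way_below P z (y j) \<and> (\<forall>i<m1. way_below P (x1 i) (y j) \<longrightarrow> (x1 i, z) \<in> P) \<and>
      (\<forall>i<m2. way_below P (x2 i) (y j) \<longrightarrow> (x2 i, z) \<in> P)" if j: "j < n" for j
  proof -
    let ?F = "{z \<in> x1 ` {..<m1} \<union> x2 ` {..<m2}. way_below P z (y j)}"
    have "\<exists>z\<in>{z. way_below P z (y j)}. \<forall>f\<in>?F. (f, z) \<in> P"
      by (rule directed_finite_bound[OF po way_below_directed[OF D y[OF j]]]) auto
    then show ?thesis by auto
  qed
  then obtain y' where y': "\<And>j. j < n \<Longrightarrow> way_below P (y' j) (y j)"
    "\<And>i j. j < n \<Longrightarrow> i < m1 \<Longrightarrow> way_below P (x1 i) (y j) \<Longrightarrow> (x1 i, y' j) \<in> P"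
    "\<And>i j. j < n \<Longrightarrow> i < m2 \<Longrightarrow> way_below P (x2 i) (y j) \<Longrightarrow> (x2 i, y' j) \<in> P"
    by metis
  \<comment> \<open>A factor close enough to 1 preserves the finitely many strict inequalities of
    both approximants.\<close>
  have "eventually (\<lambda>r::real. 0 < r) (at_left 1)" "eventually (\<lambda>r::real. r < 1) (at_left 1)"
    using eventually_at_left_real[of 0 "1::real"] by (auto elim!: eventually_mono)
  with approx_eventually_strict[OF a(1)] approx_eventually_strict[OF b(1)]
  have "eventually (\<lambda>r. (\<forall>S\<in>Pow {..<m1} - {{}}. sum d1 S < r * ?\<sigma> (way_above P x1 S)) \<and>
      (\<forall>S\<in>Pow {..<m2} - {{}}. sum d2 S < r * ?\<sigma> (way_above P x2 S)) \<and> 0 < r \<and> r < 1) (at_left 1)"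
    by (intro eventually_conj)
  then obtain r where r: "\<forall>S\<in>Pow {..<m1} - {{}}. sum d1 S < r * ?\<sigma> (way_above P x1 S)"
    "\<forall>S\<in>Pow {..<m2} - {{}}. sum d2 S < r * ?\<sigma> (way_above P x2 S)" "0 < r" "r < 1"
    using eventually_happens'[OF trivial_limit_at_left_real] by blast
  have \<tau>: "approx P n (\<lambda>i. r * c i) y' ?\<sigma>"
    using approx_shrink[OF D c r(3,4) y'(1)] .
  have "(a, bary {..<n} (\<lambda>i. r * c i) y') \<in> P"
    unfolding a(2) by (rule approx_dominated[OF a(1) c(1) approx_weights[OF \<tau>] r(3)]) (use r(1) y'(2) in auto)
  moreover have "(b, bary {..<n} (\<lambda>i. r * c i) y') \<in> P"
    unfolding b(2) by (rule approx_dominated[OF b(1) c(1) approx_weights[OF \<tau>] r(3)]) (use r(2) y'(3) in auto)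
  ultimately show "\<exists>z\<in>lower ?\<sigma>. (a, z) \<in> P \<and> (b, z) \<in> P" using lowerI[OF \<tau>] by blast
qed (use lower_subset lower_nonempty in auto)

lemma lower_directed:
  assumes "\<nu> \<in> M_set P"
  shows "directed P (lower \<nu>)"
  using assms
proof (induction rule: M_induct)
  case (simple \<sigma>)
  then obtain n :: nat and c x where "\<sigma> = simple_val P {..<n} c x"
    "\<And>i. i < n \<Longrightarrow> 0 < c i" "\<And>i. i < n \<Longrightarrow> x i \<in> A" "(\<Sum>i<n. c i) \<le> 1"
    by (rule simple_valuationsE) blast
  then show ?case using lower_directed_simple[of n c x] by simp
next
  case (lub T \<xi>)
  show ?case
    unfolding directed_def
  proof (intro conjI ballI)
    fix a b assume "a \<in> lower \<xi>" "b \<in> lower \<xi>"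
    then obtain m1 d1 x1 m2 d2 x2 where a: "approx P m1 d1 x1 \<xi>" "a = bary {..<m1} d1 x1"
      and b: "approx P m2 d2 x2 \<xi>" "b = bary {..<m2} d2 x2"
      by (elim lowerE)
    \<comment> \<open>Each approximant of the supremum already approximates a member of
      \<open>T\<close>, and directedness of \<open>T\<close> brings both to a common one, where the
      induction hypothesis applies.\<close>
    obtain \<tau>1 \<tau>2 where \<tau>12: "\<tau>1 \<in> T" "approx P m1 d1 x1 \<tau>1" "\<tau>2 \<in> T" "approx P m2 d2 x2 \<tau>2"
      using approx_lub[OF D a(1) lub.hyps(1,2)] approx_lub[OF D b(1) lub.hyps(1,2)] by blast
    obtain \<tau> where \<tau>: "\<tau> \<in> T" "(\<tau>1, \<tau>) \<in> M_dcpo P" "(\<tau>2, \<tau>) \<in> M_dcpo P"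
      using lub.hyps(1) \<tau>12(1,3) unfolding directed_def by blast
    have "a \<in> lower \<tau>" "b \<in> lower \<tau>"
      unfolding a(2) b(2) using approx_mono[OF D] \<tau>12 \<tau> by (blast intro: lowerI)+
    then obtain z where "z \<in> lower \<tau>" "(a, z) \<in> P" "(b, z) \<in> P"
      using lub.IH[OF \<tau>(1)] unfolding directed_def by blast
    moreover have "(\<tau>, \<xi>) \<in> M_dcpo P" using lub.hyps(2) \<tau>(1) by (simp add: is_lub_def)
    ultimately show "\<exists>z\<in>lower \<xi>. (a, z) \<in> P \<and> (b, z) \<in> P" using lower_mono by blast
  qed (use lower_subset lower_nonempty in auto)
qed

section \<open>The algebra structure of a continuous Kegelspitze\<close>

definition beta :: "('a set \<Rightarrow> real) \<Rightarrow> 'a" where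
  "beta = (\<lambda>\<nu>\<in>M_set P. THE a. is_lub P (lower \<nu>) a)"

lemma beta_lub:
  assumes "\<nu> \<in> M_set P"
  shows "is_lub P (lower \<nu>) (beta \<nu>)"
proof -
  have "\<exists>a. is_lub P (lower \<nu>) a"
    using D lower_directed[OF assms] by (simp add: continuous_domain_def dcpo_def)
  then have "\<exists>!a. is_lub P (lower \<nu>) a" using is_lub_unique[OF po] by blast
  then show ?thesis unfolding beta_def using assms theI' by simp
qed

lemma beta_continuous: "scott_continuous (M_dcpo P) P beta"
  unfolding scott_continuous_def
proof (intro conjI allI impI)
  show "beta \<in> Field (M_dcpo P) \<rightarrow> A" using beta_lub by (auto simp: is_lub_def)
  show mono: "(beta \<nu>, beta \<xi>) \<in> P" if "(\<nu>, \<xi>) \<in> M_dcpo P" for \<nu> \<xi>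
    using that beta_lub[of \<nu>] beta_lub[of \<xi>] lower_mono[OF that] unfolding is_lub_def M_dcpo_iff by blast
  fix T \<nu> assume T: "directed (M_dcpo P) T" "is_lub (M_dcpo P) T \<nu>"
  have \<nu>: "\<nu> \<in> M_set P" using T(2) by (simp add: is_lub_def)
  have T_sub: "T \<subseteq> M_set P" using T(1) by (simp add: directed_def)
  show "is_lub P (beta ` T) (beta \<nu>)"
    unfolding is_lub_def
  proof (intro conjI ballI impI)
    show "beta \<nu> \<in> A" using beta_lub[OF \<nu>] by (simp add: is_lub_def)
    show "(a, beta \<nu>) \<in> P" if "a \<in> beta ` T" for a
      using that mono T(2) unfolding is_lub_def by blast
    fix u assume u: "u \<in> A" "\<forall>a\<in>beta ` T. (a, u) \<in> P"
    have "(a, u) \<in> P" if a: "a \<in> lower \<nu>" for a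
    proof -
      from a obtain n c x where a: "approx P n c x \<nu>" "a = bary {..<n} c x" by (rule lowerE)
      obtain \<tau> where \<tau>: "\<tau> \<in> T" "approx P n c x \<tau>" using approx_lub[OF D a(1) T] by blast
      then have "(a, beta \<tau>) \<in> P"
        using beta_lub[of \<tau>] lowerI[OF \<tau>(2)] T_sub a(2) unfolding is_lub_def by blast
      then show ?thesis using u(2) \<tau>(1) po_trans[OF po] by blast
    qed
    then show "(beta \<nu>, u) \<in> P" using beta_lub[OF \<nu>] u(1) unfolding is_lub_def by blast
  qed
qed

text \<open>The substitute for joint continuity. Induction on the number \<open>k\<close> of points
  that already equal their limits: for \<open>k = 0\<close> the factor \<open>r\<close> tends to 1,
  and in the step the point at index \<open>k\<close> tends to \<open>y k\<close> through the single
  operation isolated by \<open>bary_remove\<close>.\<close>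

lemma bary_le_of_shrunk:
  fixes n :: nat
  assumes c: "\<And>i. i < n \<Longrightarrow> 0 \<le> c i" "(\<Sum>i<n. c i) \<le> 1" and y: "\<And>i. i < n \<Longrightarrow> y i \<in> A" and u: "u \<in> A"
    and le: "\<And>r y'. 0 < r \<Longrightarrow> r < 1 \<Longrightarrow> (\<And>i. i < n \<Longrightarrow> way_below P (y' i) (y i)) \<Longrightarrow>
       (bary {..<n} (\<lambda>i. r * c i) y', u) \<in> P"
  shows "(bary {..<n} c y, u) \<in> P"
proof -
  have "(bary {..<n} c y', u) \<in> P"
    if "k \<le> n" "\<And>i. i < k \<Longrightarrow> y' i = y i" "\<And>i. k \<le> i \<Longrightarrow> i < n \<Longrightarrow> way_below P (y' i) (y i)" for k y'
    using that
  proof (induction k arbitrary: y')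
    case 0
    then have y': "way_below P (y' i) (y i)" if "i < n" for i using that by simp
    have w: "weights {..<n} c y'" using c way_below_Field(1)[OF y'] by (auto simp: weights_def)
    \<comment> \<open>The open interval has supremum 1 without attaining it, so continuity of
      scaling recovers the unscaled barycentre from factors strictly below 1.\<close>
    have "{0<..<1} \<subseteq> {0..1::real}" "{0<..<1::real} \<noteq> {}" by auto
    then have "is_lub unit_interval {0<..<1} 1"
      by (subst is_lub_unit_interval) (auto intro: dense_le_bounded[of 0 "1::real"])
    moreover have "directed unit_interval {0<..<1}"
      unfolding directed_def
    proof (intro conjI ballI)
      fix a b :: real assume "a \<in> {0<..<1}" "b \<in> {0<..<1}"
      then show "\<exists>z\<in>{0<..<1}. (a, z) \<in> unit_interval \<and> (b, z) \<in> unit_interval"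
        by (intro bexI[of _ "max a b"]) (auto simp: unit_interval_iff)
    qed auto
    ultimately have "is_lub P ((\<lambda>r. pl r (bary {..<n} c y') (bt K)) ` {0<..<1}) (pl 1 (bary {..<n} c y') (bt K))"
      using scott_continuous_lub[OF scale_continuous[OF bary_in[OF w]]] by blast
    moreover have "(pl r (bary {..<n} c y') (bt K), u) \<in> P" if "r \<in> {0<..<1}" for r
      using le[of r y'] y' that bary_scale[OF w, of r] by simp
    ultimately have "(pl 1 (bary {..<n} c y') (bt K), u) \<in> P" using u unfolding is_lub_def by blast
    then show ?case using bary_in[OF w] bot_in by (simp add: pl_one)
  next
    case (Suc k)
    have k: "k < n" using Suc.prems(1) by simp
    have yk: "y' k = y k" using Suc.prems(2) by simp
    have F: "y' i \<in> A" if "i < n" for i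
      using Suc.prems(2,3)[of i] y[OF that] way_below_Field(1) that by (metis not_less_eq_eq not_le)
    have w: "weights {..<n} c y'" using c F by (auto simp: weights_def)
    obtain b where b: "b \<in> A" "\<And>a. a \<in> A \<Longrightarrow> bary {..<n} c (y'(k := a)) = pl (c k) a b"
      using bary_remove[OF w, of k] k by blast
    have ck1: "0 \<le> c k" "c k \<le> 1"
      using c k member_le_sum[of k "{..<n}" c] by auto
    have "is_lub P ((\<lambda>a. pl (c k) a b) ` {z. way_below P z (y k)}) (pl (c k) (y k) b)"
      using scott_continuous_lub[OF pl_continuous_left[OF ck1 b(1)] way_below_directed[OF D y[OF k]] way_below_lub[OF D y[OF k]]] .
    moreover have "(pl (c k) z b, u) \<in> P" if z: "way_below P z (y k)" for z
    proof -
      \<comment> \<open>Lowering the point at \<open>k\<close> again leads back to a family with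
        only the first \<open>k\<close> points at their limits.\<close>
      have "(bary {..<n} c (y'(k := z)), u) \<in> P"
        using Suc.prems k z by (intro Suc.IH) (auto simp: less_Suc_eq le_Suc_eq)
      then show ?thesis using b(2)[OF way_below_Field(1)[OF z]] by simp
    qed
    ultimately have "(pl (c k) (y k) b, u) \<in> P" using u unfolding is_lub_def by blast
    then show ?case using b(2)[OF y[OF k]] yk by (metis fun_upd_triv)
  qed
  from this[of n y] show ?thesis by simp
qed

text \<open>Every approximant is transported into the family itself, with factor 1 and unmoved
  points, which bounds the supremum from above. Conversely, all shrunk families are approximants,
  and the barycentre lies below any bound of theirs.\<close>

lemma beta_simple_nat:
  fixes n :: nat
  assumes c: "\<And>i. i < n \<Longrightarrow> 0 < c i" "(\<Sum>i<n. c i) \<le> 1" and y: "\<And>i. i < n \<Longrightarrow> y i \<in> A"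
  shows "beta (simple_val P {..<n} c y) = bary {..<n} c y" (is "beta ?\<sigma> = _")
proof (rule po_antisym[OF po])
  have \<sigma>: "?\<sigma> \<in> M_set P" using c y by (intro simple_val_in_M) (auto simp: less_imp_le)
  have w: "weights {..<n} c y" using c y by (auto simp: weights_def less_imp_le)
  have "(a, bary {..<n} c y) \<in> P" if a: "a \<in> lower ?\<sigma>" for a
  proof -
    from a obtain m d x where a: "approx P m d x ?\<sigma>" "a = bary {..<m} d x" by (rule lowerE)
    have "(bary {..<m} d x, bary {..<n} (\<lambda>i. 1 * c i) y) \<in> P"
    proof (rule approx_dominated[OF a(1) c(1)])
      show "sum d S < 1 * simple_val P {..<n} c y (way_above P x S)" if "S \<subseteq> {..<m}" "S \<noteq> {}" for S
        using a(1) that by (simp add: approx_def)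
    qed (use w way_below_le[OF po] in simp_all)
    then show ?thesis using a(2) by simp
  qed
  then show "(beta ?\<sigma>, bary {..<n} c y) \<in> P"
    using beta_lub[OF \<sigma>] bary_in[OF w] unfolding is_lub_def by blast
  show "(bary {..<n} c y, beta ?\<sigma>) \<in> P"
  proof (rule bary_le_of_shrunk)
    show "beta ?\<sigma> \<in> A" using beta_lub[OF \<sigma>] by (simp add: is_lub_def)
    fix r y' assume "0 < r" "r < (1::real)" "\<And>i. i < n \<Longrightarrow> way_below P (y' i) (y i)"
    then have "bary {..<n} (\<lambda>i. r * c i) y' \<in> lower ?\<sigma>" using approx_shrink[OF D c] by (intro lowerI) blast
    then show "(bary {..<n} (\<lambda>i. r * c i) y', beta ?\<sigma>) \<in> P" using beta_lub[OF \<sigma>] by (simp add: is_lub_def)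
  qed (use c y in \<open>auto simp: less_imp_le\<close>)
qed

lemma beta_simple_val:
  assumes "weights I c x"
  shows "beta (simple_val P I c x) = bary I c x"
proof -
  have I: "finite I" "\<And>i. i \<in> I \<Longrightarrow> 0 \<le> c i" "\<And>i. i \<in> I \<Longrightarrow> x i \<in> A" "sum c I \<le> 1"
    using assms by (auto simp: weights_def)
  define J where "J = {i \<in> I. c i \<noteq> 0}"
  have J: "finite J" "J \<subseteq> I" using I(1) by (auto simp: J_def)
  obtain h where "bij_betw h {0..<card J} J" using ex_bij_betw_nat_finite[OF J(1)] by blast
  then have h: "bij_betw h {..<card J} J" by (simp add: lessThan_atLeast0)
  then have hJ: "h ` {..<card J} = J" "inj_on h {..<card J}" by (auto simp: bij_betw_def)
  have sumJ: "sum g I = sum g J" if "\<And>i. i \<in> I \<Longrightarrow> c i = 0 \<Longrightarrow> g i = 0" for g :: "_ \<Rightarrow> real"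
    using I(1) J(2) that by (intro sum.mono_neutral_right) (auto simp: J_def)
  have "simple_val P I c x = simple_val P J c x"
    unfolding simple_val_def by (rule restrict_ext) (rule sumJ, simp)
  also have "\<dots> = simple_val P {..<card J} (c \<circ> h) (x \<circ> h)"
    unfolding simple_val_def
  proof (rule restrict_ext)
    fix U
    show "(\<Sum>i\<in>J. c i * indicator U (x i)) = (\<Sum>i<card J. (c \<circ> h) i * indicator U ((x \<circ> h) i))"
      using sum.reindex_bij_betw[OF h, of "\<lambda>i. c i * indicator U (x i)"] by (simp del: sum_mult_indicator)
  qed
  finally have "beta (simple_val P I c x) = beta (simple_val P {..<card J} (c \<circ> h) (x \<circ> h))" by simp
  also have "\<dots> = bary {..<card J} (c \<circ> h) (x \<circ> h)"
  proof (rule beta_simple_nat)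
    fix i assume "i < card J"
    then have "h i \<in> J" using hJ(1) by auto
    then show "0 < (c \<circ> h) i" "(x \<circ> h) i \<in> A" using I(2,3)[of "h i"] by (auto simp: J_def less_le)
  next
    have "(\<Sum>i<card J. (c \<circ> h) i) = sum c J" using sum.reindex[OF hJ(2), of c] hJ(1) by simp
    then show "(\<Sum>i<card J. (c \<circ> h) i) \<le> 1" using sumJ[of c] I(4) by simp
  qed
  also have "\<dots> = bary J c x" using bary_reindex[OF hJ(2), of c x] hJ(1) by simp
  also have "\<dots> = bary I c x"
  proof -
    have "cone.F (\<lambda>i. cpt (c i) (x i)) I = cone.F (\<lambda>i. cpt (c i) (x i)) J"
      using I(1) J(2) by (intro cone.mono_neutral_right) (auto simp: J_def)
    then show ?thesis unfolding bary_def csum_def using sumJ[of c] by simp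
  qed
  finally show ?thesis .
qed

lemma simple_valuations_weights:
  assumes "\<sigma> \<in> simple_valuations P"
  obtains n :: nat and c x where "\<sigma> = simple_val P {..<n} c x" "weights {..<n} c x"
proof -
  from assms obtain n :: nat and c x where "\<sigma> = simple_val P {..<n} c x"
    "\<And>i. i < n \<Longrightarrow> 0 < c i" "\<And>i. i < n \<Longrightarrow> x i \<in> A" "(\<Sum>i<n. c i) \<le> 1"
    by (rule simple_valuationsE) blast
  then show thesis by (intro that[of n c x]) (auto simp: weights_def less_imp_le)
qed

lemma beta_in: "\<nu> \<in> M_set P \<Longrightarrow> beta \<nu> \<in> A"
  using scott_continuous_in[OF beta_continuous] by simp

lemma beta_mix_simple:
  assumes r: "0 \<le> r" "r \<le> 1" and "\<sigma> \<in> simple_valuations P" "\<tau> \<in> simple_valuations P"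
  shows "beta (mix P r \<sigma> \<tau>) = pl r (beta \<sigma>) (beta \<tau>)"
proof -
  obtain n :: nat and c x where \<sigma>: "\<sigma> = simple_val P {..<n} c x" and w: "weights {..<n} c x"
    using assms(3) by (rule simple_valuations_weights)
  obtain m :: nat and d y where \<tau>: "\<tau> = simple_val P {..<m} d y" and v: "weights {..<m} d y"
    using assms(4) by (rule simple_valuations_weights)
  have "sum (case_sum (\<lambda>i. r * c i) (\<lambda>j. (1 - r) * d j)) ({..<n} <+> {..<m})
      = r * (\<Sum>i<n. c i) + (1 - r) * (\<Sum>i<m. d i)"
    by (simp add: sum.Plus sum_distrib_left)
  also have "\<dots> \<le> r * 1 + (1 - r) * 1"
    using r w v by (intro add_mono mult_left_mono) (auto simp: weights_def)
  finally have "weights ({..<n} <+> {..<m}) (case_sum (\<lambda>i. r * c i) (\<lambda>j. (1 - r) * d j)) (case_sum x y)"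
    using r w v by (auto simp: weights_def)
  then show ?thesis
    unfolding \<sigma> \<tau> mix_simple_val[OF finite_lessThan finite_lessThan]
    by (simp add: beta_simple_val w v bary_mix[OF w v r])
qed

text \<open>Agreement on simple valuations is extended first in \<open>\<xi>\<close>, with a simple
  \<open>\<sigma>\<close> in the other place, and then in \<open>\<nu>\<close>.\<close>

lemma beta_mix:
  assumes r: "0 \<le> r" "r \<le> 1" and \<nu>: "\<nu> \<in> M_set P" and \<xi>: "\<xi> \<in> M_set P"
  shows "beta (mix P r \<nu> \<xi>) = pl r (beta \<nu>) (beta \<xi>)"
proof -
  have *: "beta (mix P r \<sigma> \<xi>) = pl r (beta \<sigma>) (beta \<xi>)" if \<sigma>: "\<sigma> \<in> simple_valuations P" for \<sigma>
  proof (rule M_maps_agree[OF _ _ po _ \<xi>])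
    have \<sigma>M: "\<sigma> \<in> M_set P" using \<sigma> simple_valuations_subset_M[of P] by blast
    show "scott_continuous (M_dcpo P) P (\<lambda>\<xi>. beta (mix P r \<sigma> \<xi>))"
      by (rule scott_continuous_comp[OF mix_continuous_right[OF r \<sigma>M] beta_continuous])
    show "scott_continuous (M_dcpo P) P (\<lambda>\<xi>. pl r (beta \<sigma>) (beta \<xi>))"
      by (rule scott_continuous_comp[OF beta_continuous pl_continuous_right[OF r beta_in[OF \<sigma>M]]])
  qed (rule beta_mix_simple[OF r \<sigma>])
  show ?thesis
  proof (rule M_maps_agree[OF _ _ po _ \<nu>])
    show "scott_continuous (M_dcpo P) P (\<lambda>\<nu>. beta (mix P r \<nu> \<xi>))"
      by (rule scott_continuous_comp[OF mix_continuous_left[OF r \<xi>] beta_continuous])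
    show "scott_continuous (M_dcpo P) P (\<lambda>\<nu>. pl r (beta \<nu>) (beta \<xi>))"
      by (rule scott_continuous_comp[OF beta_continuous pl_continuous_left[OF r beta_in[OF \<xi>]]])
  qed (rule *)
qed

lemma beta_zero: "beta (zero_val P) = bt K"
proof -
  have "weights {} (\<lambda>_::nat. 0) (\<lambda>_. bt K)" by (simp add: weights_def)
  from beta_simple_val[OF this] show ?thesis
    unfolding zero_val_eq_simple_val[of P "\<lambda>_::nat. 0" "\<lambda>_. bt K"] bary_empty .
qed

lemma beta_dirac: "a \<in> A \<Longrightarrow> beta (dirac P a) = a"
  unfolding dirac_eq_simple_val[of P a "0::nat"]
  by (subst beta_simple_val) (auto simp: weights_def bary_single)

text \<open>On a simple valuation over \<open>M P\<close>, the multiplication is a barycentre in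
  \<open>M P\<close>, while the image under \<open>beta\<close> is the simple valuation at the
  values of \<open>beta\<close>. The law thus says that \<open>beta\<close> preserves finite
  barycentres, which is its linearity.\<close>

lemma beta_mult:
  assumes "\<pi> \<in> M_set (M_dcpo P)"
  shows "beta (M_mult P \<pi>) = beta (M_map (M_dcpo P) P beta \<pi>)"
proof (rule M_maps_agree[OF _ _ po _ assms])
  show "scott_continuous (M_dcpo (M_dcpo P)) P (\<lambda>\<pi>. beta (M_mult P \<pi>))"
    by (rule scott_continuous_comp[OF M_mult_continuous beta_continuous])
  show "scott_continuous (M_dcpo (M_dcpo P)) P (\<lambda>\<pi>. beta (M_map (M_dcpo P) P beta \<pi>))"
    by (rule scott_continuous_comp[OF M_map_continuous[OF beta_continuous] beta_continuous])
  fix \<sigma> assume "\<sigma> \<in> simple_valuations (M_dcpo P)"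
  then obtain n :: nat and c x where \<sigma>: "\<sigma> = simple_val (M_dcpo P) {..<n} c x"
    "\<And>i. i < n \<Longrightarrow> 0 < c i" "\<And>i. i < n \<Longrightarrow> x i \<in> Field (M_dcpo P)" "(\<Sum>i<n. c i) \<le> 1"
    by (rule simple_valuationsE) blast
  have x: "x i \<in> M_set P" if "i < n" for i using \<sigma>(3)[OF that] by simp
  interpret M: pointed_barycentric "M_set P" "M_pl P" "zero_val P" by (rule pointed_barycentric_M)
  have wM: "M.weights {..<n} c x" using \<sigma>(2,4) x by (auto simp: M.weights_def less_imp_le)
  have w: "weights {..<n} c (\<lambda>i. beta (x i))" using \<sigma>(2,4) x beta_in by (auto simp: weights_def less_imp_le)
  have "M_mult P \<sigma> = M.bary {..<n} c x"
    unfolding \<sigma>(1) using \<sigma>(2,4) x M_mult_simple_val[of "{..<n}" x P c] bary_M[of "{..<n}" c x P]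
    by (simp add: less_imp_le)
  moreover have "beta (M.bary {..<n} c x) = bary {..<n} c (\<lambda>i. beta (x i))"
    by (rule bary_hom[where f = beta, OF pointed_barycentric_M pointed_barycentric_axioms _ beta_zero _ wM])
      (auto simp: beta_in M_pl_eq beta_mix)
  moreover have "M_map (M_dcpo P) P beta \<sigma> = simple_val P {..<n} c (\<lambda>i. beta (x i))"
    unfolding \<sigma>(1) using \<sigma>(3) by (intro M_map_simple_val[OF beta_continuous]) auto
  ultimately show "beta (M_mult P \<sigma>) = beta (M_map (M_dcpo P) P beta \<sigma>)"
    using beta_simple_val[OF w] by simp
qed

lemma em_algebra_beta: "em_algebra (P, beta)"
  unfolding em_algebra_def
  using D beta_continuous beta_dirac beta_mult by (auto simp: beta_def)

end


section \<open>Algebras and Kegelspitzen\<close>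

lemma M_map_zero: "scott_continuous P Q f \<Longrightarrow> M_map P Q f (zero_val P) = zero_val Q"
  unfolding M_map_def zero_val_def by (rule restrict_ext) (simp add: scott_opens_vimage)

lemma M_map_mix:
  "scott_continuous P Q f \<Longrightarrow> M_map P Q f (mix P r \<nu> \<xi>) = mix Q r (M_map P Q f \<nu>) (M_map P Q f \<xi>)"
  unfolding M_map_def mix_def by (rule restrict_ext) (simp add: scott_opens_vimage)

lemma M_map_ident:
  assumes "\<nu> \<in> M_set P"
  shows "M_map P P (\<lambda>x\<in>Field P. x) \<nu> = \<nu>"
proof (rule valuation_eqI[of _ P])
  fix U assume U: "U \<in> scott_opens P"
  then have "{x \<in> Field P. (\<lambda>x\<in>Field P. x) x \<in> U} = U" using scott_opens_subset[OF U] by auto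
  then show "M_map P P (\<lambda>x\<in>Field P. x) \<nu> U = \<nu> U" using U by (simp add: M_map_def)
qed (simp_all add: M_map_def M_set_ext[OF assms])

lemma M_map_compose:
  assumes f: "scott_continuous P Q f" and g: "scott_continuous Q R g"
  shows "M_map P R (compose (Field P) g f) \<nu> = M_map Q R g (M_map P Q f \<nu>)"
  unfolding M_map_def
proof (rule restrict_ext)
  fix V assume V: "V \<in> scott_opens R"
  have "{x \<in> Field P. compose (Field P) g f x \<in> V} = {x \<in> Field P. f x \<in> {y \<in> Field Q. g y \<in> V}}"
    using scott_continuous_in[OF f] by (auto simp: compose_eq)
  then show "\<nu> {x \<in> Field P. compose (Field P) g f x \<in> V}
      = (\<lambda>V\<in>scott_opens Q. \<nu> {x \<in> Field P. f x \<in> V}) {y \<in> Field Q. g y \<in> V}"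
    using scott_opens_vimage[OF g V] by simp
qed

lemma scott_continuous_compose:
  assumes f: "scott_continuous P Q f" and g: "scott_continuous Q R g"
  shows "scott_continuous P R (compose (Field P) g f)"
  by (rule scott_continuous_cong[OF scott_continuous_comp[OF f g]]) (simp add: compose_eq)

lemma scott_continuous_restrict_ident: "scott_continuous P P (\<lambda>x\<in>Field P. x)"
  by (rule scott_continuous_cong[OF scott_continuous_ident]) simp

section \<open>Passage between algebras and Kegelspitzen\<close>

definition kegel_of :: "'a em_object \<Rightarrow> 'a kegel" where
  "kegel_of X = \<lparr>ord = fst X,
     plus_op = (\<lambda>r\<in>{0..1}. \<lambda>a\<in>Field (fst X). \<lambda>b\<in>Field (fst X).
       snd X (mix (fst X) r (dirac (fst X) a) (dirac (fst X) b))),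
     bt = snd X (zero_val (fst X))\<rparr>"

definition em_of :: "'a kegel \<Rightarrow> 'a em_object" where
  "em_of K = (ord K, cont_kegelspitze.beta K)"

locale em_alg =
  fixes P :: "'a rel" and \<beta> :: "('a set \<Rightarrow> real) \<Rightarrow> 'a"
  assumes em: "em_algebra (P, \<beta>)"
begin

lemma D: "continuous_domain P"
  and \<beta>_ext: "\<beta> \<in> extensional (M_set P)"
  and \<beta>_continuous: "scott_continuous (M_dcpo P) P \<beta>"
  and \<beta>_dirac: "x \<in> Field P \<Longrightarrow> \<beta> (dirac P x) = x"
  and \<beta>_mult: "\<pi> \<in> M_set (M_dcpo P) \<Longrightarrow> \<beta> (M_mult P \<pi>) = \<beta> (M_map (M_dcpo P) P \<beta> \<pi>)"
  using em by (simp_all add: em_algebra_def)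

lemma po: "Partial_order P"
  by (rule continuous_domain_po[OF D])

lemma \<beta>_in: "\<nu> \<in> M_set P \<Longrightarrow> \<beta> \<nu> \<in> Field P"
  using scott_continuous_in[OF \<beta>_continuous] by simp

abbreviation K where "K \<equiv> kegel_of (P, \<beta>)"

lemma ord_K [simp]: "ord K = P"
  and bt_K [simp]: "bt K = \<beta> (zero_val P)"
  by (simp_all add: kegel_of_def)

lemma plus_K:
  "0 \<le> r \<Longrightarrow> r \<le> 1 \<Longrightarrow> a \<in> Field P \<Longrightarrow> b \<in> Field P \<Longrightarrow>
   plus_op K r a b = \<beta> (mix P r (dirac P a) (dirac P b))"
  by (simp add: kegel_of_def)

text \<open>The Eilenberg--Moore law for \<open>r \<delta>\<^sub>\<nu> + (1 - r) \<delta>\<^sub>\<xi>\<close>.\<close>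

lemma \<beta>_mix:
  assumes r: "0 \<le> r" "r \<le> 1" and \<nu>: "\<nu> \<in> M_set P" and \<xi>: "\<xi> \<in> M_set P"
  shows "\<beta> (mix P r \<nu> \<xi>) = plus_op K r (\<beta> \<nu>) (\<beta> \<xi>)"
proof -
  let ?I = "{0::nat} <+> {0::nat}" and ?c = "case_sum (\<lambda>_. r) (\<lambda>_. 1 - r)"
  let ?x = "case_sum (\<lambda>_. \<nu>) (\<lambda>_. \<xi>)"
  define \<pi> where "\<pi> = simple_val (M_dcpo P) ?I ?c ?x"
  have x: "?x i \<in> M_set P" if "i \<in> ?I" for i using that \<nu> \<xi> by auto
  have \<pi>: "\<pi> \<in> M_set (M_dcpo P)"
    unfolding \<pi>_def using r \<nu> \<xi> by (intro simple_val_in_M) (auto simp: sum.Plus)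
  have "M_mult P \<pi> = mix P r \<nu> \<xi>"
    unfolding \<pi>_def mix_def using M_mult_simple_val[of ?I ?x P ?c] x by (simp add: sum.Plus)
  moreover have "M_map (M_dcpo P) P \<beta> \<pi> = mix P r (dirac P (\<beta> \<nu>)) (dirac P (\<beta> \<xi>))"
  proof -
    have "M_map (M_dcpo P) P \<beta> \<pi> = simple_val P ?I ?c (\<lambda>i. \<beta> (?x i))"
      unfolding \<pi>_def by (rule M_map_simple_val[OF \<beta>_continuous]) (use x in simp)
    also have "(\<lambda>i. \<beta> (?x i)) = case_sum (\<lambda>_. \<beta> \<nu>) (\<lambda>_. \<beta> \<xi>)"
      by (rule ext) (simp split: sum.split)
    finally show ?thesis
      unfolding dirac_eq_simple_val[of P _ "0::nat"] by (simp add: mix_simple_val)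
  qed
  ultimately show ?thesis using \<beta>_mult[OF \<pi>] plus_K[OF r \<beta>_in[OF \<nu>] \<beta>_in[OF \<xi>]] by simp
qed

text \<open>The map \<open>\<beta>\<close> preserves the operations and is onto, since
  \<open>\<beta> (dirac P a) = a\<close>. The equational laws of \<open>M_set P\<close> pass to this
  homomorphic image.\<close>

lemma barycentric_K: "barycentric_algebra (Field P) (plus_op K)"
proof -
  interpret M: pointed_barycentric "M_set P" "M_pl P" "zero_val P" by (rule pointed_barycentric_M)
  have plus: "plus_op K r (\<beta> \<nu>) (\<beta> \<xi>) = \<beta> (M_pl P r \<nu> \<xi>)"
    if "0 \<le> r" "r \<le> 1" "\<nu> \<in> M_set P" "\<xi> \<in> M_set P" for r \<nu> \<xi>
    using that \<beta>_mix by (simp add: M_pl_eq)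
  have rep: "\<exists>\<nu>\<in>M_set P. a = \<beta> \<nu>" if "a \<in> Field P" for a
    using \<beta>_dirac[OF that] dirac_in_M[OF that] by metis
  show ?thesis
    unfolding barycentric_algebra_def
  proof (intro conjI ballI)
    show "plus_op K \<in> {0..1} \<rightarrow>\<^sub>E Field P \<rightarrow>\<^sub>E Field P \<rightarrow>\<^sub>E Field P"
    proof -
      have "plus_op K = (\<lambda>r\<in>{0..1}. \<lambda>a\<in>Field P. \<lambda>b\<in>Field P. \<beta> (mix P r (dirac P a) (dirac P b)))"
        by (simp add: kegel_of_def)
      then show ?thesis
        by (simp only: restrict_PiE_iff) (auto intro!: \<beta>_in mix_in_M dirac_in_M)
    qed
  next
    fix a b assume "a \<in> Field P" "b \<in> Field P"
    then obtain \<nu> \<xi> where "\<nu> \<in> M_set P" "\<xi> \<in> M_set P" "a = \<beta> \<nu>" "b = \<beta> \<xi>" using rep by metis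
    then show "plus_op K 1 a b = a" by (simp add: plus M.pl_one)
  next
    fix r :: real and a b assume r: "r \<in> {0..1}" and "a \<in> Field P" "b \<in> Field P"
    then obtain \<nu> \<xi> where "\<nu> \<in> M_set P" "\<xi> \<in> M_set P" "a = \<beta> \<nu>" "b = \<beta> \<xi>" using rep by metis
    then show "plus_op K r a b = plus_op K (1 - r) b a"
      using r M.pl_commute[of r \<nu> \<xi>] by (simp add: plus)
  next
    fix r :: real and a assume r: "r \<in> {0..1}" and "a \<in> Field P"
    then obtain \<nu> where "\<nu> \<in> M_set P" "a = \<beta> \<nu>" using rep by metis
    then show "plus_op K r a a = a" using r by (simp add: plus M.pl_idem)
  next
    fix p r :: real and a b c
    assume pr: "p \<in> {0..<1}" "r \<in> {0..<1}" and abc: "a \<in> Field P" "b \<in> Field P" "c \<in> Field P"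
    obtain \<nu> \<xi> \<zeta> where *: "\<nu> \<in> M_set P" "\<xi> \<in> M_set P" "\<zeta> \<in> M_set P" "a = \<beta> \<nu>" "b = \<beta> \<xi>" "c = \<beta> \<zeta>"
      using rep[OF abc(1)] rep[OF abc(2)] rep[OF abc(3)] by blast
    have "0 \<le> p * r" "p * r \<le> 1" "p * r \<le> r" using pr by (auto simp: mult_le_one mult_left_le_one_le)
    moreover then have "0 \<le> (r - p * r) / (1 - p * r)" "(r - p * r) / (1 - p * r) \<le> 1"
      using pr by (auto simp: divide_le_eq_1)
    ultimately show "plus_op K r (plus_op K p a b) c = plus_op K (p * r) a (plus_op K ((r - p * r) / (1 - p * r)) b c)"
      using pr * M.pl_assoc[of p r \<nu> \<xi> \<zeta>] by (simp add: plus M.pl_in)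
  qed
qed

lemma plus_K_continuous_left:
  assumes r: "0 \<le> r" "r \<le> 1" and b: "b \<in> Field P"
  shows "scott_continuous P P (\<lambda>a. plus_op K r a b)"
proof (rule scott_continuous_cong)
  show "scott_continuous P P (\<lambda>a. \<beta> (mix P r (dirac P a) (dirac P b)))"
    by (rule scott_continuous_comp[OF scott_continuous_comp[OF dirac_continuous[OF po]
            mix_continuous_left[OF r dirac_in_M[OF b]]] \<beta>_continuous])
qed (use r b in \<open>simp add: plus_K\<close>)

lemma plus_K_continuous_right:
  assumes r: "0 \<le> r" "r \<le> 1" and a: "a \<in> Field P"
  shows "scott_continuous P P (\<lambda>b. plus_op K r a b)"
proof (rule scott_continuous_cong)
  show "scott_continuous P P (\<lambda>b. \<beta> (mix P r (dirac P a) (dirac P b)))"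
    by (rule scott_continuous_comp[OF scott_continuous_comp[OF dirac_continuous[OF po]
            mix_continuous_right[OF r dirac_in_M[OF a]]] \<beta>_continuous])
qed (use r a in \<open>simp add: plus_K\<close>)

text \<open>By definition the second argument enters through the Dirac valuation at
  \<open>\<beta> (zero_val P)\<close>; \<open>\<beta>_mix\<close> exchanges it for the zero
  valuation. Monotonicity in \<open>r\<close> is then evident, whereas with the Dirac valuation it
  would presuppose that this point is least.\<close>

lemma scale_K_continuous:
  assumes a: "a \<in> Field P"
  shows "scott_continuous unit_interval P (\<lambda>r. plus_op K r a (\<beta> (zero_val P)))"
proof (rule scott_continuous_cong)
  show "scott_continuous unit_interval P (\<lambda>r. \<beta> (mix P r (dirac P a) (zero_val P)))"
    by (rule scott_continuous_comp[OF scale_continuous_M[OF dirac_in_M[OF a]] \<beta>_continuous])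
  fix r assume "r \<in> Field unit_interval"
  then show "\<beta> (mix P r (dirac P a) (zero_val P)) = plus_op K r a (\<beta> (zero_val P))"
    using \<beta>_mix[of r "dirac P a" "zero_val P"] dirac_in_M[OF a] zero_val_in_M[of P] \<beta>_dirac[OF a] by simp
qed

lemma continuous_kegelspitze_K: "continuous_kegelspitze K"
proof -
  have "\<beta> (zero_val P) \<in> Field P" by (rule \<beta>_in[OF zero_val_in_M])
  then show ?thesis
    unfolding continuous_kegelspitze_def kegelspitze_def scale_def ord_K bt_K
    using D barycentric_K plus_K_continuous_left plus_K_continuous_right scale_K_continuous
    by (simp add: continuous_domain_def)
qed

text \<open>On a simple valuation, \<open>\<beta>\<close> is the barycentre of its values at the
  Dirac valuations, that is, of the points themselves, and so is the structure constructed from the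
  operations. Both are continuous, hence equal.\<close>

lemma em_of_K: "em_of K = (P, \<beta>)"
proof -
  interpret E: cont_kegelspitze K by unfold_locales (rule continuous_kegelspitze_K)
  have "E.beta = \<beta>"
  proof (rule extensionalityI[of _ "M_set P"])
    show "E.beta \<in> extensional (M_set P)" unfolding E.beta_def by simp
    show "\<beta> \<in> extensional (M_set P)" by (rule \<beta>_ext)
    fix \<nu> assume \<nu>: "\<nu> \<in> M_set P"
    show "E.beta \<nu> = \<beta> \<nu>"
    proof (rule M_maps_agree[OF _ \<beta>_continuous po _ \<nu>])
      show "scott_continuous (M_dcpo P) P E.beta" using E.beta_continuous by simp
      fix \<sigma> assume "\<sigma> \<in> simple_valuations P"
      then obtain n :: nat and c x where \<sigma>: "\<sigma> = simple_val P {..<n} c x" and w: "E.weights {..<n} c x"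
        using E.simple_valuations_weights[of \<sigma>] by auto
      have F: "\<And>i. i \<in> {..<n} \<Longrightarrow> 0 \<le> c i \<and> x i \<in> Field P" "sum c {..<n} \<le> 1"
        using w unfolding E.weights_def by auto
      interpret M: pointed_barycentric "M_set P" "M_pl P" "zero_val P" by (rule pointed_barycentric_M)
      have wM: "M.weights {..<n} c (\<lambda>i. dirac P (x i))"
        using F by (auto simp: M.weights_def dirac_in_M)
      have "\<beta> \<sigma> = \<beta> (M.bary {..<n} c (\<lambda>i. dirac P (x i)))"
        unfolding \<sigma> using simple_val_eq_bary[of "{..<n}" c x P] F by simp
      also have "\<dots> = E.bary {..<n} c (\<lambda>i. \<beta> (dirac P (x i)))"
        by (rule bary_hom[where f = \<beta>, OF pointed_barycentric_M E.pointed_barycentric_axioms _ _ _ wM])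
          (auto simp: \<beta>_in M_pl_eq \<beta>_mix)
      also have "\<dots> = E.bary {..<n} c x"
        using F by (intro E.bary_cong) (auto simp: \<beta>_dirac)
      also have "\<dots> = E.beta \<sigma>" unfolding \<sigma> using E.beta_simple_val[OF w] by simp
      finally show "E.beta \<sigma> = \<beta> \<sigma>" by simp
    qed
  qed
  then show ?thesis by (simp add: em_of_def)
qed

end

context cont_kegelspitze
begin

text \<open>For arguments in range this is linearity of \<open>beta\<close> at Dirac valuations. The
  remaining cases compare the values \<open>undefined\<close> of two extensional operations,
  argument by argument.\<close>

lemma kegel_of_em_of: "kegel_of (em_of K) = K"
proof -
  have "(\<lambda>r\<in>{0..1}. \<lambda>a\<in>A. \<lambda>b\<in>A. beta (mix P r (dirac P a) (dirac P b))) = pl"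
  proof (intro ext)
    fix r a b
    have ext: "pl \<in> {0..1} \<rightarrow>\<^sub>E A \<rightarrow>\<^sub>E A \<rightarrow>\<^sub>E A" using bary_alg by (simp add: barycentric_algebra_def)
    show "(\<lambda>r\<in>{0..1}. \<lambda>a\<in>A. \<lambda>b\<in>A. beta (mix P r (dirac P a) (dirac P b))) r a b = pl r a b"
    proof (cases "r \<in> {0..1}")
      case r: True
      have pr: "pl r \<in> A \<rightarrow>\<^sub>E A \<rightarrow>\<^sub>E A" using PiE_mem[OF ext r] .
      show ?thesis
      proof (cases "a \<in> A")
        case a: True
        have pa: "pl r a \<in> A \<rightarrow>\<^sub>E A" using PiE_mem[OF pr a] .
        show ?thesis
        proof (cases "b \<in> A")
          case b: True
          show ?thesis using r a b by (simp add: beta_mix dirac_in_M beta_dirac)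
        next
          case False
          then show ?thesis using r a PiE_arb[OF pa False] by simp
        qed
      next
        case False
        then show ?thesis using r PiE_arb[OF pr False] by simp
      qed
    next
      case False
      show ?thesis unfolding restrict_apply if_not_P[OF False] PiE_arb[OF ext False] ..
    qed
  qed
  then show ?thesis by (simp add: kegel_of_def em_of_def beta_zero)
qed

end

text \<open>The homomorphism law at \<open>mix P r (dirac P a) (dirac P b)\<close> is preservation
  of the operation with parameter \<open>r\<close>; at the zero valuation it is preservation of
  bottom.\<close>

lemma em_hom_linear:
  assumes "em_algebra X" "em_algebra Y" and f: "f \<in> em_hom X Y"
  shows "f \<in> extensional (Field (fst X)) \<and> scott_continuous (fst X) (fst Y) f \<and>
    linear_map (kegel_of X) (kegel_of Y) f"
proof -
  obtain P \<beta> Q \<gamma> where X: "X = (P, \<beta>)" and Y: "Y = (Q, \<gamma>)" by fastforce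
  interpret X: em_alg P \<beta> using assms X by unfold_locales simp
  interpret Y: em_alg Q \<gamma> using assms Y by unfold_locales simp
  have f: "f \<in> extensional (Field P)" "scott_continuous P Q f"
    and fh: "\<And>\<nu>. \<nu> \<in> M_set P \<Longrightarrow> f (\<beta> \<nu>) = \<gamma> (M_map P Q f \<nu>)"
    using f by (auto simp: em_hom_def X Y)
  note fin = scott_continuous_in[OF f(2)]
  have "f (plus_op X.K r a b) = plus_op Y.K r (f a) (f b)"
    if "r \<in> {0..1}" "a \<in> Field P" "b \<in> Field P" for r a b
    using that fin[OF that(2)] fin[OF that(3)]
    by (simp add: X.plus_K Y.plus_K fh mix_in_M dirac_in_M M_map_mix[OF f(2)] M_map_dirac[OF f(2)])
  moreover have "f (\<beta> (zero_val P)) = \<gamma> (zero_val Q)"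
    using fh[OF zero_val_in_M] M_map_zero[OF f(2)] by simp
  ultimately show ?thesis using f fin by (simp add: X Y linear_map_def)
qed

text \<open>Both sides of the homomorphism law are Scott-continuous in \<open>\<nu>\<close>, and on
  simple valuations the law is preservation of finite barycentres, which linearity gives by
  \<open>bary_hom\<close>.\<close>

lemma linear_em_hom:
  assumes "continuous_kegelspitze K" "continuous_kegelspitze L"
    and f: "f \<in> extensional (Field (ord K))" "scott_continuous (ord K) (ord L) f" "linear_map K L f"
  shows "f \<in> em_hom (em_of K) (em_of L)"
proof -
  interpret K: cont_kegelspitze K using assms by unfold_locales
  interpret L: cont_kegelspitze L using assms by unfold_locales
  have "f (K.beta \<nu>) = L.beta (M_map K.P L.P f \<nu>)" if \<nu>: "\<nu> \<in> M_set K.P" for \<nu>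
  proof (rule M_maps_agree[OF _ _ L.po _ \<nu>])
    show "scott_continuous (M_dcpo K.P) L.P (\<lambda>\<nu>. f (K.beta \<nu>))"
      by (rule scott_continuous_comp[OF K.beta_continuous f(2)])
    show "scott_continuous (M_dcpo K.P) L.P (\<lambda>\<nu>. L.beta (M_map K.P L.P f \<nu>))"
      by (rule scott_continuous_comp[OF M_map_continuous[OF f(2)] L.beta_continuous])
    fix \<sigma> assume "\<sigma> \<in> simple_valuations K.P"
    then obtain n :: nat and c x where \<sigma>: "\<sigma> = simple_val K.P {..<n} c x" and w: "K.weights {..<n} c x"
      by (rule K.simple_valuations_weights)
    have w': "L.weights {..<n} c (\<lambda>i. f (x i))"
      using w scott_continuous_in[OF f(2)] by (auto simp: K.weights_def L.weights_def)
    have "f (K.bary {..<n} c x) = L.bary {..<n} c (\<lambda>i. f (x i))"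
      by (rule bary_hom[where f = f, OF K.pointed_barycentric_axioms L.pointed_barycentric_axioms _ _ _ w])
        (use f(3) in \<open>auto simp: linear_map_def\<close>)
    moreover have "M_map K.P L.P f \<sigma> = simple_val L.P {..<n} c (\<lambda>i. f (x i))"
      unfolding \<sigma> using w by (intro M_map_simple_val[OF f(2)]) (auto simp: K.weights_def)
    ultimately show "f (K.beta \<sigma>) = L.beta (M_map K.P L.P f \<sigma>)"
      using K.beta_simple_val[OF w] L.beta_simple_val[OF w'] \<sigma> by simp
  qed
  then show ?thesis using f by (simp add: em_hom_def em_of_def)
qed

section \<open>The two categories and their isomorphism\<close>

lemma category_DOM_M: "category (DOM_M :: ('a em_object, 'a \<Rightarrow> 'a) cat)"
  unfolding category_def
proof (intro conjI ballI)
  fix X :: "'a em_object" assume "X \<in> Ob DOM_M"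
  obtain P \<beta> where X: "X = (P, \<beta>)" by fastforce
  interpret em_alg P \<beta> using \<open>X \<in> _\<close> by unfold_locales (simp add: DOM_M_def X)
  show "Ident DOM_M X \<in> Hom DOM_M X X"
    using \<beta>_in by (simp add: DOM_M_def X em_hom_def scott_continuous_restrict_ident M_map_ident)
next
  fix X Y Z :: "'a em_object" and f g
  assume fg: "f \<in> Hom DOM_M X Y" "g \<in> Hom DOM_M Y Z" and "X \<in> Ob DOM_M"
  obtain P \<beta> Q \<gamma> R \<delta> where X: "X = (P, \<beta>)" "Y = (Q, \<gamma>)" "Z = (R, \<delta>)" by fastforce
  interpret em_alg P \<beta> using \<open>X \<in> _\<close> by unfold_locales (simp add: DOM_M_def X)
  have f: "scott_continuous P Q f" "\<And>\<nu>. \<nu> \<in> M_set P \<Longrightarrow> f (\<beta> \<nu>) = \<gamma> (M_map P Q f \<nu>)"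
    and g: "scott_continuous Q R g" "\<And>\<nu>. \<nu> \<in> M_set Q \<Longrightarrow> g (\<gamma> \<nu>) = \<delta> (M_map Q R g \<nu>)"
    using fg by (auto simp: DOM_M_def X em_hom_def)
  have "compose (Field P) g f (\<beta> \<nu>) = \<delta> (M_map P R (compose (Field P) g f) \<nu>)" if \<nu>: "\<nu> \<in> M_set P" for \<nu>
  proof -
    \<comment> \<open>The law for \<open>g\<close> is used at the image valuation, which therefore
      has to lie in \<open>M_set Q\<close>.\<close>
    have "M_map P Q f \<nu> \<in> M_set Q" using scott_continuous_in[OF M_map_continuous[OF f(1)]] \<nu> by simp
    then show ?thesis using f(2)[OF \<nu>] g(2) M_map_compose[OF f(1) g(1)] \<beta>_in[OF \<nu>] by (simp add: compose_eq)
  qed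
  then show "Comp DOM_M X Y Z g f \<in> Hom DOM_M X Z"
    using scott_continuous_compose[OF f(1) g(1)] by (simp add: DOM_M_def X em_hom_def)
next
  fix X Y :: "'a em_object" and f
  assume "f \<in> Hom DOM_M X Y"
  then have f: "f \<in> extensional (Field (fst X))" "scott_continuous (fst X) (fst Y) f"
    by (auto simp: DOM_M_def em_hom_def split: prod.splits)
  show "Comp DOM_M X X Y f (Ident DOM_M X) = f"
    by (rule extensionalityI[OF _ f(1)]) (auto simp: DOM_M_def compose_eq)
  show "Comp DOM_M X Y Y (Ident DOM_M Y) f = f"
    by (rule extensionalityI[OF _ f(1)]) (auto simp: DOM_M_def compose_eq scott_continuous_in[OF f(2)])
next
  fix W X Y Z :: "'a em_object" and f g h
  assume "f \<in> Hom DOM_M W X"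
  then have "scott_continuous (fst W) (fst X) f" by (auto simp: DOM_M_def em_hom_def split: prod.splits)
  then have "f \<in> Field (fst W) \<rightarrow> Field (fst X)" by (simp add: scott_continuous_def)
  then show "Comp DOM_M W Y Z h (Comp DOM_M W X Y g f) = Comp DOM_M W X Z (Comp DOM_M X Y Z h g) f"
    by (simp add: DOM_M_def compose_assoc)
qed

lemma category_CKS: "category (CKS :: ('a kegel, 'a \<Rightarrow> 'a) cat)"
  unfolding category_def
proof (intro conjI ballI)
  fix K :: "'a kegel" assume "K \<in> Ob CKS"
  then interpret cont_kegelspitze K by unfold_locales (simp add: CKS_def)
  show "Ident CKS K \<in> Hom CKS K K"
    using bot_in pl_in by (simp add: CKS_def scott_continuous_restrict_ident linear_map_def)
next
  fix K L N :: "'a kegel" and f g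
  assume fg: "f \<in> Hom CKS K L" "g \<in> Hom CKS L N" and "K \<in> Ob CKS"
  then interpret cont_kegelspitze K by unfold_locales (simp add: CKS_def)
  have f: "scott_continuous (ord K) (ord L) f" "linear_map K L f"
    and g: "scott_continuous (ord L) (ord N) g" "linear_map L N g"
    using fg by (auto simp: CKS_def)
  have "linear_map K N (compose A g f)"
    using f(2) g(2) bot_in pl_in by (auto simp: linear_map_def compose_eq Pi_iff)
  then show "Comp CKS K L N g f \<in> Hom CKS K N"
    using scott_continuous_compose[OF f(1) g(1)] by (simp add: CKS_def)
next
  fix K L :: "'a kegel" and f
  assume "f \<in> Hom CKS K L"
  then have f: "f \<in> extensional (Field (ord K))" "scott_continuous (ord K) (ord L) f"
    by (auto simp: CKS_def)
  show "Comp CKS K K L f (Ident CKS K) = f"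
    by (rule extensionalityI[OF _ f(1)]) (auto simp: CKS_def compose_eq)
  show "Comp CKS K L L (Ident CKS L) f = f"
    by (rule extensionalityI[OF _ f(1)]) (auto simp: CKS_def compose_eq scott_continuous_in[OF f(2)])
next
  fix K L M N :: "'a kegel" and f g h
  assume "f \<in> Hom CKS K L"
  then have "f \<in> Field (ord K) \<rightarrow> Field (ord L)" by (simp add: CKS_def scott_continuous_def)
  then show "Comp CKS K M N h (Comp CKS K L M g f) = Comp CKS K L N (Comp CKS L M N h g) f"
    by (simp add: CKS_def compose_assoc)
qed

lemma kegel_of_object: "em_algebra X \<Longrightarrow> continuous_kegelspitze (kegel_of X)"
  and em_of_kegel_of: "em_algebra X \<Longrightarrow> em_of (kegel_of X) = X"
  using em_alg.continuous_kegelspitze_K[of "fst X" "snd X"] em_alg.em_of_K[of "fst X" "snd X"]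
  by (simp_all add: em_alg_def)

lemma em_of_object: "continuous_kegelspitze K \<Longrightarrow> em_algebra (em_of K)"
  and kegel_of_em_of: "continuous_kegelspitze K \<Longrightarrow> kegel_of (em_of K) = K"
  using cont_kegelspitze.em_algebra_beta[of K] cont_kegelspitze.kegel_of_em_of[of K]
  by (simp_all add: cont_kegelspitze_def em_of_def)

theorem theorem3p26:
  shows "isomorphic_categories
           (DOM_M :: ('a em_object, 'a \<Rightarrow> 'a) cat)
           (CKS :: ('a kegel, 'a \<Rightarrow> 'a) cat)"
proof -
  \<comment> \<open>Both functors are the identity on maps: they leave the order, hence the carrier,
    unchanged, and the two notions of morphism select the same functions.\<close>
  let ?id = "\<lambda>_ _ f. f"
  have ord: "ord (kegel_of X) = fst X" for X :: "'a em_object" by (simp add: kegel_of_def)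
  have "is_functor (DOM_M :: ('a em_object, 'a \<Rightarrow> 'a) cat) CKS kegel_of ?id"
    unfolding is_functor_def
  proof (intro conjI ballI)
    fix X Y :: "'a em_object" and f
    assume "X \<in> Ob DOM_M" "Y \<in> Ob DOM_M" "f \<in> Hom DOM_M X Y"
    then show "f \<in> Hom CKS (kegel_of X) (kegel_of Y)"
      using em_hom_linear[of X Y f] by (simp add: DOM_M_def CKS_def ord)
  qed (simp_all add: DOM_M_def CKS_def ord kegel_of_object)
  moreover have "is_functor (CKS :: ('a kegel, 'a \<Rightarrow> 'a) cat) DOM_M em_of ?id"
    unfolding is_functor_def
  proof (intro conjI ballI)
    fix K L :: "'a kegel" and f
    assume "K \<in> Ob CKS" "L \<in> Ob CKS" "f \<in> Hom CKS K L"
    then show "f \<in> Hom DOM_M (em_of K) (em_of L)"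
      using linear_em_hom[of K L f] by (simp add: DOM_M_def CKS_def)
  next
    show "em_of K \<in> Ob DOM_M" if "K \<in> Ob CKS" for K :: "'a kegel"
      using that em_of_object[of K] by (simp add: DOM_M_def CKS_def)
  qed (simp_all add: DOM_M_def CKS_def em_of_def)
  moreover have "\<forall>X\<in>Ob (DOM_M :: ('a em_object, 'a \<Rightarrow> 'a) cat). em_of (kegel_of X) = X"
    using em_of_kegel_of by (auto simp: DOM_M_def)
  moreover have "\<forall>K\<in>Ob (CKS :: ('a kegel, 'a \<Rightarrow> 'a) cat). kegel_of (em_of K) = K"
    using kegel_of_em_of by (auto simp: CKS_def)
  ultimately show ?thesis
    unfolding isomorphic_categories_def using category_DOM_M category_CKS
    by (intro conjI exI[of _ kegel_of] exI[of _ ?id] exI[of _ em_of]) auto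
qed

end
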